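(* The following decision problem is NP-complete: given an instance of the Integrated Last-Mile Transportation Problem with a single destination per trip (ILMTP-SD), decide whether the instance has a feasible solution.
   Context: Instance of the ILMTP-SD (all times are integers; numbers are encoded in the usual way): - A terminal $\mathbf{T}_0$, a finite set $\mathcal{S}$ of stations, and a finite set $\mathcal{C}$ of mass transit trips. Each trip $c\in\mathcal{C}$ stops at all stations of $\mathcal{S}$ and ends at $\mathbf{T}_0$; it leaves station $s$ at time $\tilde t(c,s)$ and arrives at $\mathbf{T}_0$ at time $\tilde t(c)$. Trips are regular: the travel time $\tilde t(c)-\tilde t(c,s)$ from station $s$ to $\mathbf{T}_0$ is the same for all trips $c$. - A finite set $\mathcal{D}$ of destinations (with $\mathbf{T}_0\in\mathcal{D}$ by convention). For each $d\in\mathcal{D}$, nonnegative times $\tau^1(d)$ (travel from $\mathbf{T}_0$ to $d$), $\tau^2(d)$ (stop at $d$), $\tau^3(d)$ (return to $\mathbf{T}_0$), with round-trip time $\tau(d)=\tau^1(d)+\tau^2(d)+\tau^3(d)$. - A time horizon $\mathcal{T}=\{1,\dots,t^{\max}\}$. - A finite set $V$ of commuter vehicles (CVs), each able to carry at most $v^{\mathrm{cap}}\ge 1$ passengers per trip. All CVs are initially at $\mathbf{T}_0$. - A finite set $\mathcal{J}$ of passengers. Each $j\in\mathcal{J}$ has an origin station $s(j)\in\mathcal{S}$, a destination $d(j)\in\mathcal{D}$, and a requested arrival time $t^r(j)$. A time-window length $T_w\ge 0$ common to all passengers. - A weight $\alpha\in[0,1]$ (used only in the objective, irrelevant for feasibility).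 Feasible solution: a partition $\mathsf{g}=\{g_1,\dots,g_\gamma\}$ of $\mathcal{J}$ into nonempty groups together with departure times $t^{\mathsf g}_1,\dots,t^{\mathsf g}_\gamma\in\mathcal{T}$ from $\mathbf{T}_0$ such that, for every $l$: (1) all passengers of $g_l$ have the same destination, denoted $d_l$, and $|g_l|\le v^{\mathrm{cap}}$; (2) every $j\in g_l$ arrives within the time window, i.e. $t^r(j)-T_w\le t^{\mathsf g}_l+\tau^1(d_l)\le t^r(j)+T_w$; (3) there is a trip $c\in\mathcal{C}$ with $\tilde t(c)\le t^{\mathsf g}_l$ (so that passengers can reach $\mathbf{T}_0$ before departure); (4) the CV is back by the end of the horizon: $t^{\mathsf g}_l+\tau(d_l)\le t^{\max}$; and (5) for every $t\in\mathcal{T}$ the number of indices $l$ with $t^{\mathsf g}_l\le t<t^{\mathsf g}_l+\tau(d_l)$ is at most $|V|$ (a CV departing at time $t$ to $d$ is available again at time $t+\tau(d)$). *)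

theory Defs
  imports "HOL-Computational_Algebra.Polynomial" "HOL-Library.Disjoint_Sets"
begin

section \<open>Turing machines and NP-completeness\<close>

text \<open>
  Deterministic multi-tape machines with two-way infinite tapes. The states are the numbers below
  \<open>tm_states M\<close>, where 0 is the initial and 1 the only halting state. The tape symbols are the
  numbers below \<open>tm_symbols M\<close>, where 0 is the blank and 1 and 2 stand for the input bits
  \<open>False\<close> and \<open>True\<close>. The transition function is only ever applied to a state and to a list of
  \<open>tm_tapes M\<close> symbols in these ranges, so it amounts to a finite table.
\<close>

datatype move = Move_Left | Stay | Move_Right

record tm =
  tm_tapes :: nat
  tm_states :: nat
  tm_symbols :: nat
  tm_trans :: "nat \<Rightarrow> nat list \<Rightarrow> nat \<times> (nat \<times> move) list"

definition wf_tm :: "tm \<Rightarrow> bool" where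
  "wf_tm M \<longleftrightarrow> 1 \<le> tm_tapes M \<and> 2 \<le> tm_states M \<and> 3 \<le> tm_symbols M \<and>
     (\<forall>q ss. q < tm_states M \<longrightarrow> length ss = tm_tapes M \<longrightarrow> set ss \<subseteq> {..<tm_symbols M} \<longrightarrow>
        (case tm_trans M q ss of (q', as) \<Rightarrow>
           q' < tm_states M \<and> length as = tm_tapes M \<and> fst ` set as \<subseteq> {..<tm_symbols M}))"

text \<open>A tape is its cell contents together with the head position.\<close>

type_synonym tape = "(int \<Rightarrow> nat) \<times> int"
type_synonym config = "nat \<times> tape list"

fun shift :: "move \<Rightarrow> int" where
  "shift Move_Left = -1"
| "shift Stay = 0"
| "shift Move_Right = 1"

fun read_tape :: "tape \<Rightarrow> nat" where
  "read_tape (T, h) = T h"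

fun act :: "nat \<times> move \<Rightarrow> tape \<Rightarrow> tape" where
  "act (s, m) (T, h) = (T(h := s), h + shift m)"

fun tm_step :: "tm \<Rightarrow> config \<Rightarrow> config" where
  "tm_step M (q, ts) =
     (if q = 1 then (q, ts)
      else case tm_trans M q (map read_tape ts) of (q', as) \<Rightarrow> (q', map2 act as ts))"

definition bit_symbol :: "bool \<Rightarrow> nat" where
  "bit_symbol b = (if b then 2 else 1)"

definition word_tape :: "bool list \<Rightarrow> tape" where
  "word_tape x = ((\<lambda>i. if 0 \<le> i \<and> i < int (length x) then bit_symbol (x ! nat i) else 0), 0)"

definition init_config :: "tm \<Rightarrow> bool list \<Rightarrow> config" where
  "init_config M x = (0, word_tape x # replicate (tm_tapes M - 1) (word_tape []))"

text \<open>
  The output is the word on the first tape that starts at the head and extends to the right up to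
  the first blank.
\<close>

fun tape_output :: "tape \<Rightarrow> bool list \<Rightarrow> bool" where
  "tape_output (T, h) y \<longleftrightarrow>
     (\<forall>i < length y. T (h + int i) = bit_symbol (y ! i)) \<and> T (h + int (length y)) = 0"

text \<open>As halting configurations are fixed by \<open>tm_step\<close>, this says: within at most \<open>n\<close> steps.\<close>

definition tm_computes :: "tm \<Rightarrow> bool list \<Rightarrow> bool list \<Rightarrow> nat \<Rightarrow> bool" where
  "tm_computes M x y n \<longleftrightarrow>
     (\<exists>ts. (tm_step M ^^ n) (init_config M x) = (1, ts) \<and> tape_output (hd ts) y)"

definition polytime :: "(bool list \<Rightarrow> bool list) \<Rightarrow> bool" where
  "polytime f \<longleftrightarrow>
     (\<exists>M (p :: nat poly). wf_tm M \<and> (\<forall>x. tm_computes M x (f x) (poly p (length x))))"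

type_synonym language = "bool list set"

definition polytime_decidable :: "language \<Rightarrow> bool" where
  "polytime_decidable A \<longleftrightarrow> polytime (\<lambda>x. [x \<in> A])"

text \<open>Self-delimiting encoding of lists: every element is preceded by \<open>True\<close>, the end is \<open>False\<close>.\<close>

definition enc_list :: "('a \<Rightarrow> bool list) \<Rightarrow> 'a list \<Rightarrow> bool list" where
  "enc_list e xs = concat (map (\<lambda>x. True # e x) xs) @ [False]"

definition enc_pair :: "bool list \<Rightarrow> bool list \<Rightarrow> bool list" where
  "enc_pair x u = enc_list (\<lambda>b. [b]) x @ u"

definition NP :: "language set" where
  "NP = {A. \<exists>R (p :: nat poly). polytime_decidable R \<and>
          (\<forall>x. x \<in> A \<longleftrightarrow> (\<exists>u. length u \<le> poly p (length x) \<and> enc_pair x u \<in> R))}"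

definition polytime_reducible :: "language \<Rightarrow> language \<Rightarrow> bool" where
  "polytime_reducible A B \<longleftrightarrow> (\<exists>f. polytime f \<and> (\<forall>x. x \<in> A \<longleftrightarrow> f x \<in> B))"

definition NP_hard :: "language \<Rightarrow> bool" where
  "NP_hard B \<longleftrightarrow> (\<forall>A \<in> NP. polytime_reducible A B)"

definition NP_complete :: "language \<Rightarrow> bool" where
  "NP_complete B \<longleftrightarrow> B \<in> NP \<and> NP_hard B"


section \<open>The ILMTP-SD\<close>

text \<open>
  The elements of each finite set of an instance are identified with the numbers from 0 up to its
  cardinality (excluded): trips, destinations and passengers are the positions in the respective
  list. The terminal is the destination 0. Different positions may carry the same data.
\<close>

record trip =
  dep_times :: "int list"  \<comment> \<open>indexed by the stations\<close>
  arr_time :: int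

record destination =
  time_to :: nat      \<comment> \<open>\<open>\<tau>\<^sup>1\<close>\<close>
  time_stop :: nat    \<comment> \<open>\<open>\<tau>\<^sup>2\<close>\<close>
  time_back :: nat    \<comment> \<open>\<open>\<tau>\<^sup>3\<close>\<close>

record passenger =
  origin :: nat
  dest :: nat
  req_time :: int

record ilmtp =
  n_stations :: nat
  trips :: "trip list"
  destinations :: "destination list"
  t_max :: nat
  n_vehicles :: nat
  v_cap :: nat
  passengers :: "passenger list"
  T_w :: nat
  alpha_num :: nat    \<comment> \<open>the weight is the fraction \<open>alpha_num / alpha_den\<close>,\<close>
  alpha_den :: nat    \<comment> \<open>not necessarily in lowest terms\<close>

definition round_trip_time :: "destination \<Rightarrow> nat" where
  "round_trip_time d = time_to d + time_stop d + time_back d"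

definition travel_time :: "trip \<Rightarrow> nat \<Rightarrow> int" where
  "travel_time c s = arr_time c - dep_times c ! s"

definition valid_instance :: "ilmtp \<Rightarrow> bool" where
  "valid_instance I \<longleftrightarrow>
     (\<forall>c \<in> set (trips I). length (dep_times c) = n_stations I) \<and>
     (\<forall>s < n_stations I. \<forall>c \<in> set (trips I). \<forall>c' \<in> set (trips I).
        travel_time c s = travel_time c' s) \<and>
     destinations I \<noteq> [] \<and>
     1 \<le> t_max I \<and> 1 \<le> v_cap I \<and>
     (\<forall>j \<in> set (passengers I). origin j < n_stations I \<and> dest j < length (destinations I)) \<and>
     0 < alpha_den I \<and> alpha_num I \<le> alpha_den I"

text \<open>
  Since the blocks of a partition are nonempty and disjoint, groups are distinct sets of passengers,
  and the groups themselves serve as indices: \<open>dst g\<close> is the common destination and \<open>dep g\<close> the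
  departure time of group \<open>g\<close>.
\<close>

definition feasible_solution ::
    "ilmtp \<Rightarrow> nat set set \<Rightarrow> (nat set \<Rightarrow> nat) \<Rightarrow> (nat set \<Rightarrow> int) \<Rightarrow> bool" where
  "feasible_solution I G dst dep \<longleftrightarrow>
     partition_on {..<length (passengers I)} G \<and>
     (\<forall>g \<in> G. dep g \<in> {1..int (t_max I)}) \<and>
     (\<forall>g \<in> G. (\<forall>j \<in> g. dest (passengers I ! j) = dst g) \<and> card g \<le> v_cap I) \<and>
     (\<forall>g \<in> G. \<forall>j \<in> g.
        req_time (passengers I ! j) - int (T_w I)
          \<le> dep g + int (time_to (destinations I ! dst g)) \<and>
        dep g + int (time_to (destinations I ! dst g))
          \<le> req_time (passengers I ! j) + int (T_w I)) \<and>
     (\<forall>g \<in> G. \<exists>c \<in> set (trips I). arr_time c \<le> dep g) \<and>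
     (\<forall>g \<in> G. dep g + int (round_trip_time (destinations I ! dst g)) \<le> int (t_max I)) \<and>
     (\<forall>t \<in> {1..int (t_max I)}.
        card {g \<in> G. dep g \<le> t \<and> t < dep g + int (round_trip_time (destinations I ! dst g))}
          \<le> n_vehicles I)"

definition has_feasible_solution :: "ilmtp \<Rightarrow> bool" where
  "has_feasible_solution I \<longleftrightarrow> (\<exists>G dst dep. feasible_solution I G dst dep)"


subsection \<open>Encoding of instances\<close>

text \<open>Binary representation, least significant bit first, without leading zeros.\<close>

fun nat_bits :: "nat \<Rightarrow> bool list" where
  "nat_bits n = (if n = 0 then [] else odd n # nat_bits (n div 2))"

declare nat_bits.simps [simp del]

definition enc_nat :: "nat \<Rightarrow> bool list" where
  "enc_nat n = enc_list (\<lambda>b. [b]) (nat_bits n)"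

definition enc_int :: "int \<Rightarrow> bool list" where
  "enc_int i = (i < 0) # enc_nat (nat \<bar>i\<bar>)"

text \<open>
  Finite sets are listed element by element, so stations and vehicles, which have no data of their
  own, contribute one bit each; only numbers are written in binary.
\<close>

definition enc_card :: "nat \<Rightarrow> bool list" where
  "enc_card n = enc_list (\<lambda>_. []) [0..<n]"

definition enc_trip :: "trip \<Rightarrow> bool list" where
  "enc_trip c = enc_list enc_int (dep_times c) @ enc_int (arr_time c)"

definition enc_destination :: "destination \<Rightarrow> bool list" where
  "enc_destination d = enc_nat (time_to d) @ enc_nat (time_stop d) @ enc_nat (time_back d)"

definition enc_passenger :: "passenger \<Rightarrow> bool list" where
  "enc_passenger j = enc_nat (origin j) @ enc_nat (dest j) @ enc_int (req_time j)"

definition enc_ilmtp :: "ilmtp \<Rightarrow> bool list" where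
  "enc_ilmtp I =
     enc_card (n_stations I) @
     enc_list enc_trip (trips I) @
     enc_list enc_destination (destinations I) @
     enc_nat (t_max I) @
     enc_card (n_vehicles I) @
     enc_nat (v_cap I) @
     enc_list enc_passenger (passengers I) @
     enc_nat (T_w I) @
     enc_nat (alpha_num I) @ enc_nat (alpha_den I)"

text \<open>The encoding is injective, as all its components are prefix codes.\<close>

definition prefix_code :: "('a \<Rightarrow> bool list) \<Rightarrow> bool" where
  "prefix_code e \<longleftrightarrow> (\<forall>x y u v. e x @ u = e y @ v \<longleftrightarrow> x = y \<and> u = v)"

lemma prefix_code_enc_list:
  assumes "prefix_code e"
  shows "prefix_code (enc_list e)"
proof -
  have "enc_list e xs @ u = enc_list e ys @ v \<longleftrightarrow> xs = ys \<and> u = v" for xs ys u v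
  proof (induction xs arbitrary: ys)
    case Nil
    then show ?case by (cases ys) (auto simp: enc_list_def)
  next
    case (Cons x xs)
    then show ?case
      using assms by (cases ys) (auto simp: enc_list_def prefix_code_def)
  qed
  then show ?thesis by (simp add: prefix_code_def)
qed

lemma nat_bits_0 [simp]: "nat_bits 0 = []"
  by (subst nat_bits.simps) simp

lemma nat_bits_pos: "n \<noteq> 0 \<Longrightarrow> nat_bits n = odd n # nat_bits (n div 2)"
  by (subst nat_bits.simps) simp

lemma inj_nat_bits: "nat_bits m = nat_bits n \<longleftrightarrow> m = n"
proof (induction m arbitrary: n rule: less_induct)
  case (less m)
  consider "m = 0" "n = 0" | "m = 0" "n \<noteq> 0" | "m \<noteq> 0" "n = 0" | "m \<noteq> 0" "n \<noteq> 0"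
    by blast
  then show ?case
  proof cases
    case 4
    have "nat_bits m = nat_bits n \<longleftrightarrow> odd m = odd n \<and> m div 2 = n div 2"
      unfolding nat_bits_pos[OF 4(1)] nat_bits_pos[OF 4(2)]
      using less.IH[of "m div 2" "n div 2"] 4(1) by simp
    also have "\<dots> \<longleftrightarrow> m = n"
      by presburger
    finally show ?thesis .
  qed (simp_all add: nat_bits_pos)
qed

lemma prefix_code_enc_nat: "prefix_code enc_nat"
  using prefix_code_enc_list[of "\<lambda>b. [b]"]
  by (simp add: prefix_code_def enc_nat_def inj_nat_bits)

lemma prefix_code_enc_int: "prefix_code enc_int"
proof -
  have "enc_int x @ u = enc_int y @ v \<longleftrightarrow> x = y \<and> u = v" for x y u v
    using prefix_code_enc_nat[unfolded prefix_code_def] by (auto simp: enc_int_def)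
  then show ?thesis by (simp add: prefix_code_def)
qed

lemma prefix_code_enc_card: "prefix_code enc_card"
proof -
  have *: "enc_card n = replicate n True @ [False]" for n
    by (induction n) (simp_all add: enc_card_def enc_list_def replicate_append_same)
  have "enc_card m @ u = enc_card n @ v \<longleftrightarrow> m = n \<and> u = v" for m n u v
  proof (induction m arbitrary: n)
    case 0
    then show ?case by (cases n) (auto simp: *)
  next
    case (Suc m)
    then show ?case by (cases n) (auto simp: *)
  qed
  then show ?thesis by (simp add: prefix_code_def)
qed

lemma prefix_code_enc_trip: "prefix_code enc_trip"
proof -
  note codes = prefix_code_enc_list[OF prefix_code_enc_int] prefix_code_enc_int
  have "enc_trip x @ u = enc_trip y @ v \<longleftrightarrow> x = y \<and> u = v" for x y u v
    using codes[unfolded prefix_code_def] by (cases x; cases y) (simp add: enc_trip_def)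
  then show ?thesis by (simp add: prefix_code_def)
qed

lemma prefix_code_enc_destination: "prefix_code enc_destination"
proof -
  note codes = prefix_code_enc_nat
  have "enc_destination x @ u = enc_destination y @ v \<longleftrightarrow> x = y \<and> u = v" for x y u v
    using codes[unfolded prefix_code_def] by (cases x; cases y) (simp add: enc_destination_def)
  then show ?thesis by (simp add: prefix_code_def)
qed

lemma prefix_code_enc_passenger: "prefix_code enc_passenger"
proof -
  note codes = prefix_code_enc_nat prefix_code_enc_int
  have "enc_passenger x @ u = enc_passenger y @ v \<longleftrightarrow> x = y \<and> u = v" for x y u v
    using codes[unfolded prefix_code_def] by (cases x; cases y) (simp add: enc_passenger_def)
  then show ?thesis by (simp add: prefix_code_def)
qed

lemma prefix_code_enc_ilmtp: "prefix_code enc_ilmtp"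
proof -
  note codes = prefix_code_enc_card prefix_code_enc_nat
    prefix_code_enc_list[OF prefix_code_enc_trip]
    prefix_code_enc_list[OF prefix_code_enc_destination]
    prefix_code_enc_list[OF prefix_code_enc_passenger]
  have "enc_ilmtp x @ u = enc_ilmtp y @ v \<longleftrightarrow> x = y \<and> u = v" for x y u v
    using codes[unfolded prefix_code_def] by (cases x; cases y) (simp add: enc_ilmtp_def)
  then show ?thesis by (simp add: prefix_code_def)
qed

lemma inj_enc_ilmtp: "inj enc_ilmtp"
  using prefix_code_enc_ilmtp unfolding prefix_code_def by (metis injI)

definition ILMTP_SD :: language where
  "ILMTP_SD = enc_ilmtp ` {I. valid_instance I \<and> has_feasible_solution I}"

end

theory Submission
  imports Defs
begin

text \<open>
  Membership: a certificate lists a representative and a departure time for every passenger. That it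
  can be checked in polynomial time is shown by closing a class of polynomial-time functions on
  numbers, pairs and lists under the usual operations on lists; these functions are realised by
  programs over stacks of bits, and stacks are tapes.

  Hardness: runs of a nondeterministic machine are tables of local constraints, in which the tapes are
  written relative to their heads. Every constraint equates two numbers of bounded size, so that the
  tables are exactly the ways to choose one vector for each entry such that the sum of all chosen
  vectors is a given one. Written as the digits of a large number, such a vector sum becomes a subset
  sum. Finally, numbers with a subset of sum \<open>b\<close> are the round-trip times of trips for two vehicles
  which, together with two further trips, can only be served if both vehicles are busy at all times.
\<close>

section \<open>Stack programs and their compilation to Turing machines\<close>

text \<open>The hardness proof starts from the definition of \<open>NP\<close>, so the verifier and
  the reduction both have to be shown to run in polynomial time on Turing machines. Only a few
  programs are written out; all else follows from closure rules that are applied along the structure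
  of expressions. The delicate rule is iteration: polynomially many polynomial-time steps can
  produce exponentially long values, so each loop comes with a bound on its intermediate results. An
  equation \<open>x = y\<close> depends on two choices, whereas in a subset sum every chosen item
  contributes a fixed amount. In the form \<open>(A - x) + y = A\<close>, with a constant
  \<open>A\<close>, the two choices contribute separately and the target depends on neither. Vectors
  keep different equations apart, and a large base keeps the digits apart. Relative positions make
  the motion of a tape uniform: a cell hands its content to a place that depends only on the move
  stored in its own option, and further equations force all cells of a tape to store the move of the
  step.\<close>

text \<open>
  Each register is a stack of bits and becomes one tape, whose head rests on the top of the stack.
  This is exactly the input and the output convention for tapes.
\<close>

datatype com =
    Skip
  | Push nat bool
  | Pop nat
  | Seq com com
  | Cond nat com com com
  | Loop nat com

type_synonym store = "nat \<Rightarrow> bool list"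

text \<open>The step count is exactly the number of steps of the compiled machine.\<close>

inductive exec :: "com \<Rightarrow> store \<Rightarrow> nat \<Rightarrow> store \<Rightarrow> bool" where
  Skip: "exec Skip s 1 s"
| Push: "exec (Push r b) s 2 (s(r := b # s r))"
| Pop: "exec (Pop r) s 1 (s(r := tl (s r)))"
| Seq: "exec c s m s' \<Longrightarrow> exec d s' n s'' \<Longrightarrow> exec (Seq c d) s (Suc (m + n)) s''"
| Cond_Nil: "s r = [] \<Longrightarrow> exec c0 s n s' \<Longrightarrow> exec (Cond r c0 c1 c2) s (Suc n) s'"
| Cond_False: "s r = False # xs \<Longrightarrow> exec c1 s n s' \<Longrightarrow> exec (Cond r c0 c1 c2) s (Suc n) s'"
| Cond_True: "s r = True # xs \<Longrightarrow> exec c2 s n s' \<Longrightarrow> exec (Cond r c0 c1 c2) s (Suc n) s'"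
| Loop_Nil: "s r = [] \<Longrightarrow> exec (Loop r c) s 1 s"
| Loop: "s r \<noteq> [] \<Longrightarrow> exec c s m s' \<Longrightarrow> exec (Loop r c) s' n s'' \<Longrightarrow>
    exec (Loop r c) s (Suc (m + n)) s''"

fun below :: "nat \<Rightarrow> com \<Rightarrow> bool" where
  "below k Skip \<longleftrightarrow> True"
| "below k (Push r b) \<longleftrightarrow> r < k"
| "below k (Pop r) \<longleftrightarrow> r < k"
| "below k (Seq c d) \<longleftrightarrow> below k c \<and> below k d"
| "below k (Cond r c d e) \<longleftrightarrow> r < k \<and> below k c \<and> below k d \<and> below k e"
| "below k (Loop r c) \<longleftrightarrow> r < k \<and> below k c"

lemma below_mono: "below k c \<Longrightarrow> k \<le> l \<Longrightarrow> below l c"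
  by (induction c) auto

lemma ex_below: "\<exists>k. below k c"
proof (induction c)
  case (Seq c d)
  then obtain k l where "below k c" "below l d" by blast
  then have "below (max k l) (Seq c d)" by (auto intro: below_mono)
  then show ?case ..
next
  case (Cond r c d e)
  then obtain k l m where "below k c" "below l d" "below m e" by blast
  then have "below (max (Suc r) (max k (max l m))) (Cond r c d e)" by (auto intro: below_mono)
  then show ?case ..
next
  case (Loop r c)
  then obtain k where "below k c" by blast
  then have "below (max (Suc r) k) (Loop r c)" by (auto intro: below_mono)
  then show ?case ..
qed auto

text \<open>
  A control state is a list of commands still to be executed; the flag marks the middle of a
  \<open>Push\<close>, which takes two machine steps.
\<close>

type_synonym control = "bool \<times> com list"

abbreviation idle :: "nat list \<Rightarrow> (nat \<times> move) list" where
  "idle ss \<equiv> map (\<lambda>s. (s, Stay)) ss"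

text \<open>A popped cell is not erased: a stack begins at the head, and \<open>Push\<close>
  overwrites whatever lies to the left. Popping an empty stack must leave the head in place, hence
  the test for a blank.\<close>

fun delta :: "control \<Rightarrow> nat list \<Rightarrow> control \<times> (nat \<times> move) list" where
  "delta (fl, []) ss = ((fl, []), idle ss)"
| "delta (fl, Skip # K) ss = ((False, K), idle ss)"
| "delta (fl, Push r b # K) ss =
     (if fl then ((False, K), (idle ss)[r := (bit_symbol b, Stay)])
      else ((True, Push r b # K), (idle ss)[r := (ss ! r, Move_Left)]))"
| "delta (fl, Pop r # K) ss =
     ((False, K), (idle ss)[r := (ss ! r, if ss ! r = 0 then Stay else Move_Right)])"
| "delta (fl, Seq c d # K) ss = ((False, c # d # K), idle ss)"
| "delta (fl, Cond r c0 c1 c2 # K) ss =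
     ((False, (if ss ! r = 0 then c0 else if ss ! r = 1 then c1 else c2) # K), idle ss)"
| "delta (fl, Loop r c # K) ss =
     ((False, if ss ! r = 0 then K else c # Loop r c # K), idle ss)"

definition cstep :: "control \<times> tape list \<Rightarrow> control \<times> tape list" where
  "cstep = (\<lambda>(q, ts). case delta q (map read_tape ts) of (q', as) \<Rightarrow> (q', map2 act as ts))"

text \<open>The control lists that can occur while \<open>c\<close> runs in front of
  \<open>K\<close>, without \<open>K\<close> itself. The body of a loop is followed by the same loop
  again, which keeps the set finite; it provides the states of the machine.\<close>

fun conts :: "com \<Rightarrow> com list \<Rightarrow> com list set" where
  "conts Skip K = {Skip # K}"
| "conts (Push r b) K = {Push r b # K}"
| "conts (Pop r) K = {Pop r # K}"
| "conts (Seq c d) K = insert (Seq c d # K) (conts c (d # K) \<union> conts d K)"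
| "conts (Cond r c0 c1 c2) K =
     insert (Cond r c0 c1 c2 # K) (conts c0 K \<union> conts c1 K \<union> conts c2 K)"
| "conts (Loop r c) K = insert (Loop r c # K) (conts c (Loop r c # K))"

lemma finite_conts: "finite (conts c K)"
  by (induction c arbitrary: K) auto

lemma conts_self: "c # K \<in> conts c K"
  by (cases c) auto

lemma conts_delta:
  "L \<in> conts c K \<Longrightarrow> snd (fst (delta (fl, L) ss)) \<in> insert K (conts c K)"
proof (induction c arbitrary: K)
  case (Seq c d)
  then show ?case using conts_self[of d K] conts_self[of c "d # K"] by fastforce
next
  case (Cond r c0 c1 c2)
  then show ?case
    using conts_self[of c0 K] conts_self[of c1 K] conts_self[of c2 K] by auto
next
  case (Loop r c)
  then show ?case using conts_self[of c "Loop r c # K"] by (auto split: if_splits)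
qed auto

section \<open>Simulation of programs by machines\<close>

definition sim :: "nat \<Rightarrow> store \<Rightarrow> tape list \<Rightarrow> bool" where
  "sim k s ts \<longleftrightarrow> length ts = k \<and> (\<forall>r<k. tape_output (ts ! r) (s r))"

lemma map2_act_idle: "map2 act (idle (map read_tape ts)) ts = ts"
  by (induction ts) (auto simp: split: prod.splits)

lemma act_idle [simp]: "act (read_tape t, Stay) t = t"
  by (cases t) simp

lemma map2_act_update:
  assumes "r < length ts"
  shows "map2 act ((idle (map read_tape ts))[r := a]) ts = ts[r := act a (ts ! r)]"
proof (rule nth_equalityI)
  fix i assume "i < length (map2 act ((idle (map read_tape ts))[r := a]) ts)"
  then have "i < length ts" by simp
  then show "map2 act ((idle (map read_tape ts))[r := a]) ts ! i = ts[r := act a (ts ! r)] ! i"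
    using assms by (cases "i = r") auto
qed simp

lemma sim_read:
  assumes "sim k s ts" "r < k"
  shows "map read_tape ts ! r = (case s r of [] \<Rightarrow> 0 | b # _ \<Rightarrow> bit_symbol b)"
proof -
  have *: "tape_output t x \<Longrightarrow> read_tape t = (case x of [] \<Rightarrow> 0 | b # _ \<Rightarrow> bit_symbol b)" for t x
    by (cases t; cases x) force+
  have "tape_output (ts ! r) (s r)" "r < length ts" using assms by (auto simp: sim_def)
  then show ?thesis using *[of "ts ! r" "s r"] by simp
qed

lemma sim_update:
  assumes "sim k s ts" "tape_output t x"
  shows "sim k (s(r := x)) (ts[r := t])"
  using assms by (auto simp: sim_def nth_list_update)

lemma tape_output_push:
  assumes "tape_output (T, h) x"
  shows "tape_output (T(h - 1 := bit_symbol b), h - 1) (b # x)"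
proof -
  have "(T(h - 1 := bit_symbol b)) (h - 1 + int i) = bit_symbol ((b # x) ! i)"
    if "i < length (b # x)" for i
    using assms that by (cases i) (auto simp: algebra_simps)
  then show ?thesis using assms by (simp add: algebra_simps)
qed

lemma tape_output_pop:
  assumes "tape_output (T, h) (b # x)"
  shows "tape_output (T, h + 1) x"
proof -
  have "T (h + 1 + int i) = bit_symbol (x ! i)" if "i < length x" for i
    using assms that by (auto simp: algebra_simps dest!: spec[of _ "Suc i"])
  then show ?thesis using assms by (simp add: algebra_simps)
qed

lemma funpow_Suc_trans: "f x = y \<Longrightarrow> (f ^^ n) y = z \<Longrightarrow> (f ^^ Suc n) x = z"
  by (simp add: funpow_Suc_right del: funpow.simps)

lemma funpow_add_trans: "(f ^^ m) x = y \<Longrightarrow> (f ^^ n) y = z \<Longrightarrow> (f ^^ (m + n)) x = z"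
  by (subst add.commute) (simp add: funpow_add)

text \<open>The rest \<open>K\<close> of the control list is arbitrary, so that the induction can
  run a part of a command in front of what follows it. As step counts agree exactly, the runs of the
  parts simply concatenate.\<close>

lemma exec_simulation:
  assumes "exec c s n s'" "sim k s ts" "below k c"
  shows "\<exists>ts'. (cstep ^^ n) ((False, c # K), ts) = ((False, K), ts') \<and> sim k s' ts'"
  using assms
proof (induction arbitrary: ts K rule: exec.induct)
  case (Skip s)
  then show ?case by (simp add: cstep_def map2_act_idle del: map_map)
next
  case (Push r b s)
  obtain T h where t: "ts ! r = (T, h)" by (cases "ts ! r")
  from Push.prems have r: "r < length ts" and tr: "tape_output (ts ! r) (s r)"
    by (simp_all add: sim_def)
  note tr = tr[unfolded t]
  let ?ts = "ts[r := (T, h - 1)]"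
  have 1: "cstep ((False, Push r b # K), ts) = ((True, Push r b # K), ?ts)"
    using r by (simp add: cstep_def map2_act_update t del: map_map)
  have 2: "cstep ((True, Push r b # K), ?ts)
      = ((False, K), ts[r := (T(h - 1 := bit_symbol b), h - 1)])"
    using r by (simp add: cstep_def map2_act_update del: map_map)
  have 3: "sim k (s(r := b # s r)) (ts[r := (T(h - 1 := bit_symbol b), h - 1)])"
    using Push.prems tape_output_push[OF tr] by (intro sim_update)
  have "(cstep ^^ 2) ((False, Push r b # K), ts)
      = ((False, K), ts[r := (T(h - 1 := bit_symbol b), h - 1)])"
    using 1 2 by (simp add: numeral_2_eq_2)
  with 3 show ?case by blast
next
  case (Pop r s)
  obtain T h where t: "ts ! r = (T, h)" by (cases "ts ! r")
  from Pop.prems have r: "r < length ts" "r < k" and tr: "tape_output (ts ! r) (s r)"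
    by (simp_all add: sim_def)
  note tr = tr[unfolded t]
  have rd: "T h = (case s r of [] \<Rightarrow> 0 | b # _ \<Rightarrow> bit_symbol b)"
    using sim_read[OF Pop.prems(1) r(2)] r(1) t by simp
  show ?case
  proof (cases "s r")
    case Nil
    then have "(cstep ^^ 1) ((False, Pop r # K), ts) = ((False, K), ts[r := (T, h)])"
      using r rd fun_upd_idem[of T h 0] by (simp add: cstep_def map2_act_update t del: map_map)
    moreover have "sim k (s(r := tl (s r))) (ts[r := (T, h)])"
      using sim_update[OF Pop.prems(1) tr, of r] Nil by (metis list.sel(2))
    ultimately show ?thesis by blast
  next
    case (Cons b x)
    then have "(cstep ^^ 1) ((False, Pop r # K), ts) = ((False, K), ts[r := (T, h + 1)])"
      using r rd fun_upd_idem[of T h "bit_symbol b"] by (simp add: cstep_def map2_act_update t bit_symbol_def del: map_map)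
    moreover have "sim k (s(r := tl (s r))) (ts[r := (T, h + 1)])"
      using sim_update[OF Pop.prems(1) tape_output_pop, of T h b x r] Cons tr
      by (metis list.sel(3))
    ultimately show ?thesis by blast
  qed
next
  case (Seq c s m s' d n s'')
  have 0: "cstep ((False, Seq c d # K), ts) = ((False, c # d # K), ts)"
    by (simp add: cstep_def map2_act_idle del: map_map)
  obtain ts' where 1: "(cstep ^^ m) ((False, c # d # K), ts) = ((False, d # K), ts')" "sim k s' ts'"
    using Seq by fastforce
  obtain ts'' where "(cstep ^^ n) ((False, d # K), ts') = ((False, K), ts'')" "sim k s'' ts''"
    using Seq.IH(2)[OF 1(2)] Seq.prems by fastforce
  moreover from 0 funpow_add_trans have
    "(cstep ^^ Suc (m + n)) ((False, Seq c d # K), ts) = ((False, K), ts'')"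
    by (rule funpow_Suc_trans) (rule 1(1), rule calculation(1))
  ultimately show ?case by blast
next
  case (Cond_Nil s r c0 n s' c1 c2)
  from Cond_Nil.hyps Cond_Nil.prems have 0: "cstep ((False, Cond r c0 c1 c2 # K), ts) = ((False, c0 # K), ts)"
    using sim_read[OF Cond_Nil.prems(1), of r] by (simp add: cstep_def map2_act_idle del: map_map)
  obtain ts' where "(cstep ^^ n) ((False, c0 # K), ts) = ((False, K), ts')" "sim k s' ts'"
    using Cond_Nil.IH[OF Cond_Nil.prems(1)] Cond_Nil.prems(2) by fastforce
  moreover from 0 this(1) have "(cstep ^^ Suc n) ((False, Cond r c0 c1 c2 # K), ts) = ((False, K), ts')"
    by (rule funpow_Suc_trans)
  ultimately show ?case by blast
next
  case (Cond_False s r xs c1 n s' c0 c2)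
  from Cond_False.hyps Cond_False.prems have 0: "cstep ((False, Cond r c0 c1 c2 # K), ts) = ((False, c1 # K), ts)"
    using sim_read[OF Cond_False.prems(1), of r]
    by (simp add: cstep_def map2_act_idle bit_symbol_def del: map_map)
  obtain ts' where "(cstep ^^ n) ((False, c1 # K), ts) = ((False, K), ts')" "sim k s' ts'"
    using Cond_False.IH[OF Cond_False.prems(1)] Cond_False.prems(2) by fastforce
  moreover from 0 this(1) have "(cstep ^^ Suc n) ((False, Cond r c0 c1 c2 # K), ts) = ((False, K), ts')"
    by (rule funpow_Suc_trans)
  ultimately show ?case by blast
next
  case (Cond_True s r xs c2 n s' c0 c1)
  from Cond_True.hyps Cond_True.prems have 0: "cstep ((False, Cond r c0 c1 c2 # K), ts) = ((False, c2 # K), ts)"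
    using sim_read[OF Cond_True.prems(1), of r]
    by (simp add: cstep_def map2_act_idle bit_symbol_def del: map_map)
  obtain ts' where "(cstep ^^ n) ((False, c2 # K), ts) = ((False, K), ts')" "sim k s' ts'"
    using Cond_True.IH[OF Cond_True.prems(1)] Cond_True.prems(2) by fastforce
  moreover from 0 this(1) have "(cstep ^^ Suc n) ((False, Cond r c0 c1 c2 # K), ts) = ((False, K), ts')"
    by (rule funpow_Suc_trans)
  ultimately show ?case by blast
next
  case (Loop_Nil s r c)
  then have "(cstep ^^ 1) ((False, Loop r c # K), ts) = ((False, K), ts)"
    using sim_read[OF Loop_Nil.prems(1), of r] by (simp add: cstep_def map2_act_idle del: map_map)
  with Loop_Nil.prems(1) show ?case by blast
next
  case (Loop s r c m s' n s'')
  have 0: "cstep ((False, Loop r c # K), ts) = ((False, c # Loop r c # K), ts)"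
    using sim_read[OF Loop.prems(1), of r] Loop.hyps(1) Loop.prems
    by (cases "s r") (simp_all add: cstep_def map2_act_idle bit_symbol_def del: map_map)
  obtain ts' where 1: "(cstep ^^ m) ((False, c # Loop r c # K), ts) = ((False, Loop r c # K), ts')"
    "sim k s' ts'"
    using Loop.IH(1)[OF Loop.prems(1)] Loop.prems by fastforce
  obtain ts'' where "(cstep ^^ n) ((False, Loop r c # K), ts') = ((False, K), ts'')" "sim k s'' ts''"
    using Loop.IH(2)[OF 1(2)] Loop.prems by fastforce
  moreover from 0 funpow_add_trans have
    "(cstep ^^ Suc (m + n)) ((False, Loop r c # K), ts) = ((False, K), ts'')"
    by (rule funpow_Suc_trans) (rule 1(1), rule calculation(1))
  ultimately show ?case by blast
qed

definition start :: "bool list \<Rightarrow> store" where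
  "start x = (\<lambda>_. [])(0 := x)"

lemma sim_init:
  assumes "0 < k"
  shows "sim k (start x) (word_tape x # replicate (k - 1) (word_tape []))"
  using assms by (auto simp: sim_def start_def nth_Cons word_tape_def split: nat.splits)

lemma delta_wf:
  assumes "set ss \<subseteq> {..<3}" "snd q = c # K \<Longrightarrow> below (length ss) c"
  shows "length (snd (delta q ss)) = length ss \<and> fst ` set (snd (delta q ss)) \<subseteq> {..<3}"
proof -
  have "fst ` set (idle ss) \<subseteq> {..<3}" using assms(1) by auto
  moreover have "r < length ss \<Longrightarrow> ss ! r < 3" for r using assms(1) nth_mem by fastforce
  moreover have "set ((idle ss)[r := a]) \<subseteq> insert a (set (idle ss))" for r a
    by (rule set_update_subset_insert)
  ultimately have upd: "s < 3 \<Longrightarrow> fst ` set ((idle ss)[r := (s, m)]) \<subseteq> {..<3}" for r s m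
    by fastforce
  have idle: "fst ` set (idle ss) \<subseteq> {..<3}" using assms(1) by auto
  show ?thesis
  proof (cases "(q, ss)" rule: delta.cases)
    case (3 fl r b K ss')
    then show ?thesis
      using upd idle assms(1) \<open>\<And>r. r < length ss \<Longrightarrow> ss ! r < 3\<close>
      by (cases "r < length ss") (auto simp: bit_symbol_def list_update_beyond)
  next
    case (4 fl r K ss')
    then show ?thesis
      using upd idle assms(1) \<open>\<And>r. r < length ss \<Longrightarrow> ss ! r < 3\<close>
      by (cases "r < length ss") (auto simp: list_update_beyond)
  qed (use idle in auto)
qed


lemma conts_below: "L \<in> conts c K \<Longrightarrow> below k c \<Longrightarrow> L = c' # K' \<Longrightarrow> below k c'"
  by (induction c arbitrary: K) auto

lemma cstep_halt: "cstep ((fl, []), ts) = ((fl, []), ts)"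
  by (simp add: cstep_def map2_act_idle del: map_map)

lemma ex_index:
  assumes "distinct L"
  obtains e where "\<And>q. q \<in> set L \<Longrightarrow> e q < length L \<and> L ! e q = q"
    "\<And>i. i < length L \<Longrightarrow> e (L ! i) = i"
proof
  have inj: "inj_on ((!) L) {..<length L}"
    using assms by (auto simp: distinct_conv_nth inj_on_def)
  have img: "(!) L ` {..<length L} = set L"
    by (auto simp: in_set_conv_nth)
  let ?e = "inv_into {..<length L} ((!) L)"
  show "?e q < length L \<and> L ! ?e q = q" if "q \<in> set L" for q
    using that inv_into_into[of q "(!) L" "{..<length L}"] f_inv_into_f[of q "(!) L" "{..<length L}"]
    unfolding img by simp
  show "?e (L ! i) = i" if "i < length L" for i
    using inv_into_f_f[OF inj, of i] that by simp
qed

theorem polytimeI: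
  assumes "\<And>x. \<exists>n s'. exec c (start x) n s' \<and> s' 0 = f x \<and> n \<le> poly p (length x)"
  shows "polytime f"
proof -
  obtain k0 where k0: "below k0 c" using ex_below by blast
  define k where "k = Suc k0"
  have k: "below k c" "0 < k" using below_mono[OF k0] by (auto simp: k_def)
  define Q where "Q = (UNIV :: bool set) \<times> insert [] (conts c [])"
  have "finite Q"
    by (simp add: Q_def finite_conts)
  from finite_distinct_list[OF finite_Diff[OF this]]
  obtain xs where xs: "set xs = Q - {(False, [c]), (False, [])}" "distinct xs"
    by meson
  \<comment> \<open>The positions in this list number the states: 0 has to be the initial one and 1
    the halting one.\<close>
  define L where "L = (False, [c]) # (False, []) # xs"
  have "(False, [c]) \<in> Q" "(False, []) \<in> Q"
    using conts_self[of c "[]"] by (simp_all add: Q_def)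
  then have L: "distinct L" "set L = Q"
    using xs unfolding L_def by auto
  obtain e where e: "\<And>q. q \<in> Q \<Longrightarrow> e q < length L \<and> L ! e q = q"
    and e': "\<And>i. i < length L \<Longrightarrow> e (L ! i) = i"
    using ex_index[OF L(1)] unfolding L(2) by blast
  have e_start: "e (False, [c]) = 0" and e_halt: "e (False, []) = 1"
    using e'[of 0] e'[of 1] by (simp_all add: L_def)
  define M where "M = \<lparr>tm_tapes = k, tm_states = length L, tm_symbols = 3,
    tm_trans = (\<lambda>i ss. case delta (L ! i) ss of (q, as) \<Rightarrow> (e q, as))\<rparr>"
  have closed: "fst (delta q ss) \<in> Q" if "q \<in> Q" for q ss
  proof (cases q)
    case (Pair fl K)
    then show ?thesis
      using that conts_delta[of K c "[]" fl ss]
      by (cases "fst (delta (fl, K) ss)") (auto simp: Q_def)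
  qed
  have wf: "wf_tm M"
    unfolding wf_tm_def
  proof (intro conjI allI impI)
    fix i ss
    assume *: "i < tm_states M" "length ss = tm_tapes M" "set ss \<subseteq> {..<tm_symbols M}"
    have q: "L ! i \<in> Q" using * L(2) nth_mem by (fastforce simp: M_def)
    have "below (length ss) c'" if "snd (L ! i) = c' # K" for c' K
      using q that conts_below[OF _ k(1)] * by (auto simp: Q_def M_def)
    then have "length (snd (delta (L ! i) ss)) = length ss \<and>
        fst ` set (snd (delta (L ! i) ss)) \<subseteq> {..<3}"
      using * by (intro delta_wf) (auto simp: M_def)
    moreover have "e (fst (delta (L ! i) ss)) < length L"
      using closed[OF q] e by blast
    ultimately show "case tm_trans M i ss of (q', as) \<Rightarrow> q' < tm_states M \<and>
        length as = tm_tapes M \<and> fst ` set as \<subseteq> {..<tm_symbols M}"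
      using * by (cases "delta (L ! i) ss") (simp add: M_def)
  qed (use k in \<open>auto simp: M_def L_def\<close>)
  have step: "tm_step M (e q, ts) = (e (fst r), snd r) \<and> fst r \<in> Q"
    if "q \<in> Q" "r = cstep (q, ts)" for q ts r
  proof (cases "e q = 1")
    case True
    then have "q = (False, [])" using e[OF that(1)] by (simp add: L_def)
    then show ?thesis using that by (simp add: cstep_halt e_halt)
  next
    case False
    obtain q' as where d: "delta q (map read_tape ts) = (q', as)" by fastforce
    have "tm_step M (e q, ts) = (e q', map2 act as ts)"
      using False e[OF that(1)] d by (simp add: M_def)
    moreover have "r = (q', map2 act as ts)"
      using that(2) d by (simp add: cstep_def)
    ultimately show ?thesis
      using closed[OF that(1), of "map read_tape ts"] d by simp
  qed
  have steps: "(tm_step M ^^ n) (e q, ts) = (e (fst ((cstep ^^ n) (q, ts))), snd ((cstep ^^ n) (q, ts)))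
      \<and> fst ((cstep ^^ n) (q, ts)) \<in> Q" if "q \<in> Q" for n q ts
  proof (induction n)
    case (Suc n)
    then show ?case
      using step[of "fst ((cstep ^^ n) (q, ts))" "cstep ((cstep ^^ n) (q, ts))" "snd ((cstep ^^ n) (q, ts))"]
      by simp
  qed (use that in simp)
  have "tm_computes M x (f x) (poly p (length x))" for x
  proof -
    obtain n s' where n: "exec c (start x) n s'" "s' 0 = f x" "n \<le> poly p (length x)"
      using assms by blast
    let ?ts = "word_tape x # replicate (k - 1) (word_tape [])"
    obtain ts' where ts': "(cstep ^^ n) ((False, [c]), ?ts) = ((False, []), ts')" "sim k s' ts'"
      using exec_simulation[OF n(1) sim_init[OF k(2)] k(1), of "[]"] by blast
    have "(cstep ^^ m) ((False, []), ts') = ((False, []), ts')" for m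
      by (induction m) (simp_all add: cstep_halt)
    moreover obtain m where "poly p (length x) = n + m"
      using n(3) le_Suc_ex by blast
    ultimately have "(cstep ^^ poly p (length x)) ((False, [c]), ?ts) = ((False, []), ts')"
      using funpow_add_trans[OF ts'(1)] by simp
    then have "(tm_step M ^^ poly p (length x)) (init_config M x) = (1, ts')"
      using steps[of "(False, [c])" "poly p (length x)" ?ts] conts_self[of c "[]"]
      by (simp add: init_config_def e_start e_halt M_def Q_def)
    moreover have "tape_output (hd ts') (f x)"
      using ts'(2) k(2) n(2) by (cases ts') (auto simp: sim_def)
    ultimately show ?thesis by (auto simp: tm_computes_def)
  qed
  with wf show ?thesis unfolding polytime_def by blast
qed

section \<open>Polynomial-time computation on words\<close>

definition runs :: "com \<Rightarrow> store \<Rightarrow> nat \<Rightarrow> store \<Rightarrow> bool" where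
  "runs c s n s' \<longleftrightarrow> (\<exists>m\<le>n. exec c s m s')"

notation Seq (infixr ";;" 60)

lemma runs_mono: "runs c s m s' \<Longrightarrow> m \<le> n \<Longrightarrow> runs c s n s'"
  unfolding runs_def by (meson le_trans)

lemma runs_Skip: "runs Skip s 1 s"
  unfolding runs_def by (blast intro: exec.Skip)

lemma runs_Push: "runs (Push r b) s 2 (s(r := b # s r))"
  unfolding runs_def by (blast intro: exec.Push)

lemma runs_Pop: "runs (Pop r) s 1 (s(r := tl (s r)))"
  unfolding runs_def by (blast intro: exec.Pop)

lemma runs_Seq:
  assumes "runs c s m s'" "runs d s' n s''" "Suc (m + n) \<le> N"
  shows "runs (c ;; d) s N s''"
  using assms unfolding runs_def by (meson Suc_le_mono add_mono exec.Seq le_trans)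

lemma runs_Cond:
  assumes "s r = b # xs" "runs (if b then c2 else c1) s n s'" "Suc n \<le> N"
  shows "runs (Cond r c0 c1 c2) s N s'"
proof -
  obtain m where "m \<le> n" "exec (if b then c2 else c1) s m s'"
    using assms(2) by (auto simp: runs_def)
  moreover from this have "exec (Cond r c0 c1 c2) s (Suc m) s'"
    using assms(1) by (cases b) (auto intro: exec.Cond_True exec.Cond_False)
  ultimately show ?thesis using assms(3) unfolding runs_def by (meson Suc_le_mono le_trans)
qed

lemma runs_Loop_Nil: "s r = [] \<Longrightarrow> runs (Loop r c) s 1 s"
  unfolding runs_def by (blast intro: exec.Loop_Nil)

lemma runs_Loop:
  assumes "s r \<noteq> []" "runs c s m s'" "runs (Loop r c) s' n s''" "Suc (m + n) \<le> N"
  shows "runs (Loop r c) s N s''"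
  using assms unfolding runs_def by (meson Suc_le_mono add_mono exec.Loop le_trans)

lemma exec_length: "exec c s n s' \<Longrightarrow> length (s' r) \<le> length (s r) + n"
  by (induction rule: exec.induct) auto

lemma runs_length: "runs c s n s' \<Longrightarrow> length (s' r) \<le> length (s r) + n"
  unfolding runs_def using exec_length by (meson add_left_mono le_trans)

lemma exec_frame:
  assumes "exec c s n s'" "below k c" "\<And>r. r < k \<Longrightarrow> t r = s r"
  shows "exec c t n (\<lambda>r. if r < k then s' r else t r)"
  using assms
proof (induction arbitrary: t rule: exec.induct)
  case (Skip s)
  then have "(\<lambda>r. if r < k then s r else t r) = t" by auto
  then show ?case by (metis exec.Skip)
next
  case (Push r b s)
  then have "(\<lambda>q. if q < k then (s(r := b # s r)) q else t q) = t(r := b # t r)" by auto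
  then show ?case by (metis exec.Push)
next
  case (Pop r s)
  then have "(\<lambda>q. if q < k then (s(r := tl (s r))) q else t q) = t(r := tl (t r))" by auto
  then show ?case by (metis exec.Pop)
next
  case (Seq c s m s' d n s'')
  let ?t = "\<lambda>r. if r < k then s' r else t r"
  have "exec c t m ?t" using Seq by simp
  moreover have "exec d ?t n (\<lambda>r. if r < k then s'' r else ?t r)"
    using Seq by simp
  ultimately have "exec (c ;; d) t (Suc (m + n)) (\<lambda>r. if r < k then s'' r else ?t r)"
    by (rule exec.Seq)
  moreover have "(\<lambda>r. if r < k then s'' r else ?t r) = (\<lambda>r. if r < k then s'' r else t r)"
    by auto
  ultimately show ?case by simp
next
  case (Loop_Nil s r c)
  then have "(\<lambda>r. if r < k then s r else t r) = t" by auto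
  moreover have "exec (Loop r c) t 1 t" using Loop_Nil by (intro exec.Loop_Nil) simp
  ultimately show ?case by simp
next
  case (Loop s r c m s' n s'')
  let ?t = "\<lambda>r. if r < k then s' r else t r"
  have "exec c t m ?t" using Loop by simp
  moreover have "exec (Loop r c) ?t n (\<lambda>r. if r < k then s'' r else ?t r)"
    using Loop by simp
  moreover have "t r \<noteq> []" using Loop by simp
  ultimately have "exec (Loop r c) t (Suc (m + n)) (\<lambda>r. if r < k then s'' r else ?t r)"
    using exec.Loop by blast
  moreover have "(\<lambda>r. if r < k then s'' r else ?t r) = (\<lambda>r. if r < k then s'' r else t r)"
    by auto
  ultimately show ?case by simp
next
  case (Cond_Nil s r c0 n s' c1 c2)
  then show ?case by (intro exec.Cond_Nil) auto
next
  case (Cond_False s r xs c1 n s' c0 c2)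
  then show ?case by (intro exec.Cond_False[of _ _ xs]) auto
next
  case (Cond_True s r xs c2 n s' c0 c1)
  then show ?case by (intro exec.Cond_True[of _ _ xs]) auto
qed

text \<open>This turns a program for words into a subroutine: data parked in registers from
  \<open>k\<close> on survive its run.\<close>

lemma runs_frame:
  assumes "runs c (start x) n (start y)" "below k c" "0 < k"
    "t 0 = x" "\<And>r. 0 < r \<Longrightarrow> r < k \<Longrightarrow> t r = []"
  shows "runs c t n (t(0 := y))"
proof -
  obtain m where m: "m \<le> n" "exec c (start x) m (start y)"
    using assms(1) by (auto simp: runs_def)
  have "exec c t m (\<lambda>r. if r < k then start y r else t r)"
    using assms by (intro exec_frame[OF m(2)]) (auto simp: start_def)
  moreover have "(\<lambda>r. if r < k then start y r else t r) = t(0 := y)"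
    using assms by (auto simp: start_def)
  ultimately show ?thesis using m(1) by (auto simp: runs_def)
qed

subsection \<open>Elementary programs\<close>

definition clear :: "nat \<Rightarrow> com" where
  "clear a = Loop a (Pop a)"

lemma runs_clear: "runs (clear a) s (2 * length (s a) + 1) (s(a := []))"
proof (induction "s a" arbitrary: s)
  case Nil
  then show ?case using runs_Loop_Nil[of s a] by (simp add: clear_def fun_upd_idem)
next
  case (Cons b x)
  note Cons(2)[symmetric, simp]
  let ?s = "s(a := x)"
  have "x = ?s a" by simp
  from Cons(1)[of ?s, OF this] have 1: "runs (clear a) ?s (2 * length x + 1) (s(a := []))"
    by simp
  have "runs (Pop a) s 1 ?s" using runs_Pop[of a s] by simp
  from runs_Loop[OF _ this 1[unfolded clear_def]] show ?case by (simp add: clear_def)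
qed

text \<open>Moving reverses a stack. Words are therefore parked in reverse, and a second
  \<open>move\<close> restores them.\<close>

definition move :: "nat \<Rightarrow> nat \<Rightarrow> com" where
  "move a b = Loop a (Cond a Skip (Pop a ;; Push b False) (Pop a ;; Push b True))"

lemma runs_move:
  assumes "a \<noteq> b"
  shows "runs (move a b) s (6 * length (s a) + 1) (s(a := [], b := rev (s a) @ s b))"
proof (induction "s a" arbitrary: s)
  case Nil
  then show ?case using runs_Loop_Nil[of s a] assms by (simp add: move_def fun_upd_idem)
next
  case (Cons v x)
  note Cons(2)[symmetric, simp]
  let ?s = "s(a := x, b := v # s b)"
  have "x = ?s a" using assms by simp
  from Cons(1)[of ?s, OF this] have "runs (move a b) ?s (6 * length x + 1) (?s(a := [], b := rev x @ v # s b))"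
    using assms by simp
  also have "?s(a := [], b := rev x @ v # s b) = s(a := [], b := rev (s a) @ s b)"
    using assms by auto
  finally have 1: "runs (move a b) ?s (6 * length x + 1) (s(a := [], b := rev (s a) @ s b))" .
  have "runs (Pop a ;; Push b v) s 4 ?s"
    using runs_Seq[OF runs_Pop[of a s] runs_Push[of b v]] assms by simp
  then have "runs (Cond a Skip (Pop a ;; Push b False) (Pop a ;; Push b True)) s 5 ?s"
    by - (rule runs_Cond[where b = v and xs = "x" and n = 4], auto)
  from runs_Loop[OF _ this 1[unfolded move_def]] show ?case by (simp add: move_def)
qed

definition move2 :: "nat \<Rightarrow> nat \<Rightarrow> nat \<Rightarrow> com" where
  "move2 a b c = Loop a (Cond a Skip (Pop a ;; Push b False ;; Push c False)
     (Pop a ;; Push b True ;; Push c True))"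

lemma runs_move2:
  assumes "distinct [a, b, c]"
  shows "runs (move2 a b c) s (9 * length (s a) + 1)
    (s(a := [], b := rev (s a) @ s b, c := rev (s a) @ s c))"
proof (induction "s a" arbitrary: s)
  case Nil
  then show ?case using runs_Loop_Nil[of s a] assms by (simp add: move2_def fun_upd_idem)
next
  case (Cons v x)
  note Cons(2)[symmetric, simp]
  let ?s = "s(a := x, b := v # s b, c := v # s c)"
  have "x = ?s a" using assms by simp
  from Cons(1)[of ?s, OF this] have "runs (move2 a b c) ?s (9 * length x + 1)
      (?s(a := [], b := rev x @ v # s b, c := rev x @ v # s c))"
    using assms by simp
  also have "?s(a := [], b := rev x @ v # s b, c := rev x @ v # s c)
      = s(a := [], b := rev (s a) @ s b, c := rev (s a) @ s c)"
    using assms by auto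
  finally have 1: "runs (move2 a b c) ?s (9 * length x + 1)
      (s(a := [], b := rev (s a) @ s b, c := rev (s a) @ s c))" .
  have "runs (Pop a ;; Push b v ;; Push c v) s 7 ?s"
    using runs_Seq[OF runs_Pop[of a s] runs_Seq[OF runs_Push[of b v] runs_Push[of c v]], of 5 7] assms
    by simp
  then have "runs (Cond a Skip (Pop a ;; Push b False ;; Push c False)
      (Pop a ;; Push b True ;; Push c True)) s 8 ?s"
    by - (rule runs_Cond[where b = v and xs = "x" and n = 7], auto)
  from runs_Loop[OF _ this 1[unfolded move2_def]] show ?case by (simp add: move2_def)
qed

fun pushes :: "nat \<Rightarrow> bool list \<Rightarrow> com" where
  "pushes a [] = Skip"
| "pushes a (b # w) = (pushes a w ;; Push a b)"

lemma runs_pushes: "runs (pushes a w) s (3 * length w + 1) (s(a := w @ s a))"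
proof (induction w)
  case Nil
  then show ?case using runs_Skip[of s] by (simp add: fun_upd_idem)
next
  case (Cons b w)
  have "(s(a := w @ s a))(a := b # (s(a := w @ s a)) a) = s(a := (b # w) @ s a)"
    by auto
  moreover have "runs (pushes a w ;; Push a b) s (3 * length (b # w) + 1)
      ((s(a := w @ s a))(a := b # (s(a := w @ s a)) a))"
    by (rule runs_Seq[OF Cons.IH runs_Push]) simp
  ultimately show ?case unfolding pushes.simps by (simp only:)
qed

text \<open>Binary trees serve as universal data; their codes can be parsed with a single counter.\<close>

datatype tree = Leaf | Node tree tree

primrec flat :: "tree \<Rightarrow> bool list" where
  "flat Leaf = [False]"
| "flat (Node l r) = True # flat l @ flat r"

text \<open>The stack \<open>c\<close> has one entry for each subtree that is still to be read: a
  leaf removes an entry, a node adds one.\<close>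

definition tree_loop :: "nat \<Rightarrow> nat \<Rightarrow> nat \<Rightarrow> com" where
  "tree_loop a b c = Loop c (Cond a Skip (Pop a ;; Push b False ;; Pop c)
     (Pop a ;; Push b True ;; Push c True))"

text \<open>The loop does not stop between the two subtrees of a node. The induction therefore takes
  the run on the rest of the input as a premise and extends it to the front.\<close>

lemma runs_tree_loop:
  assumes "distinct [a, b, c]"
    and "s a = flat t @ w" "s c = x # cs"
    and "runs (tree_loop a b c) (s(a := w, b := rev (flat t) @ s b, c := cs)) n s'"
  shows "runs (tree_loop a b c) s (n + 9 * length (flat t)) s'"
  using assms(2-)
proof (induction t arbitrary: s w x cs n)
  case Leaf
  have "runs (Pop a ;; Push b False ;; Pop c) s 6 (s(a := w, b := False # s b, c := cs))"
    using runs_Seq[OF runs_Pop[of a s] runs_Seq[OF runs_Push[of b False] runs_Pop[of c]], of 4 6]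
      assms(1) Leaf by (simp add: fun_upd_twist)
  then have "runs (Cond a Skip (Pop a ;; Push b False ;; Pop c) (Pop a ;; Push b True ;; Push c True))
      s 7 (s(a := w, b := False # s b, c := cs))"
    using Leaf by - (rule runs_Cond[where b = False and xs = "w" and n = 6], auto)
  moreover have "runs (tree_loop a b c) (s(a := w, b := False # s b, c := cs)) n s'"
    using Leaf(3) by (simp only: flat.simps rev.simps append.simps)
  ultimately show ?case
    using runs_Loop[of s c _ 7 _ n s' "n + 9 * length (flat Leaf)"] Leaf(2)
    unfolding tree_loop_def by simp
next
  case (Node l r)
  let ?w = "flat l @ flat r @ w"
  let ?s1 = "s(a := ?w, b := True # s b, c := True # x # cs)"
  have "runs (Pop a ;; Push b True ;; Push c True) s 7 ?s1"
    using runs_Seq[OF runs_Pop[of a s] runs_Seq[OF runs_Push[of b True] runs_Push[of c True]], of 5 7]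
      assms(1) Node(3,4) by simp
  then have 1: "runs (Cond a Skip (Pop a ;; Push b False ;; Pop c)
      (Pop a ;; Push b True ;; Push c True)) s 8 ?s1"
    using Node(3) by - (rule runs_Cond[where b = True and xs = "?w" and n = 7], auto)
  let ?s2 = "?s1(a := flat r @ w, b := rev (flat l) @ ?s1 b, c := x # cs)"
  have "?s2(a := w, b := rev (flat r) @ ?s2 b, c := cs)
      = s(a := w, b := rev (flat (Node l r)) @ s b, c := cs)"
    using assms(1) by auto
  from back_subst[of "\<lambda>u. runs (tree_loop a b c) u n s'", OF Node(5) this[symmetric]]
  have "runs (tree_loop a b c) (?s2(a := w, b := rev (flat r) @ ?s2 b, c := cs)) n s'" .
  note 2 = Node.IH(2)[OF _ _ this]
  have "?s2 a = flat r @ w" "?s2 c = x # cs" "?s1 a = flat l @ flat r @ w" "?s1 c = True # x # cs"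
    using assms(1) by auto
  from Node.IH(1)[OF this(3,4) 2[OF this(1,2)]]
  have "runs (tree_loop a b c) ?s1 (n + 9 * length (flat r) + 9 * length (flat l)) s'" .
  from runs_Loop[OF _ 1 this[unfolded tree_loop_def]] Node(4)
  show ?case unfolding tree_loop_def by simp
qed

definition tree_move :: "nat \<Rightarrow> nat \<Rightarrow> nat \<Rightarrow> com" where
  "tree_move a b c = (Push c True ;; tree_loop a b c)"

lemma runs_tree_move:
  assumes "distinct [a, b, c]" "s a = flat t @ w" "s c = []"
  shows "runs (tree_move a b c) s (9 * length (flat t) + 4) (s(a := w, b := rev (flat t) @ s b))"
proof -
  let ?s' = "s(a := w, b := rev (flat t) @ s b)"
  let ?s1 = "s(c := [True])"
  have "?s1(a := w, b := rev (flat t) @ ?s1 b, c := []) = ?s'"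
    using assms by auto
  then have "runs (tree_loop a b c) (?s1(a := w, b := rev (flat t) @ ?s1 b, c := [])) 1 ?s'"
    unfolding tree_loop_def using assms runs_Loop_Nil[of ?s' c] by simp
  from runs_tree_loop[OF assms(1) _ _ this]
  have "runs (tree_loop a b c) ?s1 (1 + 9 * length (flat t)) ?s'"
    using assms by simp
  from runs_Seq[OF runs_Push[of c True s] this[folded assms(3)]]
  show ?thesis unfolding tree_move_def by simp
qed

subsection \<open>Polynomial bounds\<close>

lemma poly_nat_mono: "m \<le> n \<Longrightarrow> poly (p :: nat poly) m \<le> poly p n"
  by (induction p) (auto intro!: mult_mono)

definition polyb :: "(nat \<Rightarrow> nat) \<Rightarrow> bool" where
  "polyb f \<longleftrightarrow> (\<exists>p. \<forall>n. f n \<le> poly p n)"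

lemma polyb_const: "polyb (\<lambda>_. c)"
  unfolding polyb_def by (rule exI[of _ "[:c:]"]) simp

lemma polyb_id: "polyb (\<lambda>n. n)"
  unfolding polyb_def by (rule exI[of _ "[:0, 1:]"]) simp

lemma polyb_add: "polyb f \<Longrightarrow> polyb g \<Longrightarrow> polyb (\<lambda>n. f n + g n)"
  unfolding polyb_def by (metis add_mono poly_add)

lemma polyb_mult: "polyb f \<Longrightarrow> polyb g \<Longrightarrow> polyb (\<lambda>n. f n * g n)"
  unfolding polyb_def by (metis mult_le_mono poly_mult)

lemma polyb_Suc: "polyb f \<Longrightarrow> polyb (\<lambda>n. Suc (f n))"
  using polyb_add[of f "\<lambda>_. 1"] polyb_const by simp

lemma polyb_poly:
  assumes "polyb f" shows "polyb (\<lambda>n. poly p (f n))"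
proof -
  obtain q where "\<And>n. f n \<le> poly q n" using assms by (auto simp: polyb_def)
  then have "poly p (f n) \<le> poly (pcompose p q) n" for n
    by (simp add: poly_pcompose poly_nat_mono)
  then show ?thesis unfolding polyb_def by blast
qed

lemmas polyb_intros = polyb_const polyb_id polyb_add polyb_mult polyb_Suc polyb_poly

subsection \<open>Closure properties\<close>

text \<open>
  The elements of \<open>D\<close> index the inputs \<open>i a\<close>; nothing is required of a program on other words.
\<close>

definition ptime :: "'a set \<Rightarrow> ('a \<Rightarrow> bool list) \<Rightarrow> ('a \<Rightarrow> bool list) \<Rightarrow> bool" where
  "ptime D i f \<longleftrightarrow> (\<exists>c (p :: nat poly). \<forall>a\<in>D.
     runs c (start (i a)) (poly p (length (i a))) (start (f a)))"

lemma ptimeI: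
  assumes "polyb b" "\<And>a. a \<in> D \<Longrightarrow> runs c (start (i a)) (b (length (i a))) (start (f a))"
  shows "ptime D i f"
proof -
  obtain p where "\<And>n. b n \<le> poly p n" using assms(1) by (auto simp: polyb_def)
  then show ?thesis unfolding ptime_def using assms(2) runs_mono by meson
qed

text \<open>The output is bounded because no stack grows by more than the number of steps.\<close>

lemma ptimeE:
  assumes "ptime D i f"
  obtains c p k where "below k c" "0 < k"
    "\<And>a. a \<in> D \<Longrightarrow> runs c (start (i a)) (poly p (length (i a))) (start (f a))"
    "\<And>a. a \<in> D \<Longrightarrow> length (f a) \<le> length (i a) + poly p (length (i a))"
proof -
  obtain c p where c: "\<And>a. a \<in> D \<Longrightarrow> runs c (start (i a)) (poly p (length (i a))) (start (f a))"
    using assms by (auto simp: ptime_def)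
  obtain k where "below k c" using ex_below by blast
  then have "below (Suc k) c" by (rule below_mono) simp
  moreover have "length (f a) \<le> length (i a) + poly p (length (i a))" if "a \<in> D" for a
    using runs_length[OF c[OF that], of 0] by (simp add: start_def)
  ultimately show thesis using that c by blast
qed

lemma ptime_length:
  assumes "ptime D i f"
  obtains p where "\<And>a. a \<in> D \<Longrightarrow> length (f a) \<le> poly p (length (i a))"
proof -
  obtain c p k where "\<And>a. a \<in> D \<Longrightarrow> length (f a) \<le> length (i a) + poly p (length (i a))"
    using ptimeE[OF assms] by metis
  then show thesis by (intro that[of "[:0, 1:] + p"]) simp
qed

lemma runs_Seq': "runs c s m s' \<Longrightarrow> runs d s' n s'' \<Longrightarrow> runs (c ;; d) s (Suc (m + n)) s''"
  by (rule runs_Seq) auto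

lemma runs_move':
  assumes "a \<noteq> b" "s' = s(a := [], b := rev (s a) @ s b)" "n = 6 * length (s a) + 1"
  shows "runs (move a b) s n s'"
  using runs_move assms by blast

lemma runs_move2':
  assumes "distinct [a, b, c]" "s' = s(a := [], b := rev (s a) @ s b, c := rev (s a) @ s c)"
    "n = 9 * length (s a) + 1"
  shows "runs (move2 a b c) s n s'"
  using runs_move2 assms by blast

lemma runs_clear':
  assumes "s' = s(a := [])" "n = 2 * length (s a) + 1"
  shows "runs (clear a) s n s'"
  using runs_clear assms by blast

lemma runs_Push':
  assumes "s' = s(r := b # s r)"
  shows "runs (Push r b) s 2 s'"
  using runs_Push assms by blast

lemma runs_Pop':
  assumes "s' = s(r := tl (s r))"
  shows "runs (Pop r) s 1 s'"
  using runs_Pop assms by blast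

lemma runs_tree_move':
  assumes "distinct [a, b, c]" "s a = flat t @ w" "s c = []"
    "s' = s(a := w, b := rev (flat t) @ s b)" "n = 9 * length (flat t) + 4"
  shows "runs (tree_move a b c) s n s'"
  using runs_tree_move[OF assms(1-3)] assms(4,5) by blast

lemma ptime_id: "ptime D i i"
proof (rule ptimeI)
  show "runs Skip (start (i a)) 1 (start (i a))" for a by (rule runs_Skip)
qed (intro polyb_intros)

lemma ptime_const: "ptime D i (\<lambda>_. w)"
proof (rule ptimeI)
  fix a
  have 1: "runs (clear 0) (start (i a)) (2 * length (i a) + 1) (start [])"
    by (rule runs_clear') (auto simp: start_def)
  have "runs (pushes 0 w) (start []) (3 * length w + 1) ((start [])(0 := w @ start [] 0))"
    by (rule runs_pushes)
  moreover have "(start [])(0 := w @ start [] 0) = start w" by (auto simp: start_def)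
  ultimately have 2: "runs (pushes 0 w) (start []) (3 * length w + 1) (start w)" by (simp only:)
  show "runs (clear 0 ;; pushes 0 w) (start (i a)) (Suc (2 * length (i a) + 1 + (3 * length w + 1)))
      (start w)"
    by (rule runs_Seq'[OF 1 2])
qed (intro polyb_intros)

lemma ptime_trans:
  assumes "ptime D i m" "ptime D m f"
  shows "ptime D i f"
proof -
  obtain c p where c: "\<And>a. a \<in> D \<Longrightarrow> runs c (start (i a)) (poly p (length (i a))) (start (m a))"
      "\<And>a. a \<in> D \<Longrightarrow> length (m a) \<le> length (i a) + poly p (length (i a))"
    using ptimeE[OF assms(1)] by metis
  obtain d q where d: "\<And>a. a \<in> D \<Longrightarrow> runs d (start (m a)) (poly q (length (m a))) (start (f a))"
    using ptimeE[OF assms(2)] by metis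
  show ?thesis
  proof (rule ptimeI)
    fix a assume "a \<in> D"
    from runs_mono[OF d[OF this] poly_nat_mono[OF c(2)[OF this]]] c(1)[OF this]
    show "runs (c ;; d) (start (i a))
        (Suc (poly p (length (i a)) + poly q (length (i a) + poly p (length (i a))))) (start (f a))"
      by (intro runs_Seq')
  qed (intro polyb_intros)
qed

lemma ptime_subset: "ptime D i f \<Longrightarrow> D' \<subseteq> D \<Longrightarrow> ptime D' i f"
  unfolding ptime_def by blast

lemma ptime_cong:
  "(\<And>a. a \<in> D \<Longrightarrow> i a = i' a) \<Longrightarrow> (\<And>a. a \<in> D \<Longrightarrow> f a = f' a) \<Longrightarrow> ptime D i f \<longleftrightarrow> ptime D i' f'"
  unfolding ptime_def by simp

lemma ptime_reindex: "ptime D i f \<Longrightarrow> h ` D' \<subseteq> D \<Longrightarrow> ptime D' (\<lambda>a. i (h a)) (\<lambda>a. f (h a))"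
  unfolding ptime_def by (meson image_subset_iff)

text \<open>The output is the code of a node, so this one rule yields pairing as well as
  \<open>Cons\<close>.\<close>

lemma ptime_fork:
  assumes "ptime D i f" "ptime D i g"
  shows "ptime D i (\<lambda>a. True # f a @ g a)"
proof -
  obtain c p k where c: "below k c" "0 < k"
      "\<And>a. a \<in> D \<Longrightarrow> runs c (start (i a)) (poly p (length (i a))) (start (f a))"
      "\<And>a. a \<in> D \<Longrightarrow> length (f a) \<le> length (i a) + poly p (length (i a))"
    using ptimeE[OF assms(1)] by metis
  obtain d q l where d: "below l d" "0 < l"
      "\<And>a. a \<in> D \<Longrightarrow> runs d (start (i a)) (poly q (length (i a))) (start (g a))"
    using ptimeE[OF assms(2)] by metis
  \<comment> \<open>Registers out of reach of both programs: \<open>B\<close> keeps the second copy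
    of the input and \<open>A\<close> the first result.\<close>
  define A where "A = k + l"
  define B where "B = Suc (k + l)"
  have AB: "0 < A" "0 < B" "A \<noteq> B" "k \<le> A" "k \<le> B" "l \<le> A" "l \<le> B"
    using c(2) d(2) by (auto simp: A_def B_def)
  show ?thesis
  proof (rule ptimeI)
    fix a assume a: "a \<in> D"
    let ?x = "i a" and ?f = "f a" and ?g = "g a"
    have 1: "runs (move2 0 A B) (start ?x) (9 * length ?x + 1)
        ((start [])(A := rev ?x, B := rev ?x))"
      using AB by (intro runs_move2') (auto simp: start_def)
    have 2: "runs (move A 0) ((start [])(A := rev ?x, B := rev ?x)) (6 * length ?x + 1)
        ((start ?x)(B := rev ?x))"
      using AB by (intro runs_move') (auto simp: start_def)
    have "((start ?x)(B := rev ?x))(0 := ?f) = (start ?f)(B := rev ?x)"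
      using AB by (auto simp: start_def)
    then have 3: "runs c ((start ?x)(B := rev ?x)) (poly p (length ?x)) ((start ?f)(B := rev ?x))"
      using runs_frame[OF c(3)[OF a] c(1,2), of "(start ?x)(B := rev ?x)"] AB
      by (auto simp: start_def)
    have 4: "runs (move 0 A) ((start ?f)(B := rev ?x)) (6 * length ?f + 1)
        ((start [])(A := rev ?f, B := rev ?x))"
      using AB by (intro runs_move') (auto simp: start_def)
    have 5: "runs (move B 0) ((start [])(A := rev ?f, B := rev ?x)) (6 * length ?x + 1)
        ((start ?x)(A := rev ?f))"
      using AB by (intro runs_move') (auto simp: start_def)
    have "((start ?x)(A := rev ?f))(0 := ?g) = (start ?g)(A := rev ?f)"
      using AB by (auto simp: start_def)
    then have 6: "runs d ((start ?x)(A := rev ?f)) (poly q (length ?x)) ((start ?g)(A := rev ?f))"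
      using runs_frame[OF d(3)[OF a] d(1,2), of "(start ?x)(A := rev ?f)"] AB
      by (auto simp: start_def)
    have 7: "runs (move A 0) ((start ?g)(A := rev ?f)) (6 * length ?f + 1) (start (?f @ ?g))"
      using AB by (intro runs_move') (auto simp: start_def)
    have 8: "runs (Push 0 True) (start (?f @ ?g)) 2 (start (True # ?f @ ?g))"
      by (intro runs_Push') (auto simp: start_def)
    have "runs (move2 0 A B ;; move A 0 ;; c ;; move 0 A ;; move B 0 ;; d ;; move A 0 ;; Push 0 True)
        (start ?x) (21 * length ?x + 12 * length ?f + poly p (length ?x) + poly q (length ?x) + 14)
        (start (True # ?f @ ?g))"
      by (rule runs_mono[OF runs_Seq'[OF 1 runs_Seq'[OF 2 runs_Seq'[OF 3 runs_Seq'[OF 4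
        runs_Seq'[OF 5 runs_Seq'[OF 6 runs_Seq'[OF 7 8]]]]]]]]) simp
    then show "runs (move2 0 A B ;; move A 0 ;; c ;; move 0 A ;; move B 0 ;; d ;; move A 0 ;; Push 0 True)
        (start ?x) (33 * length ?x + 13 * poly p (length ?x) + poly q (length ?x) + 14)
        (start (True # ?f @ ?g))"
      by (rule runs_mono) (use c(4)[OF a] in simp)
  qed (intro polyb_intros)
qed

lemma ptime_left: "ptime D (\<lambda>a. flat (Node (l a) (r a))) (\<lambda>a. flat (l a))"
proof (rule ptimeI)
  fix a
  let ?l = "flat (l a)" and ?r = "flat (r a)"
  have 1: "runs (Pop 0) (start (flat (Node (l a) (r a)))) 1 (start (?l @ ?r))"
    by (rule runs_Pop') (auto simp: start_def)
  have 2: "runs (tree_move 0 1 2) (start (?l @ ?r)) (9 * length ?l + 4) ((start ?r)(1 := rev ?l))"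
    by (rule runs_tree_move'[where t = "l a" and w = ?r]) (auto simp: start_def)
  have 3: "runs (clear 0) ((start ?r)(1 := rev ?l)) (2 * length ?r + 1) ((start [])(1 := rev ?l))"
    by (rule runs_clear') (auto simp: start_def)
  have 4: "runs (move 1 0) ((start [])(1 := rev ?l)) (6 * length ?l + 1) (start ?l)"
    by (rule runs_move') (auto simp: start_def)
  show "runs (Pop 0 ;; tree_move 0 1 2 ;; clear 0 ;; move 1 0) (start (flat (Node (l a) (r a))))
      (15 * length (flat (Node (l a) (r a))) + 20) (start ?l)"
    by (rule runs_mono[OF runs_Seq'[OF 1 runs_Seq'[OF 2 runs_Seq'[OF 3 4]]]]) simp
qed (intro polyb_intros)

lemma ptime_right: "ptime D (\<lambda>a. flat (Node (l a) (r a))) (\<lambda>a. flat (r a))"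
proof (rule ptimeI)
  fix a
  let ?l = "flat (l a)" and ?r = "flat (r a)"
  have 1: "runs (Pop 0) (start (flat (Node (l a) (r a)))) 1 (start (?l @ ?r))"
    by (rule runs_Pop') (auto simp: start_def)
  have 2: "runs (tree_move 0 1 2) (start (?l @ ?r)) (9 * length ?l + 4) ((start ?r)(1 := rev ?l))"
    by (rule runs_tree_move'[where t = "l a" and w = ?r]) (auto simp: start_def)
  have 3: "runs (clear 1) ((start ?r)(1 := rev ?l)) (2 * length ?l + 1) (start ?r)"
    by (rule runs_clear') (auto simp: start_def)
  show "runs (Pop 0 ;; tree_move 0 1 2 ;; clear 1) (start (flat (Node (l a) (r a))))
      (15 * length (flat (Node (l a) (r a))) + 20) (start ?r)"
    by (rule runs_mono[OF runs_Seq'[OF 1 runs_Seq'[OF 2 3]]]) simp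
qed (intro polyb_intros)

definition bool_tree :: "bool \<Rightarrow> tree" where
  "bool_tree b = (if b then Node Leaf Leaf else Leaf)"

text \<open>
  A test only looks at the first bit, so \<open>b\<close> may be any tree: false is a leaf, true is a node.
\<close>

lemma ptime_if:
  assumes "ptime D i (\<lambda>a. flat (b a))" "ptime {a \<in> D. b a \<noteq> Leaf} i f" "ptime {a \<in> D. b a = Leaf} i g"
  shows "ptime D i (\<lambda>a. if b a \<noteq> Leaf then f a else g a)"
proof -
  obtain c p k where c: "below k c" "0 < k"
      "\<And>a. a \<in> D \<Longrightarrow> runs c (start (i a)) (poly p (length (i a))) (start (flat (b a)))"
      "\<And>a. a \<in> D \<Longrightarrow> length (flat (b a)) \<le> length (i a) + poly p (length (i a))"
    using ptimeE[OF assms(1)] by metis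
  obtain d q where d:
      "\<And>a. a \<in> {a \<in> D. b a \<noteq> Leaf} \<Longrightarrow> runs d (start (i a)) (poly q (length (i a))) (start (f a))"
    using ptimeE[OF assms(2)] by metis
  obtain e r where e:
      "\<And>a. a \<in> {a \<in> D. b a = Leaf} \<Longrightarrow> runs e (start (i a)) (poly r (length (i a))) (start (g a))"
    using ptimeE[OF assms(3)] by metis
  define A where "A = k"
  define B where "B = Suc k"
  have AB: "0 < A" "0 < B" "A \<noteq> B" "k \<le> A" "k \<le> B"
    using c(2) by (auto simp: A_def B_def)
  let ?P = "clear 0 ;; move B 0"
  show ?thesis
  proof (rule ptimeI)
    fix a assume a: "a \<in> D"
    let ?x = "i a" and ?b = "flat (b a)"
    let ?n = "length ?x"
    let ?N = "2 * (?n + poly p ?n) + 6 * ?n + poly q ?n + poly r ?n + 10"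
    have 1: "runs (move2 0 A B) (start ?x) (9 * length ?x + 1)
        ((start [])(A := rev ?x, B := rev ?x))"
      using AB by (intro runs_move2') (auto simp: start_def)
    have 2: "runs (move A 0) ((start [])(A := rev ?x, B := rev ?x)) (6 * length ?x + 1)
        ((start ?x)(B := rev ?x))"
      using AB by (intro runs_move') (auto simp: start_def)
    have "((start ?x)(B := rev ?x))(0 := ?b) = (start ?b)(B := rev ?x)"
      using AB by (auto simp: start_def)
    then have 3: "runs c ((start ?x)(B := rev ?x)) (poly p (length ?x)) ((start ?b)(B := rev ?x))"
      using runs_frame[OF c(3)[OF a] c(1,2), of "(start ?x)(B := rev ?x)"] AB
      by (auto simp: start_def)
    have 4: "runs (clear 0) ((start ?b)(B := rev ?x)) (2 * length ?b + 1) ((start [])(B := rev ?x))"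
      using AB by (intro runs_clear') (auto simp: start_def)
    have 5: "runs (move B 0) ((start [])(B := rev ?x)) (6 * length ?x + 1) (start ?x)"
      using AB by (intro runs_move') (auto simp: start_def)
    note len = c(4)[OF a]
    have 6: "runs (if b a \<noteq> Leaf then clear 0 ;; move B 0 ;; d else clear 0 ;; move B 0 ;; e)
        ((start ?b)(B := rev ?x)) ?N (start (if b a \<noteq> Leaf then f a else g a))"
    proof (cases "b a \<noteq> Leaf")
      case True
      then have "runs (clear 0 ;; move B 0 ;; d) ((start ?b)(B := rev ?x)) ?N (start (f a))"
        using a len by (intro runs_mono[OF runs_Seq'[OF 4 runs_Seq'[OF 5 d]]]) auto
      with True show ?thesis by simp
    next
      case False
      then have "runs (clear 0 ;; move B 0 ;; e) ((start ?b)(B := rev ?x)) ?N (start (g a))"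
        using a len by (intro runs_mono[OF runs_Seq'[OF 4 runs_Seq'[OF 5 e]]]) auto
      with False show ?thesis by simp
    qed
    have "((start ?b)(B := rev ?x)) 0 = (b a \<noteq> Leaf) # tl ?b"
      using AB by (cases "b a") (auto simp: start_def)
    from runs_Cond[OF this 6 le_refl]
    have 7: "runs (Cond 0 Skip (clear 0 ;; move B 0 ;; e) (clear 0 ;; move B 0 ;; d))
        ((start ?b)(B := rev ?x)) (Suc ?N) (start (if b a \<noteq> Leaf then f a else g a))" .
    show "runs (move2 0 A B ;; move A 0 ;; c ;;
        Cond 0 Skip (clear 0 ;; move B 0 ;; e) (clear 0 ;; move B 0 ;; d)) (start ?x)
        (23 * ?n + 3 * poly p ?n + poly q ?n + poly r ?n + 20) (start (if b a \<noteq> Leaf then f a else g a))"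
      by (rule runs_mono[OF runs_Seq'[OF 1 runs_Seq'[OF 2 runs_Seq'[OF 3 7]]]]) simp
  qed (intro polyb_intros)
qed

text \<open>The code of \<open>u a\<close> is the clock: it is parked, and every round pops one bit
  of it. That a single step is polynomial does not bound the length of the iterates, so this is
  required separately for all of them.\<close>

lemma ptime_iterate:
  assumes step: "ptime E g (\<lambda>e. g (F e))"
    and closed: "\<And>e. e \<in> E \<Longrightarrow> F e \<in> E" "\<And>a. a \<in> D \<Longrightarrow> h a \<in> E"
    and bound: "\<And>a n. a \<in> D \<Longrightarrow> n \<le> length (flat (u a)) \<Longrightarrow>
      length (g ((F ^^ n) (h a))) \<le> poly q (length (True # flat (u a) @ g (h a)))"
  shows "ptime D (\<lambda>a. True # flat (u a) @ g (h a)) (\<lambda>a. g ((F ^^ length (flat (u a))) (h a)))"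
proof -
  obtain c p k where c: "below k c" "0 < k"
      "\<And>e. e \<in> E \<Longrightarrow> runs c (start (g e)) (poly p (length (g e))) (start (g (F e)))"
    using ptimeE[OF step] by metis
  define A where "A = k"
  define B where "B = Suc k"
  have AB: "0 < A" "0 < B" "A \<noteq> B" "k \<le> A" "k \<le> B"
    using c(2) by (auto simp: A_def B_def)
  have iter: "(F ^^ n) e \<in> E" if "e \<in> E" for n e
    using that closed(1) by (induction n) auto
  have loop: "runs (Loop A (Pop A ;; c)) ((start (g e))(A := w)) (length w * (N + 3) + 1)
      (start (g ((F ^^ length w) e)))"
    if "e \<in> E" "\<And>n. n \<le> length w \<Longrightarrow> poly p (length (g ((F ^^ n) e))) \<le> N" for w e N
    using that
  proof (induction w arbitrary: e)
    case Nil
    have "(start (g e))(A := []) = start (g e)" using AB by (auto simp: start_def)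
    moreover have "start (g e) A = []" using AB by (simp add: start_def)
    ultimately show ?case
      using runs_Loop_Nil by (simp only: list.size mult_0 add_0 funpow_0)
  next
    case (Cons b w)
    have 1: "runs (Pop A) ((start (g e))(A := b # w)) 1 ((start (g e))(A := w))"
      by (rule runs_Pop') (auto simp: start_def)
    have "((start (g e))(A := w))(0 := g (F e)) = (start (g (F e)))(A := w)"
      using AB by (auto simp: start_def)
    then have "runs c ((start (g e))(A := w)) (poly p (length (g e))) ((start (g (F e)))(A := w))"
      using runs_frame[OF c(3)[OF Cons.prems(1)] c(1,2), of "(start (g e))(A := w)"] AB
      by (auto simp: start_def)
    moreover have "poly p (length (g e)) \<le> N"
      using Cons.prems(2)[of 0] by simp
    ultimately have 2: "runs c ((start (g e))(A := w)) N ((start (g (F e)))(A := w))"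
      by (rule runs_mono)
    have "F e \<in> E" using Cons.prems closed by blast
    moreover have "poly p (length (g ((F ^^ n) (F e)))) \<le> N" if "n \<le> length w" for n
      using Cons.prems(2)[of "Suc n"] that by (simp add: funpow_swap1)
    ultimately have 3: "runs (Loop A (Pop A ;; c)) ((start (g (F e)))(A := w))
        (length w * (N + 3) + 1) (start (g ((F ^^ length w) (F e))))"
      by (rule Cons.IH)
    have "((start (g e))(A := b # w)) A \<noteq> []" by simp
    then have "runs (Loop A (Pop A ;; c)) ((start (g e))(A := b # w))
        (length (b # w) * (N + 3) + 1) (start (g ((F ^^ length w) (F e))))"
      by (rule runs_Loop[OF _ runs_Seq'[OF 1 2] 3]) simp
    moreover have "(F ^^ length w) (F e) = (F ^^ length (b # w)) e"
      by (simp add: funpow_swap1)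
    ultimately show ?case by (simp only:)
  qed
  show ?thesis
  proof (rule ptimeI)
    fix a assume a: "a \<in> D"
    let ?w = "True # flat (u a) @ g (h a)"
    let ?N = "poly p (poly q (length ?w))"
    have 1: "runs (Pop 0) (start ?w) 1 (start (flat (u a) @ g (h a)))"
      by (rule runs_Pop') (auto simp: start_def)
    have 2: "runs (tree_move 0 A B) (start (flat (u a) @ g (h a))) (9 * length (flat (u a)) + 4)
        ((start (g (h a)))(A := rev (flat (u a))))"
      using AB by (intro runs_tree_move'[where t = "u a" and w = "g (h a)"]) (auto simp: start_def)
    have 3: "runs (Loop A (Pop A ;; c)) ((start (g (h a)))(A := rev (flat (u a))))
        (length (rev (flat (u a))) * (?N + 3) + 1) (start (g ((F ^^ length (rev (flat (u a)))) (h a))))"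
      using closed(2)[OF a] bound[OF a] by (intro loop poly_nat_mono) auto
    show "runs (Pop 0 ;; tree_move 0 A B ;; Loop A (Pop A ;; c)) (start ?w)
        (length ?w * (?N + 12) + 8) (start (g ((F ^^ length (flat (u a))) (h a))))"
      by (rule runs_mono[OF runs_Seq'[OF 1 runs_Seq'[OF 2 3[unfolded length_rev]]]])
        (simp add: algebra_simps)
  qed (intro polyb_intros)
qed

section \<open>Polynomial-time functions on data types\<close>

class code =
  fixes rep :: "'a \<Rightarrow> tree"
  assumes rep_inject: "rep x = rep y \<longleftrightarrow> x = y"

instantiation tree :: code
begin
definition rep_tree :: "tree \<Rightarrow> tree" where [simp]: "rep_tree t = t"
instance by standard simp
end

instantiation unit :: code
begin
definition rep_unit :: "unit \<Rightarrow> tree" where [simp]: "rep_unit _ = Leaf"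
instance by standard simp
end

instantiation bool :: code
begin
definition rep_bool :: "bool \<Rightarrow> tree" where "rep_bool = bool_tree"
instance by standard (auto simp: rep_bool_def bool_tree_def)
end

instantiation prod :: (code, code) code
begin
definition rep_prod :: "'a \<times> 'b \<Rightarrow> tree" where
  rep_prod: "rep_prod p = Node (rep (fst p)) (rep (snd p))"
instance by standard (simp add: rep_prod rep_inject prod_eq_iff)
end

instantiation list :: (code) code
begin
primrec rep_list :: "'a list \<Rightarrow> tree" where
  "rep_list [] = Leaf"
| "rep_list (x # xs) = Node (rep x) (rep_list xs)"
instance
proof
  show "rep xs = rep ys \<longleftrightarrow> xs = ys" for xs ys :: "'a list"
  proof (induction xs arbitrary: ys)
    case Nil
    then show ?case by (cases ys) auto
  next
    case (Cons x xs)
    then show ?case by (cases ys) (auto simp: rep_inject)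
  qed
qed
end

instantiation nat :: code
begin
definition rep_nat :: "nat \<Rightarrow> tree" where "rep_nat n = rep (nat_bits n)"
instance by standard (simp add: rep_nat_def rep_inject inj_nat_bits)
end

instantiation int :: code
begin
definition rep_int :: "int \<Rightarrow> tree" where "rep_int i = rep (i < 0, nat \<bar>i\<bar>)"
instance by standard (auto simp: rep_int_def rep_inject)
end

definition code :: "'a :: code \<Rightarrow> bool list" where
  "code a = flat (rep a)"

abbreviation sz :: "'a :: code \<Rightarrow> nat" where
  "sz a \<equiv> length (code a)"

lemma flat_append_inject: "flat s @ u = flat t @ v \<longleftrightarrow> s = t \<and> u = v"
proof (induction s arbitrary: t u v)
  case Leaf
  then show ?case by (cases t) auto
next
  case (Node l r)
  then show ?case by (cases t) auto
qed

lemma code_inject: "code a = code b \<longleftrightarrow> a = b"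
  using flat_append_inject[of "rep a" "[]" "rep b" "[]"] by (simp add: code_def rep_inject)

lemma code_Pair: "code (a, b) = True # code a @ code b"
  by (simp add: code_def rep_prod)

lemma code_Cons: "code (a # as) = True # code a @ code as"
  by (simp add: code_def)

lemma code_Nil: "code [] = [False]"
  by (simp add: code_def)

lemma code_bool: "code b = (if b then [True, False, False] else [False])"
  by (simp add: code_def rep_bool_def bool_tree_def)

lemma sz_pos: "0 < sz a"
  by (cases "rep a") (simp_all add: code_def)

definition pt :: "('a :: code \<Rightarrow> 'b :: code) \<Rightarrow> bool" where
  "pt f \<longleftrightarrow> ptime UNIV code (\<lambda>a. code (f a))"

named_theorems pt_intros

lemma pt_size:
  assumes "pt f"
  obtains p where "\<And>a. sz (f a) \<le> poly p (sz a)"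
  using assms unfolding pt_def by (elim ptime_length) auto

lemma pt_comp:
  assumes "pt f" "pt g"
  shows "pt (\<lambda>x. f (g x))"
  using ptime_trans[OF assms(2)[unfolded pt_def]] ptime_reindex[OF assms(1)[unfolded pt_def], of g UNIV]
  by (auto simp: pt_def)

lemma pt_id [pt_intros]: "pt (\<lambda>x. x)"
  unfolding pt_def by (rule ptime_id)

lemma pt_const [pt_intros]: "pt (\<lambda>_. c)"
  unfolding pt_def by (rule ptime_const)

text \<open>A change of type that leaves the tree as it is costs nothing. This covers conversions
  such as \<open>nat_bits\<close>, \<open>spine\<close> and \<open>rep\<close>.\<close>

lemma pt_coerce:
  assumes "pt g" "\<And>x. rep (f x) = rep (g x)"
  shows "pt f"
  using assms by (simp add: pt_def code_def)

lemma pt_Pair [pt_intros]: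
  assumes "pt f" "pt g"
  shows "pt (\<lambda>x. (f x, g x))"
  using ptime_fork assms unfolding pt_def code_Pair by blast

lemma pt_Cons [pt_intros]:
  assumes "pt f" "pt g"
  shows "pt (\<lambda>x. f x # g x)"
  using ptime_fork assms unfolding pt_def code_Cons by blast

lemma pt_fst [pt_intros]:
  assumes "pt f" shows "pt (\<lambda>x. fst (f x))"
proof (rule pt_comp[OF _ assms])
  have *: "code = (\<lambda>p :: 'b \<times> 'c. flat (Node (rep (fst p)) (rep (snd p))))"
    by (rule ext) (simp add: code_def rep_prod)
  show "pt (fst :: 'b \<times> 'c \<Rightarrow> 'b)"
    using ptime_left[of UNIV "\<lambda>p. rep (fst p)" "\<lambda>p. rep (snd p)"] unfolding pt_def * by (simp add: code_def)
qed

lemma pt_snd [pt_intros]: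
  assumes "pt f" shows "pt (\<lambda>x. snd (f x))"
proof (rule pt_comp[OF _ assms])
  have *: "code = (\<lambda>p :: 'b \<times> 'c. flat (Node (rep (fst p)) (rep (snd p))))"
    by (rule ext) (simp add: code_def rep_prod)
  show "pt (snd :: 'b \<times> 'c \<Rightarrow> 'c)"
    using ptime_right[of UNIV "\<lambda>p. rep (fst p)" "\<lambda>p. rep (snd p)"] unfolding pt_def * by (simp add: code_def)
qed

lemma pt_if [pt_intros]:
  assumes "pt b" "pt f" "pt g"
  shows "pt (\<lambda>x. if b x then f x else g x)"
proof -
  have b: "ptime UNIV code (\<lambda>x. flat (bool_tree (b x)))"
    using assms(1) by (simp add: pt_def code_def rep_bool_def)
  have "ptime UNIV code (\<lambda>x. if bool_tree (b x) \<noteq> Leaf then code (f x) else code (g x))"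
    using assms(2,3) unfolding pt_def
    by (intro ptime_if[OF b]) (auto elim: ptime_subset)
  moreover have "(if bool_tree (b x) \<noteq> Leaf then code (f x) else code (g x))
      = code (if b x then f x else g x)" for x
    by (simp add: bool_tree_def)
  ultimately show ?thesis by (simp add: pt_def)
qed

text \<open>A nonempty list has the code of the pair of its head and its tail, so the second branch
  receives its arguments by \<open>ptime_fork\<close>. Here and in the rules for functions with
  bound variables, these variables become components of the argument, which lets the rules work
  below binders.\<close>

lemma pt_case_list [pt_intros]:
  assumes "pt l" "pt f" "pt (\<lambda>z. g (fst z) (fst (snd z)) (snd (snd z)))"
  shows "pt (\<lambda>x. case l x of [] \<Rightarrow> f x | a # as \<Rightarrow> g x a as)"
proof -
  let ?D = "{x. l x \<noteq> []}"
  have l: "ptime UNIV code (\<lambda>x. flat (rep (l x)))"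
    using assms(1) by (simp add: pt_def code_def)
  have cons: "code (x, hd (l x), tl (l x)) = True # code x @ code (l x)" if "x \<in> ?D" for x
    using that by (cases "l x") (simp_all add: code_Pair code_Cons)
  have "ptime ?D code (\<lambda>x. True # code x @ code (l x))"
    using assms(1) unfolding pt_def by (intro ptime_fork ptime_id) (auto elim: ptime_subset)
  then have 1: "ptime ?D code (\<lambda>x. code (x, hd (l x), tl (l x)))"
    using cons by (subst ptime_cong[OF refl, of _ "\<lambda>x. code (x, hd (l x), tl (l x))"]) auto
  have "ptime ?D (\<lambda>x. code (x, hd (l x), tl (l x))) (\<lambda>x. code (g x (hd (l x)) (tl (l x))))"
    using ptime_reindex[OF assms(3)[unfolded pt_def], of "\<lambda>x. (x, hd (l x), tl (l x))" ?D] by simp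
  from ptime_trans[OF 1 this]
  have g: "ptime {x \<in> UNIV. rep (l x) \<noteq> Leaf} code (\<lambda>x. code (g x (hd (l x)) (tl (l x))))"
    by (rule ptime_subset) auto
  have f: "ptime {x \<in> UNIV. rep (l x) = Leaf} code (\<lambda>x. code (f x))"
    using assms(2) unfolding pt_def by (rule ptime_subset) auto
  have "(if rep (l x) \<noteq> Leaf then code (g x (hd (l x)) (tl (l x))) else code (f x))
      = code (case l x of [] \<Rightarrow> f x | a # as \<Rightarrow> g x a as)" for x
    by (cases "l x") auto
  with ptime_if[OF l g f] show ?thesis by (simp add: pt_def)
qed

lemma pt_iterate:
  fixes F :: "'s :: code \<Rightarrow> 's"
  assumes u: "pt u" and h: "pt h" and F: "pt F"
    and bound: "\<And>x n. n \<le> sz (u x) \<Longrightarrow> sz ((F ^^ n) (h x)) \<le> poly q (sz (u x) + sz (h x))"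
  shows "pt (\<lambda>x. (F ^^ sz (u x)) (h x))"
proof -
  have "sz ((F ^^ n) (h x)) \<le> poly q (length (True # flat (rep (u x)) @ code (h x)))"
    if "n \<le> length (flat (rep (u x)))" for x n
    using bound[of n x] that
      poly_nat_mono[of "sz (u x) + sz (h x)" "length (True # flat (rep (u x)) @ code (h x))" q]
    by (simp add: code_def)
  then have "ptime UNIV (\<lambda>x. True # flat (rep (u x)) @ code (h x))
      (\<lambda>x. code ((F ^^ length (flat (rep (u x)))) (h x)))"
    using F unfolding pt_def by - (rule ptime_iterate[where E = UNIV and g = code and F = F], auto)
  moreover have "ptime UNIV code (\<lambda>x. True # flat (rep (u x)) @ code (h x))"
    using pt_Pair[OF u h] unfolding pt_def code_Pair by (simp add: code_def)
  ultimately show ?thesis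
    using ptime_trans by (simp add: pt_def code_def) 
qed

section \<open>Sizes of codes and bounded folds\<close>

lemma sz_Pair: "sz (a, b) = Suc (sz a + sz b)"
  by (simp add: code_Pair)

lemma sz_Cons: "sz (a # as) = Suc (sz a + sz as)"
  by (simp add: code_Cons)

lemma sz_Nil: "sz [] = 1"
  by (simp add: code_Nil)

lemma length_le_sz: "length l \<le> sz l"
  by (induction l) (auto simp: sz_Cons)

lemma sz_append: "sz (as @ bs) + 1 = sz as + sz bs"
  by (induction as) (auto simp: sz_Cons sz_Nil)

lemma sz_mem: "a \<in> set l \<Longrightarrow> sz a \<le> sz l"
  by (induction l) (auto simp: sz_Cons)

lemma sz_drop: "sz (drop n as) \<le> sz as"
  using sz_append[of "take n as" "drop n as"] sz_pos[of "take n as"]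
  by (simp del: length_greater_0_conv)

text \<open>The iterated state consists of the parameter, the remaining list and the accumulator.
  The clock \<open>sz (l x)\<close> is at least the length of the list, and \<open>F\<close> does
  nothing once the list is used up.\<close>

lemma pt_foldl_bounded:
  assumes f: "pt (\<lambda>z. f (fst z) (fst (snd z)) (snd (snd z)))" and i: "pt i" and l: "pt l"
    and bound: "\<And>x n. sz (foldl (f x) (i x) (take n (l x))) \<le> poly q (sz x)"
  shows "pt (\<lambda>x. foldl (f x) (i x) (l x))"
proof -
  define F where "F = (\<lambda>z. case fst (snd z) of [] \<Rightarrow> z
    | a # as \<Rightarrow> (fst z, as, f (fst z) (snd (snd z)) a))"
  have pf: "pt (\<lambda>x. f (a x) (b x) (c x))" if "pt a" "pt b" "pt c"
    for a :: "'x :: code \<Rightarrow> 'a" and b c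
    using pt_comp[OF f pt_Pair[OF that(1) pt_Pair[OF that(2,3)]]] by simp
  have F: "pt F"
    unfolding F_def by (intro pt_intros pf)
  have iter: "(F ^^ n) (x, as, acc) = (x, drop n as, foldl (f x) acc (take n as))" for n x as acc
  proof (induction n arbitrary: as acc)
    case (Suc n)
    then show ?case by (cases as) (simp_all add: funpow_Suc_right F_def del: funpow.simps)
  qed simp
  let ?q = "[:0, 2:] + q"
  have "pt (\<lambda>x. (F ^^ sz (l x)) (x, l x, i x))"
  proof (rule pt_iterate[where q = ?q])
    fix x n
    let ?m = "sz (l x) + sz (x, l x, i x)"
    have "sz (foldl (f x) (i x) (take n (l x))) \<le> poly q ?m"
      by (rule le_trans[OF bound poly_nat_mono]) (simp add: sz_Pair)
    then show "sz ((F ^^ n) (x, l x, i x)) \<le> poly ?q ?m"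
      using sz_drop[of n "l x"] by (simp add: iter sz_Pair)
  qed (intro pt_intros i l F)+
  then have "pt (\<lambda>x. snd (snd ((F ^^ sz (l x)) (x, l x, i x))))"
    by (intro pt_intros)
  then show ?thesis by (simp add: iter length_le_sz)
qed

text \<open>Additive growth per element keeps the accumulator polynomial. A measure other than
  \<open>sz\<close> is needed for numbers: the code of \<open>True\<close> is longer than that of
  \<open>False\<close>, so addition may change \<open>sz\<close> by a factor, while the bit length
  grows additively.\<close>

lemma pt_foldl_measure:
  assumes f: "pt (\<lambda>z. f (fst z) (fst (snd z)) (snd (snd z)))" and i: "pt i" and l: "pt l"
    and \<mu>: "\<And>acc. sz acc \<le> poly s (\<mu> acc)" "\<And>x. \<mu> (i x) \<le> poly r (sz x)"
      "\<And>x acc a. \<mu> (f x acc a) \<le> \<mu> acc + poly d (sz x + sz a)"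
  shows "pt (\<lambda>x. foldl (f x) (i x) (l x))"
proof -
  obtain t where t: "\<And>x. sz (l x) \<le> poly t (sz x)" using pt_size[OF l] by metis
  have bound: "\<mu> (foldl (f x) acc as) \<le> \<mu> acc + length as * poly d (sz x + N)"
    if "\<And>a. a \<in> set as \<Longrightarrow> sz a \<le> N" for x acc as N
    using that
  proof (induction as arbitrary: acc)
    case (Cons a as)
    have "\<mu> (foldl (f x) acc (a # as)) \<le> \<mu> (f x acc a) + length as * poly d (sz x + N)"
      using Cons by simp
    also have "\<mu> (f x acc a) \<le> \<mu> acc + poly d (sz x + N)"
      using \<mu>(3)[of x acc a] poly_nat_mono[of "sz x + sz a" "sz x + N" d] Cons.prems[of a] by simp
    finally show ?case by simp
  qed simp
  show ?thesis
  proof (rule pt_foldl_bounded[OF f i l])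
    fix x n
    have "\<mu> (foldl (f x) (i x) (take n (l x)))
        \<le> \<mu> (i x) + length (take n (l x)) * poly d (sz x + sz (l x))"
      by (rule bound, rule sz_mem, erule in_set_takeD)
    also have "\<dots> \<le> poly r (sz x) + poly t (sz x) * poly d (sz x + poly t (sz x))"
      using t[of x] \<mu>(2)[of x] length_le_sz[of "l x"]
      by (intro add_mono[OF _ mult_mono] poly_nat_mono) auto
    also have "\<dots> = poly (r + t * pcompose d ([:0, 1:] + t)) (sz x)"
      by (simp add: poly_pcompose)
    finally show "sz (foldl (f x) (i x) (take n (l x)))
        \<le> poly (pcompose s (r + t * pcompose d ([:0, 1:] + t))) (sz x)"
      using \<mu>(1) poly_nat_mono le_trans unfolding poly_pcompose by meson
  qed
qed

lemma pt_foldl: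
  assumes "pt (\<lambda>z. f (fst z) (fst (snd z)) (snd (snd z)))" "pt i" "pt l"
    and "\<And>x acc a. sz (f x acc a) \<le> sz acc + poly d (sz x + sz a)"
  shows "pt (\<lambda>x. foldl (f x) (i x) (l x))"
proof -
  obtain r where "\<And>x. sz (i x) \<le> poly r (sz x)" using pt_size[OF assms(2)] by metis
  with assms show ?thesis
    by (intro pt_foldl_measure[where s = "[:0, 1:]" and \<mu> = sz]) simp_all
qed

section \<open>Boolean and list operations\<close>

lemma pt_conj [pt_intros]:
  assumes "pt f" "pt g" shows "pt (\<lambda>x. f x \<and> g x)"
proof -
  have "(\<lambda>x. f x \<and> g x) = (\<lambda>x. if f x then g x else False)" by auto
  then show ?thesis using assms by (simp only: pt_if pt_const)
qed

lemma pt_not [pt_intros]: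
  assumes "pt f" shows "pt (\<lambda>x. \<not> f x)"
proof -
  have "(\<lambda>x. \<not> f x) = (\<lambda>x. if f x then False else True)" by auto
  then show ?thesis using assms by (simp only: pt_if pt_const)
qed

lemma pt_disj [pt_intros]: "pt f \<Longrightarrow> pt g \<Longrightarrow> pt (\<lambda>x. f x \<or> g x)"
  using pt_not[OF pt_conj[OF pt_not[of f] pt_not[of g]]] by simp

lemma pt_rev [pt_intros]:
  assumes "pt l" shows "pt (\<lambda>x. rev (l x))"
proof -
  have "foldl (\<lambda>acc a. a # acc) bs as = rev as @ bs" for as bs :: "'b list"
    by (induction as arbitrary: bs) auto
  moreover have "pt (\<lambda>x. foldl (\<lambda>acc a. a # acc) [] (l x))"
    by (intro pt_foldl[where d = "[:1, 1:]"] pt_intros assms) (simp add: sz_Cons)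
  ultimately show ?thesis by simp
qed

lemma pt_append [pt_intros]:
  assumes "pt k" "pt l" shows "pt (\<lambda>x. k x @ l x)"
proof -
  have "foldl (\<lambda>acc a. a # acc) bs as = rev as @ bs" for as bs :: "'b list"
    by (induction as arbitrary: bs) auto
  moreover have "pt (\<lambda>x. foldl (\<lambda>acc a. a # acc) (l x) (rev (k x)))"
    by (intro pt_foldl[where d = "[:1, 1:]"] pt_intros assms) (simp add: sz_Cons)
  ultimately show ?thesis by simp
qed

lemma pt_map [pt_intros]:
  assumes "pt (\<lambda>z. f (fst z) (snd z))" "pt l"
  shows "pt (\<lambda>x. map (f x) (l x))"
proof -
  obtain p where p: "\<And>x a. sz (f x a) \<le> poly p (sz (x, a))"
    using pt_size[OF assms(1)] by (metis fst_conv snd_conv)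
  have "foldl (\<lambda>acc a. f x a # acc) bs as = rev (map (f x) as) @ bs" for x as bs
    by (induction as arbitrary: bs) auto
  moreover have "pt (\<lambda>x. foldl (\<lambda>acc a. f x a # acc) [] (l x))"
  proof (rule pt_foldl[where d = "1 + pcompose p [:1, 1:]"])
    have "pt (\<lambda>z. f (fst z) (snd (snd z)))"
      using pt_comp[OF assms(1) pt_Pair[OF pt_fst[OF pt_id] pt_snd[OF pt_snd[OF pt_id]]]] by simp
    then show "pt (\<lambda>z. f (fst z) (snd (snd z)) # fst (snd z))"
      by (intro pt_intros)
    show "sz (f x a # acc) \<le> sz acc + poly (1 + pcompose p [:1, 1:]) (sz x + sz a)" for x a acc
      using p[of x a] by (simp add: sz_Cons sz_Pair poly_pcompose)
  qed (intro pt_intros assms)+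
  ultimately have "pt (\<lambda>x. rev (map (f x) (l x)))" by simp
  from pt_rev[OF this] show ?thesis by simp
qed

lemma pt_filter [pt_intros]:
  assumes "pt (\<lambda>z. P (fst z) (snd z))" "pt l"
  shows "pt (\<lambda>x. filter (P x) (l x))"
proof -
  have "foldl (\<lambda>acc a. if P x a then a # acc else acc) bs as = rev (filter (P x) as) @ bs" for x as bs
    by (induction as arbitrary: bs) auto
  moreover have "pt (\<lambda>x. foldl (\<lambda>acc a. if P x a then a # acc else acc) [] (l x))"
  proof (rule pt_foldl[where d = "[:1, 1:]"])
    have "pt (\<lambda>z. P (fst z) (snd (snd z)))"
      using pt_comp[OF assms(1) pt_Pair[OF pt_fst[OF pt_id] pt_snd[OF pt_snd[OF pt_id]]]] by simp
    then show "pt (\<lambda>z. if P (fst z) (snd (snd z)) then snd (snd z) # fst (snd z) else fst (snd z))"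
      by (intro pt_intros)
  qed (auto simp: sz_Cons intro!: pt_intros assms)
  ultimately have "pt (\<lambda>x. rev (filter (P x) (l x)))" by simp
  from pt_rev[OF this] show ?thesis by simp
qed

lemma pt_concat [pt_intros]:
  assumes "pt l" shows "pt (\<lambda>x. concat (l x))"
proof -
  have "foldl (@) bs as = bs @ concat as" for as and bs :: "'b list"
    by (induction as arbitrary: bs) auto
  moreover have "pt (\<lambda>x. foldl (@) [] (l x))"
  proof (rule pt_foldl[where d = "[:0, 1:]"])
    show "sz (acc @ a) \<le> sz acc + poly [:0, 1:] (sz x + sz a)" for acc a :: "'b list" and x :: 'a
      using sz_append[of acc a] by simp
  qed (intro pt_intros assms)+
  ultimately show ?thesis by simp
qed

lemma sz_bool: "sz (b :: bool) \<le> 3"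
  by (simp add: code_bool)

lemma pt_Ball [pt_intros]:
  assumes "pt (\<lambda>z. P (fst z) (snd z))" "pt l"
  shows "pt (\<lambda>x. \<forall>a\<in>set (l x). P x a)"
proof -
  have "(\<lambda>x. \<forall>a\<in>set (l x). P x a)
      = (\<lambda>x. case filter (\<lambda>a. \<not> P x a) (l x) of [] \<Rightarrow> True | _ # _ \<Rightarrow> False)"
    by (auto simp: fun_eq_iff filter_empty_conv split: list.splits)
      (metis filter_eq_ConsD append_Cons in_set_conv_decomp list.set_intros(1) mem_Collect_eq set_filter)
  moreover have "pt (\<lambda>x. case filter (\<lambda>a. \<not> P x a) (l x) of [] \<Rightarrow> True | _ # _ \<Rightarrow> False)"
    using assms by (intro pt_intros)
  ultimately show ?thesis by simp
qed

lemma pt_Bex [pt_intros]: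
  assumes "pt (\<lambda>z. P (fst z) (snd z))" "pt l"
  shows "pt (\<lambda>x. \<exists>a\<in>set (l x). P x a)"
  using pt_not[OF pt_Ball[OF pt_not[OF assms(1)] assms(2)]] by simp

subsection \<open>Words as data\<close>

text \<open>The inputs and outputs of \<open>polytime\<close> are plain words, whereas
  \<open>pt\<close> works on codes. This program and \<open>unquote_word\<close> translate between
  them. The code is built from its end, so the word is reversed first.\<close>

definition quote_word :: com where
  "quote_word = (move 0 1 ;; Push 0 False ;; Loop 1 (Cond 1 Skip
     (Pop 1 ;; Push 0 False ;; Push 0 True)
     (Pop 1 ;; Push 0 False ;; Push 0 False ;; Push 0 True ;; Push 0 True)))"

lemma ptime_quote: "ptime UNIV (\<lambda>w. w) (\<lambda>w :: bool list. code w)"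
proof (rule ptimeI)
  fix w :: "bool list"
  let ?no = "Pop 1 ;; Push 0 False ;; Push 0 True"
  let ?yes = "Pop 1 ;; Push 0 False ;; Push 0 False ;; Push 0 True ;; Push 0 True"
  have loop: "runs (Loop 1 (Cond 1 Skip ?no ?yes)) ((start (code v))(1 := x))
      (15 * length x + 1) (start (code (rev x @ v)))" for v x :: "bool list"
  proof (induction x arbitrary: v)
    case Nil
    have "(start (code v))(1 := []) = start (code v)" by (auto simp: start_def)
    moreover have "start (code v) 1 = []" by (simp add: start_def)
    ultimately show ?case
      using runs_Loop_Nil by (simp only: list.size mult_0_right add_0 rev.simps append.simps)
  next
    case (Cons b x)
    let ?s = "(start (code v))(1 := b # x)"
    have 1: "runs (Pop 1) ?s 1 ((start (code v))(1 := x))"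
      by (rule runs_Pop') (auto simp: start_def)
    have "runs ?no ?s 7 ((start (code (False # v)))(1 := x))"
      by (rule runs_mono[OF runs_Seq'[OF 1 runs_Seq'[OF runs_Push' runs_Push']]])
        (auto simp: start_def code_Cons code_bool)
    moreover have "runs ?yes ?s 13 ((start (code (True # v)))(1 := x))"
      by (rule runs_mono[OF runs_Seq'[OF 1 runs_Seq'[OF runs_Push' runs_Seq'[OF runs_Push'
          runs_Seq'[OF runs_Push' runs_Push']]]]])
        (auto simp: start_def code_Cons code_bool)
    ultimately have "runs (if b then ?yes else ?no) ?s 13 ((start (code (b # v)))(1 := x))"
      using runs_mono by (cases b) fastforce+
    then have "runs (Cond 1 Skip ?no ?yes) ?s 14 ((start (code (b # v)))(1 := x))"
      by - (rule runs_Cond[where b = b and xs = x and n = 13], auto)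
    note 2 = this
    have "?s 1 \<noteq> []" by simp
    from this 2 Cons.IH[of "b # v"] have "runs (Loop 1 (Cond 1 Skip ?no ?yes)) ?s (15 * length (b # x) + 1)
        (start (code (rev x @ b # v)))"
      by (rule runs_Loop) simp
    then show ?case by (simp only: rev.simps append_assoc append.simps)
  qed
  have 1: "runs (move 0 1) (start w) (6 * length w + 1) ((start [])(1 := rev w))"
    by (rule runs_move') (auto simp: start_def)
  have 2: "runs (Push 0 False) ((start [])(1 := rev w)) 2 ((start (code ([] :: bool list)))(1 := rev w))"
    by (rule runs_Push') (auto simp: start_def code_Nil)
  from loop[of "[]" "rev w"]
  have 3: "runs (Loop 1 (Cond 1 Skip ?no ?yes)) ((start (code ([] :: bool list)))(1 := rev w))
      (15 * length w + 1) (start (code w))"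
    by simp
  show "runs quote_word (start w) (21 * length w + 8) (start (code w))"
    unfolding quote_word_def by (rule runs_mono[OF runs_Seq'[OF 1 runs_Seq'[OF 2 3]]]) simp
qed (intro polyb_intros)

definition unquote_word :: com where
  "unquote_word = (Loop 0 (Cond 0 Skip (Pop 0) (Pop 0 ;; Cond 0 Skip
     (Pop 0 ;; Push 1 False) (Pop 0 ;; Pop 0 ;; Pop 0 ;; Push 1 True))) ;; move 1 0)"

lemma ptime_unquote: "ptime UNIV (\<lambda>w :: bool list. code w) (\<lambda>w. w)"
proof (rule ptimeI)
  fix w :: "bool list"
  let ?no = "Pop 0 ;; Push 1 False"
  let ?yes = "Pop 0 ;; Pop 0 ;; Pop 0 ;; Push 1 True"
  let ?c = "Cond 0 Skip (Pop 0) (Pop 0 ;; Cond 0 Skip ?no ?yes)"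
  have loop: "runs (Loop 0 ?c) ((start (code x))(1 := v))
      (13 * length x + 4) ((start [])(1 := rev x @ v))" for v x :: "bool list"
  proof (induction x arbitrary: v)
    case Nil
    let ?s = "(start (code ([] :: bool list)))(1 := v)"
    let ?t = "(start [])(1 := v)"
    have "runs (Pop 0) ?s 1 ?t"
      by (rule runs_Pop') (auto simp: start_def code_Nil)
    then have "runs ?c ?s 2 ?t"
      by - (rule runs_Cond[where b = False and xs = "[]" and n = 1], auto simp: start_def code_Nil)
    note 1 = this
    have 2: "runs (Loop 0 ?c) ?t 1 ?t" by (rule runs_Loop_Nil) (simp add: start_def)
    have "?s 0 \<noteq> []" by (simp add: start_def code_Nil)
    from this 1 2 have "runs (Loop 0 ?c) ?s 4 ?t" by (rule runs_Loop) simp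
    then show ?case by (simp only: list.size mult_0_right add_0 rev.simps append.simps)
  next
    case (Cons b x)
    let ?s = "(start (code (b # x)))(1 := v)"
    let ?s1 = "(start (code b @ code x))(1 := v)"
    let ?t = "(start (code x))(1 := b # v)"
    have 1: "runs (Pop 0) ?s 1 ?s1"
      by (rule runs_Pop') (auto simp: start_def code_Cons)
    have "runs (if b then ?yes else ?no) ?s1 8 ?t"
    proof (cases b)
      case True
      have "runs ?yes ?s1 8 ?t"
        by (rule runs_mono[OF runs_Seq'[OF runs_Pop' runs_Seq'[OF runs_Pop' runs_Seq'[OF runs_Pop'
            runs_Push']]]]) (use True in \<open>auto simp: start_def code_bool\<close>)
      with True show ?thesis by simp
    next
      case False
      have "runs ?no ?s1 8 ?t"
        by (rule runs_mono[OF runs_Seq'[OF runs_Pop' runs_Push']])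
          (use False in \<open>auto simp: start_def code_bool\<close>)
      with False show ?thesis by simp
    qed
    then have 2: "runs (Cond 0 Skip ?no ?yes) ?s1 9 ?t"
      by - (rule runs_Cond[where b = b and xs = "tl (code b) @ code x" and n = 8],
        auto simp: start_def code_bool)
    have "runs (Pop 0 ;; Cond 0 Skip ?no ?yes) ?s 11 ?t"
      by (rule runs_mono[OF runs_Seq'[OF 1 2]]) simp
    then have "runs ?c ?s 12 ?t"
      by - (rule runs_Cond[where b = True and xs = "code b @ code x" and n = 11],
        auto simp: start_def code_Cons)
    note 3 = this
    have "?s 0 \<noteq> []" by (simp add: start_def code_Cons)
    from this 3 Cons.IH[of "b # v"] have "runs (Loop 0 ?c) ?s (13 * length (b # x) + 4) ((start [])(1 := rev x @ b # v))"
      by (rule runs_Loop) simp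
    then show ?case by (simp only: rev.simps append_assoc append.simps)
  qed
  have "(start (code w))(1 := []) = start (code w)" by (auto simp: start_def)
  with loop[of w "[]"]
  have 1: "runs (Loop 0 ?c) (start (code w)) (13 * length w + 4) ((start [])(1 := rev w))"
    by simp
  have 2: "runs (move 1 0) ((start [])(1 := rev w)) (6 * length w + 1) (start w)"
    by (rule runs_move') (auto simp: start_def)
  show "runs unquote_word (start (code w)) (19 * length (code w) + 6) (start w)"
    unfolding unquote_word_def
    by (rule runs_mono[OF runs_Seq'[OF 1 2]]) (use length_le_sz[of w] in simp)
qed (intro polyb_intros)

theorem polytime_pt:
  fixes f :: "bool list \<Rightarrow> bool list"
  assumes "pt f" shows "polytime f"
proof -
  have "ptime UNIV (\<lambda>w. w) f"
    using ptime_trans[OF ptime_trans[OF ptime_quote assms[unfolded pt_def]]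
      ptime_reindex[OF ptime_unquote, of f UNIV]] by simp
  then obtain c p where "\<And>w. runs c (start w) (poly p (length w)) (start (f w))"
    unfolding ptime_def by auto
  then show ?thesis
    unfolding runs_def by (intro polytimeI[of c f p]) (metis fun_upd_same start_def)
qed

text \<open>A code is itself a word on the first stack, and quoting this word makes it available as
  data. Equality on every type is thereby reduced to equality of words.\<close>

lemma pt_code [pt_intros]:
  assumes "pt f" shows "pt (\<lambda>x. code (f x))"
  using ptime_trans[OF assms[unfolded pt_def] ptime_reindex[OF ptime_quote, of "\<lambda>x. code (f x)" UNIV]]
  by (simp add: pt_def)

lemma pt_eq_word:
  fixes f g :: "'a :: code \<Rightarrow> bool list"
  assumes "pt f" "pt g"
  shows "pt (\<lambda>x. f x = g x)"
proof -
  define step :: "bool \<times> bool list \<Rightarrow> bool \<Rightarrow> bool \<times> bool list" where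
    "step = (\<lambda>st b. case snd st of [] \<Rightarrow> (False, []) | c # cs \<Rightarrow> (if b then c \<and> fst st else \<not> c \<and> fst st, cs))"
  have run: "foldl step (ok, v) u = (True, []) \<longleftrightarrow> ok \<and> u = v" for ok u v
  proof (induction u arbitrary: ok v)
    case (Cons b u)
    then show ?case by (cases v) (auto simp: step_def)
  qed auto
  have "pt (\<lambda>x. foldl step (True, g x) (f x))"
    unfolding step_def
  proof (rule pt_foldl[where d = "[:3:]"])
    show "sz (case snd acc of [] \<Rightarrow> (False, []) | c # cs \<Rightarrow> (if a then c \<and> fst acc else \<not> c \<and> fst acc, cs))
        \<le> sz acc + poly [:3:] (sz x + sz a)" for x :: 'a and acc :: "bool \<times> bool list" and a
      by (cases acc) (auto simp: sz_Pair sz_Cons sz_Nil code_bool split: list.splits)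
  qed (intro pt_intros assms)+
  from this have "pt (\<lambda>x. fst (foldl step (True, g x) (f x)) \<and>
      (case snd (foldl step (True, g x) (f x)) of [] \<Rightarrow> True | _ # _ \<Rightarrow> False))"
    by (intro pt_intros)
  moreover have "fst (foldl step (True, g x) (f x)) \<and>
      (case snd (foldl step (True, g x) (f x)) of [] \<Rightarrow> True | _ # _ \<Rightarrow> False)
      \<longleftrightarrow> f x = g x" for x
    using run[of True "g x" "f x"]
    by (cases "foldl step (True, g x) (f x)") (auto split: list.splits)
  ultimately show ?thesis by simp
qed

lemma pt_eq [pt_intros]:
  assumes "pt f" "pt g" shows "pt (\<lambda>x. f x = g x)"
  using pt_eq_word[OF pt_code[OF assms(1)] pt_code[OF assms(2)]] by (simp add: code_inject)

subsection \<open>Binary arithmetic\<close>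

primrec bits_nat :: "bool list \<Rightarrow> nat" where
  "bits_nat [] = 0"
| "bits_nat (b # bs) = of_bool b + 2 * bits_nat bs"

lemma bits_nat_inverse [simp]: "bits_nat (nat_bits n) = n"
proof (induction n rule: less_induct)
  case (less n)
  show ?case
  proof (cases "n = 0")
    case False
    then show ?thesis using less[of "n div 2"] by (simp add: nat_bits_pos)
  qed simp
qed

text \<open>On representations, \<open>bits_nat\<close> only has to remove the leading zeros, which
  stand at the end of the list.\<close>

lemma nat_bits_bits_nat:
  "nat_bits (bits_nat bs) = foldr (\<lambda>b acc. if b \<or> acc \<noteq> [] then b # acc else []) bs []"
proof (induction bs)
  case (Cons b bs)
  have "nat_bits m \<noteq> [] \<longleftrightarrow> m \<noteq> 0" for m by (cases "m = 0") (simp_all add: nat_bits_pos)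
  moreover have "nat_bits (of_bool b + 2 * m) = b # nat_bits m" if "b \<or> m \<noteq> 0" for m
    using that by (subst nat_bits_pos) auto
  ultimately show ?case by (auto simp flip: Cons.IH)
qed simp

lemma bits_nat_append: "bits_nat (as @ bs) = bits_nat as + 2 ^ length as * bits_nat bs"
  by (induction as) (simp_all add: algebra_simps)

lemma bits_nat_less: "bits_nat bs < 2 ^ length bs"
  by (induction bs) auto

definition bitlen :: "nat \<Rightarrow> nat" where
  "bitlen n = length (nat_bits n)"

lemma less_exp_bitlen: "n < 2 ^ bitlen n"
  using bits_nat_less[of "nat_bits n"] by (simp add: bitlen_def)

lemma bitlen_le: "n < 2 ^ k \<Longrightarrow> bitlen n \<le> k"
proof (induction k arbitrary: n)
  case (Suc k)
  show ?case
  proof (cases "n = 0")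
    case False
    have "n div 2 < 2 ^ k" using Suc.prems by auto
    then show ?thesis using Suc.IH[of "n div 2"] False by (simp add: bitlen_def nat_bits_pos)
  qed (simp add: bitlen_def)
qed (simp add: bitlen_def)

lemma bitlen_mono: "m \<le> n \<Longrightarrow> bitlen m \<le> bitlen n"
  using less_exp_bitlen[of n] by (intro bitlen_le) simp

lemma bitlen_le_self: "bitlen n \<le> n"
  by (rule bitlen_le) simp

lemma bitlen_add: "bitlen (m + n) \<le> bitlen m + bitlen n + 1"
proof (rule bitlen_le)
  have "m < 2 ^ (bitlen m + bitlen n)"
    using less_exp_bitlen[of m] by (rule less_le_trans) simp
  moreover have "n < 2 ^ (bitlen m + bitlen n)"
    using less_exp_bitlen[of n] by (rule less_le_trans) simp
  ultimately show "m + n < 2 ^ (bitlen m + bitlen n + 1)" by simp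
qed

lemma sz_nat_le: "sz (n :: nat) \<le> 4 * bitlen n + 1"
proof -
  have "sz bs \<le> 4 * length bs + 1" for bs :: "bool list"
    by (induction bs) (auto simp: sz_Cons sz_Nil code_bool)
  then show ?thesis by (simp add: code_def rep_nat_def bitlen_def)
qed

lemma bitlen_le_sz: "bitlen n \<le> sz n"
  using length_le_sz[of "nat_bits n"] by (simp add: code_def rep_nat_def bitlen_def)

lemma pt_nat_bits [pt_intros]: "pt f \<Longrightarrow> pt (\<lambda>x. nat_bits (f x))"
  by (erule pt_coerce) (simp add: rep_nat_def)

lemma pt_bits_nat [pt_intros]:
  assumes "pt f" shows "pt (\<lambda>x. bits_nat (f x))"
proof -
  let ?step = "\<lambda>acc b. if b \<or> acc \<noteq> [] then b # acc else []"
  have "pt (\<lambda>x. foldl ?step [] (rev (f x)))"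
    by (intro pt_foldl[where d = "[:1, 1:]"] pt_intros assms) (auto simp: sz_Cons sz_Nil)
  then show ?thesis
    by (rule pt_coerce) (simp add: rep_nat_def nat_bits_bits_nat foldl_conv_foldr)
qed

fun zip_bits :: "bool list \<Rightarrow> bool list \<Rightarrow> (bool \<times> bool) list" where
  "zip_bits [] ys = map (Pair False) ys"
| "zip_bits (x # xs) [] = (x, False) # zip_bits xs []"
| "zip_bits (x # xs) (y # ys) = (x, y) # zip_bits xs ys"

lemma bits_nat_zip_bits:
  "bits_nat (map fst (zip_bits xs ys)) = bits_nat xs \<and> bits_nat (map snd (zip_bits xs ys)) = bits_nat ys"
proof (induction xs ys rule: zip_bits.induct)
  case (1 ys)
  have "bits_nat (map (\<lambda>_. False) ys) = 0" by (induction ys) auto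
  then show ?case by (simp add: comp_def)
qed auto

lemma pt_zip_bits [pt_intros]:
  assumes "pt f" "pt g" shows "pt (\<lambda>x. zip_bits (f x) (g x))"
proof -
  define step :: "bool list \<times> (bool \<times> bool) list \<Rightarrow> bool \<Rightarrow> bool list \<times> (bool \<times> bool) list" where
    "step = (\<lambda>st b. case fst st of [] \<Rightarrow> ([], (b, False) # snd st) | c # cs \<Rightarrow> (cs, (b, c) # snd st))"
  have run: "rev (snd st) @ map (Pair False) (fst st) = rev zs @ zip_bits xs ys"
    if "st = foldl step (ys, zs) xs" for st xs ys zs
    using that
  proof (induction xs arbitrary: st ys zs)
    case (Cons x xs)
    then show ?case by (cases ys) (auto simp: step_def)
  qed simp
  have "pt (\<lambda>x. foldl step (g x, []) (f x))"
    unfolding step_def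
  proof (rule pt_foldl[where d = "[:5, 1:]"])
    show "sz (case fst acc of [] \<Rightarrow> ([], (a, False) # snd acc) | c # cs \<Rightarrow> (cs, (a, c) # snd acc))
        \<le> sz acc + poly [:5, 1:] (sz x + sz a)" for x :: 'a and acc :: "bool list \<times> (bool \<times> bool) list" and a
      using sz_bool by (cases acc) (auto simp: sz_Pair sz_Cons sz_Nil code_bool split: list.splits)
  qed (intro pt_intros assms)+
  then have "pt (\<lambda>x. rev (snd (foldl step (g x, []) (f x)))
      @ map (Pair False) (fst (foldl step (g x, []) (f x))))"
    by (intro pt_intros)
  then show ?thesis using run[OF refl, of _ "[]"] by simp
qed

lemma pt_add [pt_intros]:
  assumes "pt f" "pt g" shows "pt (\<lambda>x. f x + g x :: nat)"
proof -
  \<comment> \<open>The state is the carry with the reversed output. Two equal bits put out the old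
    carry and become the new one; two different bits put out the negated carry and pass it
    on.\<close>
  define step :: "bool \<times> bool list \<Rightarrow> bool \<times> bool \<Rightarrow> bool \<times> bool list" where
    "step = (\<lambda>st p. if fst p = snd p then (fst p, fst st # snd st) else (fst st, (\<not> fst st) # snd st))"
  have run: "bits_nat (rev (snd st) @ [fst st])
      = bits_nat (rev out) + 2 ^ length out * (of_bool c + bits_nat (map fst z) + bits_nat (map snd z))"
    if "st = foldl step (c, out) z" for st c out z
    using that
  proof (induction z arbitrary: st c out)
    case (Cons p z)
    then show ?case
      by (cases p; cases "fst p"; cases "snd p"; cases c)
        (simp_all add: step_def bits_nat_append algebra_simps)
  qed (simp add: bits_nat_append)
  let ?st = "\<lambda>x. foldl step (False, []) (zip_bits (nat_bits (f x)) (nat_bits (g x)))"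
  have "pt ?st"
    unfolding step_def
  proof (rule pt_foldl[where d = "[:4:]"])
    show "sz (if fst a = snd a then (fst a, fst acc # snd acc) else (fst acc, (\<not> fst acc) # snd acc))
        \<le> sz acc + poly [:4:] (sz x + sz a)" for x :: 'a and acc :: "bool \<times> bool list" and a
      by (cases acc; cases a) (auto simp: sz_Pair sz_Cons code_bool)
  qed (intro pt_intros assms)+
  then have "pt (\<lambda>x. bits_nat (rev (snd (?st x)) @ [fst (?st x)]))"
    by (intro pt_intros)
  then show ?thesis
    using run[OF refl, of False "[]"] bits_nat_zip_bits by simp
qed

lemma pt_le [pt_intros]:
  assumes "pt f" "pt g" shows "pt (\<lambda>x. f x \<le> (g x :: nat))"
proof -
  \<comment> \<open>The least significant bits come first, so the last position with different bits
    decides.\<close>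
  define step :: "bool \<Rightarrow> bool \<times> bool \<Rightarrow> bool" where
    "step = (\<lambda>r p. if fst p = snd p then r else snd p)"
  have run: "foldl step r z \<longleftrightarrow> (if bits_nat (map fst z) = bits_nat (map snd z) then r
      else bits_nat (map fst z) < bits_nat (map snd z))" for r z
  proof (induction z arbitrary: r)
    case (Cons p z)
    then show ?case by (cases p; cases "fst p"; cases "snd p") (auto simp: step_def)
  qed simp
  have "pt (\<lambda>x. foldl step True (zip_bits (nat_bits (f x)) (nat_bits (g x))))"
    unfolding step_def
    by (intro pt_foldl[where d = "[:3:]"] pt_intros assms) (auto simp: code_bool)
  moreover have "(\<lambda>x. f x \<le> g x)
      = (\<lambda>x. foldl step True (zip_bits (nat_bits (f x)) (nat_bits (g x))))"
    using bits_nat_zip_bits by (auto simp: run fun_eq_iff)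
  ultimately show ?thesis by simp
qed

lemma pt_less [pt_intros]: "pt f \<Longrightarrow> pt g \<Longrightarrow> pt (\<lambda>x. f x < (g x :: nat))"
  using pt_not[OF pt_le[of g f]] by (simp add: not_le)

lemma pt_Suc [pt_intros]: "pt f \<Longrightarrow> pt (\<lambda>x. Suc (f x))"
  using pt_add[OF _ pt_const[of 1], of f] by simp

lemma pt_sum_list [pt_intros]:
  assumes "pt l" shows "pt (\<lambda>x. sum_list (l x) :: nat)"
proof -
  have "pt (\<lambda>x. foldl (+) (0 :: nat) (l x))"
  proof (rule pt_foldl_measure[where \<mu> = bitlen and s = "[:1, 4:]" and r = 0 and d = "[:1, 1:]"])
    show "bitlen (acc + a) \<le> bitlen acc + poly [:1, 1:] (sz x + sz a)" for acc a and x :: 'a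
      using bitlen_add[of acc a] bitlen_le_sz[of a] by simp
    show "sz acc \<le> poly [:1, 4:] (bitlen acc)" for acc
      using sz_nat_le[of acc] by (simp add: mult.commute)
  qed (auto simp: bitlen_def intro!: pt_intros assms)
  moreover have "foldl (+) m as = m + sum_list as" for m and as :: "nat list"
    by (induction as arbitrary: m) auto
  ultimately show ?thesis by simp
qed

lemma pt_length [pt_intros]:
  assumes "pt l" shows "pt (\<lambda>x. length (l x))"
  using pt_sum_list[OF pt_map[OF pt_const[of 1] assms]] by (simp add: sum_list_triv)

text \<open>The upper end is the length of a list, hence a number in unary: for a number in binary,
  the range could be exponentially long.\<close>

lemma pt_upt_length [pt_intros]:
  assumes "pt l" shows "pt (\<lambda>x. [0..<length (l x)])"
proof -
  obtain t where t: "\<And>x. sz (l x) \<le> poly t (sz x)" using pt_size[OF assms] by metis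
  have run: "foldl (\<lambda>acc _. acc @ [length acc]) [] as = [0..<length as]" for as :: "'b list"
    by (induction as rule: rev_induct) auto
  have sz_upt: "sz [0..<n] \<le> n * (4 * n + 2) + 1" for n
  proof -
    have "sz l \<le> length l * (4 * n + 2) + 1" if "\<And>k. k \<in> set l \<Longrightarrow> k \<le> n" for l :: "nat list"
      using that
    proof (induction l)
      case (Cons k l)
      have "sz k \<le> 4 * n + 1"
        using sz_nat_le[of k] bitlen_le_self[of k] Cons.prems[of k] by simp
      then show ?case using Cons by (simp add: sz_Cons)
    qed (simp add: sz_Nil)
    from this[of "[0..<n]"] show ?thesis by simp
  qed
  have "pt (\<lambda>x. foldl (\<lambda>acc _. acc @ [length acc]) [] (l x))"
  proof (rule pt_foldl_bounded[where q = "t * ([:4:] * t + [:2:]) + 1"])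
    fix x n
    have "length (take n (l x)) \<le> poly t (sz x)"
      using length_le_sz[of "l x"] t[of x] by simp
    then have "length (take n (l x)) * (4 * length (take n (l x)) + 2) + 1
        \<le> poly t (sz x) * (4 * poly t (sz x) + 2) + 1"
      by (intro add_mono mult_mono) auto
    then show "sz (foldl (\<lambda>acc _. acc @ [length acc]) [] (take n (l x)))
        \<le> poly (t * ([:4:] * t + [:2:]) + 1) (sz x)"
      using sz_upt[of "length (take n (l x))"] unfolding run by simp
  qed (intro pt_intros assms)+
  then show ?thesis by (simp add: run)
qed

text \<open>Lists of units are numbers in unary. The induction on the polynomial is its evaluation
  by the scheme of Horner; the reduction takes the sizes of its tables from here.\<close>

lemma pt_poly_replicate [pt_intros]:
  assumes "pt l" shows "pt (\<lambda>x. replicate (poly p (length (l x))) ())"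
proof (induction p)
  case 0
  show ?case by (simp add: pt_const)
next
  case (pCons a p)
  have "concat (map (\<lambda>_. replicate m ()) as) = replicate (length as * m) ()" for m and as :: "'b list"
    by (induction as) (auto simp: replicate_add)
  moreover have "pt (\<lambda>x. replicate a () @ concat (map (\<lambda>_. replicate (poly p (length (l x))) ()) (l x)))"
    by (intro pt_intros assms pt_comp[OF pCons.IH])
  ultimately show ?case by (simp add: replicate_add)
qed

section \<open>Subset sum as a scheduling problem on two vehicles\<close>

definition active :: "nat \<Rightarrow> (nat \<Rightarrow> nat) \<Rightarrow> (nat \<Rightarrow> nat) \<Rightarrow> nat \<Rightarrow> nat set" where
  "active n st len t = {j. j < n \<and> st j \<le> t \<and> t < st j + len j}"

lemma finite_active [simp]: "finite (active n st len t)"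
  by (simp add: active_def)

text \<open>
  As the total load fills both vehicles, every time is covered exactly twice. So a job that ends
  before the horizon is followed immediately by another one, and a chain of consecutive jobs that
  starts at time 1 reaches the horizon.
\<close>

lemma schedule_imp_partition:
  assumes st: "\<And>j. j < n \<Longrightarrow> 1 \<le> st j \<and> st j + len j \<le> Suc H"
    and two: "\<And>t. t \<in> {1..H} \<Longrightarrow> card (active n st len t) \<le> 2"
    and total: "(\<Sum>j<n. len j) = 2 * H"
  shows "\<exists>A\<subseteq>{..<n}. (\<Sum>j\<in>A. len j) = H"
proof -
  have "(\<Sum>t\<in>{1..H}. card (active n st len t))
      = (\<Sum>t\<in>{1..H}. \<Sum>j<n. if st j \<le> t \<and> t < st j + len j then 1 else 0)"
    by (intro sum.cong refl) (simp add: active_def sum.If_cases Int_def)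
  also have "\<dots> = (\<Sum>j<n. \<Sum>t\<in>{1..H}. if st j \<le> t \<and> t < st j + len j then 1 else 0)"
    by (rule sum.swap)
  also have "\<dots> = (\<Sum>j<n. len j)"
  proof (intro sum.cong refl)
    fix j assume "j \<in> {..<n}"
    then have "{1..H} \<inter> {t. st j \<le> t \<and> t < st j + len j} = {st j..<st j + len j}"
      using st[of j] by auto
    then show "(\<Sum>t\<in>{1..H}. if st j \<le> t \<and> t < st j + len j then 1 else 0) = len j"
      by (simp add: sum.If_cases)
  qed
  finally have sum: "(\<Sum>t\<in>{1..H}. card (active n st len t)) = (\<Sum>t\<in>{1..H}. 2)"
    using total by simp
  have sat: "card (active n st len t) = 2" if "t \<in> {1..H}" for t
  proof (rule ccontr)
    assume "card (active n st len t) \<noteq> 2"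
    then have "(\<Sum>t\<in>{1..H}. card (active n st len t)) < (\<Sum>t\<in>{1..H}. 2)"
      using that two by (intro sum_strict_mono_ex1) (auto intro!: bexI[of _ t] simp: le_neq_implies_less)
    with sum show False by simp
  qed
  \<comment> \<open>Of a chain that ends at time \<open>e\<close>, only this is recorded: its total
    length, that its jobs have ended by \<open>e\<close>, and that some nonempty job ends exactly at
    \<open>e\<close>, unless the chain is empty.\<close>
  define P where "P e \<longleftrightarrow> (\<exists>A\<subseteq>{..<n}. Suc (\<Sum>j\<in>A. len j) = e \<and> (\<forall>j\<in>A. st j + len j \<le> e)
    \<and> (e = 1 \<or> (\<exists>j<n. 0 < len j \<and> st j + len j = e)))" for e
  have "P 1" unfolding P_def by (intro exI[of _ "{}"]) simp
  have le: "e \<le> Suc H" if "P e" for e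
  proof -
    have "e = 1 \<or> (\<exists>j<n. st j + len j = e)" using that by (auto simp: P_def)
    then show ?thesis using st by auto
  qed
  define e where "e = Max {e. P e}"
  have fin: "finite {e. P e}" using le by (auto intro: finite_subset[of _ "{..Suc H}"])
  have "P e" using Max_in[OF fin] \<open>P 1\<close> by (auto simp: e_def)
  then obtain A where A: "A \<subseteq> {..<n}" "Suc (\<Sum>j\<in>A. len j) = e" "\<And>j. j \<in> A \<Longrightarrow> st j + len j \<le> e"
    and e: "e = 1 \<or> (\<exists>j<n. 0 < len j \<and> st j + len j = e)" by (auto simp: P_def)
  have "\<not> e \<le> H"
  proof
    assume "e \<le> H"
    moreover have "1 \<le> e" using A(2) by simp
    ultimately have c: "card (active n st len e) = 2" by (intro sat) simp
    \<comment> \<open>A nonempty job that ends at \<open>e\<close> is active at \<open>e - 1\<close>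
      but no longer at \<open>e\<close>. As two jobs are active at \<open>e\<close> and at most two
      at \<open>e - 1\<close>, one of those at \<open>e\<close> has just started. At time 1 there is
      nothing earlier, so every active job has just started.\<close>
    have "\<exists>j\<in>active n st len e. st j = e"
    proof (cases "e = 1")
      case True
      obtain j where "j \<in> active n st len e" using c by fastforce
      then show ?thesis using st[of j] True by (intro bexI[of _ j]) (auto simp: active_def)
    next
      case False
      then obtain i where i: "i < n" "0 < len i" "st i + len i = e" using e by auto
      have "i \<in> active n st len (e - 1)" using i st[of i] by (auto simp: active_def)
      moreover have "i \<notin> active n st len e" using i by (simp add: active_def)
      moreover have "card (active n st len (e - 1)) \<le> 2"
        using \<open>1 \<le> e\<close> False \<open>e \<le> H\<close> by (intro two) (simp, arith)
      ultimately have "\<not> active n st len e \<subseteq> active n st len (e - 1)"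
        using c psubset_card_mono[of "active n st len (e - 1)" "active n st len e"] by force
      then obtain j where "j \<in> active n st len e" "j \<notin> active n st len (e - 1)" by blast
      then show ?thesis by (intro bexI[of _ j]) (auto simp: active_def)
    qed
    then obtain j where j: "j < n" "st j = e" "0 < len j" by (auto simp: active_def)
    have "j \<notin> A" using A(3)[of j] j by auto
    moreover have "finite A" using A(1) finite_subset by blast
    ultimately have "P (e + len j)"
      unfolding P_def using A j
      by (intro exI[of _ "insert j A"]) (auto intro: le_trans[OF A(3)])
    then have "e + len j \<le> e" unfolding e_def by (intro Max_ge fin) simp
    with j show False by simp
  qed
  with le[OF \<open>P e\<close>] have "e = Suc H" by simp
  with A show ?thesis by auto
qed

text \<open>Each vehicle serves one class of jobs in the order of indices and without a pause. Both
  classes have total length \<open>H\<close>, so every job ends by \<open>Suc H\<close>, and jobs of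
  the same class never overlap.\<close>

lemma partition_imp_schedule:
  assumes A: "A \<subseteq> {..<n}" "(\<Sum>j\<in>A. len j) = H" and total: "(\<Sum>j<n. len j) = 2 * H"
  obtains st where "\<And>j. j < n \<Longrightarrow> 1 \<le> st j \<and> st j + len j \<le> Suc H"
    "\<And>t. card (active n st len t) \<le> 2"
proof -
  define C where "C j = (if j \<in> A then A else {..<n} - A)" for j
  define st where "st j = Suc (\<Sum>i\<in>C j \<inter> {..<j}. len i)" for j
  have "(\<Sum>j<n. len j) = (\<Sum>j\<in>A. len j) + (\<Sum>j\<in>{..<n} - A. len j)"
    using A(1) by (simp add: sum.subset_diff add.commute)
  then have C: "(\<Sum>i\<in>C j. len i) = H" for j
    using A total by (simp add: C_def)
  have fin: "finite (C j)" for j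
    using A(1) finite_subset by (auto simp: C_def)
  have mem: "j \<in> C j" if "j < n" for j using that by (simp add: C_def)
  have step: "st i + len i \<le> st j" if "i < j" "i < n" "C i = C j" for i j
  proof -
    have "(\<Sum>k\<in>insert i (C i \<inter> {..<i}). len k) \<le> (\<Sum>k\<in>C j \<inter> {..<j}. len k)"
      using that mem[of i] fin by (intro sum_mono2) auto
    then show ?thesis using fin by (simp add: st_def)
  qed
  have disj: "i = j" if "i \<in> active n st len t" "j \<in> active n st len t" "C i = C j" for i j t
    using that step[of i j] step[of j i] by (cases i j rule: linorder_cases) (auto simp: active_def)
  show thesis
  proof
    fix j assume j: "j < n"
    have "(\<Sum>k\<in>insert j (C j \<inter> {..<j}). len k) \<le> (\<Sum>k\<in>C j. len k)"
      using mem[OF j] fin by (intro sum_mono2) auto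
    then show "1 \<le> st j \<and> st j + len j \<le> Suc H"
      using fin C by (simp add: st_def)
  next
    fix t
    have "card (active n st len t \<inter> A) \<le> Suc 0" "card (active n st len t - A) \<le> Suc 0"
      by (auto simp: card_le_Suc0_iff_eq C_def intro!: disj[of _ t])
    moreover have "card (active n st len t)
        \<le> card (active n st len t \<inter> A) + card (active n st len t - A)"
      using card_Un_le[of "active n st len t \<inter> A" "active n st len t - A"] by (simp add: Int_Diff_Un)
    ultimately show "card (active n st len t) \<le> 2" by simp
  qed
qed

text \<open>Capacity 1 turns every group into a single job, whose length is the duration of the
  stop. With \<open>req_time = 0\<close> and \<open>T_w = Suc H\<close> the time window admits all
  departures in the horizon, and the only trip arrives before all of them. Departures begin at time
  1, so \<open>t_max = Suc H\<close> leaves \<open>H\<close> units of time.\<close>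

definition sched_instance :: "nat list \<Rightarrow> nat \<Rightarrow> ilmtp" where
  "sched_instance js H = \<lparr>
     n_stations = 1,
     trips = [\<lparr>dep_times = [0], arr_time = 0\<rparr>],
     destinations = map (\<lambda>a. \<lparr>time_to = 0, time_stop = a, time_back = 0\<rparr>) js,
     t_max = Suc H,
     n_vehicles = 2,
     v_cap = 1,
     passengers = map (\<lambda>i. \<lparr>origin = 0, dest = i, req_time = 0\<rparr>) [0..<length js],
     T_w = Suc H,
     alpha_num = 0,
     alpha_den = 1\<rparr>"

lemma valid_sched_instance: "js \<noteq> [] \<Longrightarrow> valid_instance (sched_instance js H)"
  by (auto simp: valid_instance_def sched_instance_def)

lemma feasible_sched_instance:
  "has_feasible_solution (sched_instance js H) \<longleftrightarrow>
     (\<exists>st. (\<forall>j<length js. 1 \<le> st j \<and> st j + js ! j \<le> Suc H) \<and>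
       (\<forall>t\<in>{1..Suc H}. card (active (length js) st ((!) js) t) \<le> 2))"
    (is "?L \<longleftrightarrow> ?R")
proof
  let ?I = "sched_instance js H" and ?n = "length js"
  have I: "t_max ?I = Suc H" "n_vehicles ?I = 2" "v_cap ?I = 1" "T_w ?I = Suc H"
    "length (passengers ?I) = ?n"
    "\<And>j. j < ?n \<Longrightarrow> passengers ?I ! j = \<lparr>origin = 0, dest = j, req_time = 0\<rparr>"
    "\<And>j. j < ?n \<Longrightarrow> destinations ?I ! j = \<lparr>time_to = 0, time_stop = js ! j, time_back = 0\<rparr>"
    "trips ?I = [\<lparr>dep_times = [0], arr_time = 0\<rparr>]"
    by (simp_all add: sched_instance_def)
  {
    assume ?L
    then obtain G dst dep where *: "feasible_solution ?I G dst dep"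
      by (auto simp: has_feasible_solution_def)
    from * have part: "partition_on {..<?n} G"
      by (simp add: feasible_solution_def I)
    then have fin: "finite G" "\<And>g. g \<in> G \<Longrightarrow> finite g"
      using finite_elements[OF _ part] partition_onD1[OF part] 
      by (auto intro: finite_subset[of _ "{..<?n}"])
    have single: "{j} \<in> G \<and> dst {j} = j" if "j < ?n" for j
    proof -
      have "j \<in> \<Union>G" using partition_onD1[OF part] that by (metis lessThan_iff)
      then obtain g where g: "g \<in> G" "j \<in> g" by blast
      then have "card g \<le> 1" using * by (auto simp: feasible_solution_def I)
      then have "g = {j}" using g fin(2)[of g] by (auto simp: card_le_Suc0_iff_eq)
      moreover have "dest (passengers ?I ! j) = dst g" using * g by (auto simp: feasible_solution_def)
      ultimately show ?thesis using g that by (simp add: I)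
    qed
    define st where "st j = nat (dep {j})" for j
    have dep: "dep {j} = int (st j)" "1 \<le> st j" "st j + js ! j \<le> Suc H" if "j < ?n" for j
    proof -
      have "dep {j} \<in> {1..int (Suc H)}"
          "dep {j} + int (round_trip_time (destinations ?I ! dst {j})) \<le> int (Suc H)"
        using * single[OF that] unfolding feasible_solution_def I by blast+
      then show "dep {j} = int (st j)" "1 \<le> st j" "st j + js ! j \<le> Suc H"
        using single[OF that] that by (auto simp: st_def I round_trip_time_def)
    qed
    have "card (active ?n st ((!) js) t) \<le> 2" if "t \<in> {1..Suc H}" for t
    proof -
      let ?S = "{g \<in> G. dep g \<le> int t \<and> int t < dep g + int (round_trip_time (destinations ?I ! dst g))}"
      have "int t \<in> {1..int (Suc H)}" using that by auto
      then have "card ?S \<le> 2" using * unfolding feasible_solution_def I by blast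
      moreover have "card (active ?n st ((!) js) t) \<le> card ?S"
      proof (rule card_inj_on_le[of "\<lambda>j. {j}"])
        show "(\<lambda>j. {j}) ` active ?n st ((!) js) t \<subseteq> ?S"
          using single dep by (auto simp: active_def I round_trip_time_def)
        show "finite ?S" using fin by simp
      qed (simp add: inj_on_def)
      ultimately show ?thesis by simp
    qed
    with dep show ?R by blast
  next
    assume ?R
    then obtain st where st: "\<And>j. j < ?n \<Longrightarrow> 1 \<le> st j \<and> st j + js ! j \<le> Suc H"
      and card: "\<And>t. t \<in> {1..Suc H} \<Longrightarrow> card (active ?n st ((!) js) t) \<le> 2" by blast
    define G where "G = (\<lambda>j. {j}) ` {..<?n}"
    have "partition_on {..<?n} G"
      by (rule partition_onI) (auto simp: G_def disjnt_def)
    moreover have "card {g \<in> G. int (st (the_elem g)) \<le> t \<and>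
        t < int (st (the_elem g)) + int (round_trip_time (destinations ?I ! the_elem g))} \<le> 2"
      (is "card ?S \<le> 2") if "t \<in> {1..int (Suc H)}" for t
    proof -
      have "?S = (\<lambda>j. {j}) ` active ?n st ((!) js) (nat t)"
        using that by (auto simp: G_def active_def I round_trip_time_def)
      moreover have "nat t \<in> {1..Suc H}" using that by auto
      ultimately show ?thesis using card card_image_le[OF finite_active] le_trans by metis
    qed
    ultimately have "feasible_solution ?I G the_elem (\<lambda>g. int (st (the_elem g)))"
      unfolding feasible_solution_def I using st
      by (fastforce simp: G_def I round_trip_time_def simp flip: of_nat_add)
    then show ?L unfolding has_feasible_solution_def by blast
  }
qed

text \<open>
  The two additional jobs do not fit on the same vehicle. Next to the job of length \<open>2 * b\<close> there
  is room for numbers of total size \<open>sum_list as - b\<close>, which leaves \<open>b\<close> for the other vehicle.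
\<close>

theorem subset_sum_iff_feasible:
  fixes as :: "nat list"
  assumes "0 < b"
  shows "(\<exists>A\<subseteq>{..<length as}. (\<Sum>i\<in>A. as ! i) = b) \<longleftrightarrow>
    has_feasible_solution (sched_instance (as @ [sum_list as, 2 * b]) (sum_list as + b))"
    (is "?L \<longleftrightarrow> _")
proof -
  let ?n = "length as" and ?S = "sum_list as"
  let ?js = "as @ [?S, 2 * b]"
  let ?H = "?S + b"
  let ?len = "(!) ?js"
  have S: "(\<Sum>i<?n. as ! i) = ?S" by (simp add: sum_list_sum_nth atLeast0LessThan)
  have len: "?len i = as ! i" if "i < ?n" for i using that by (simp add: nth_append)
  have len2: "?len ?n = ?S" "?len (Suc ?n) = 2 * b" by (simp_all add: nth_append)
  have n: "length ?js = Suc (Suc ?n)" by simp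
  have sub: "(\<Sum>i\<in>A. ?len i) = (\<Sum>i\<in>A. as ! i)" if "A \<subseteq> {..<?n}" for A
    using that len by (intro sum.cong) auto
  have total: "(\<Sum>j<length ?js. ?len j) = 2 * ?H"
    unfolding n using sub[of "{..<?n}"] S len2 by simp
  have "?L \<longleftrightarrow> (\<exists>A\<subseteq>{..<length ?js}. (\<Sum>j\<in>A. ?len j) = ?H)" (is "_ \<longleftrightarrow> ?P")
  proof
    assume ?L
    then obtain A where A: "A \<subseteq> {..<?n}" "(\<Sum>i\<in>A. as ! i) = b" by blast
    then have "finite A" "?n \<notin> A" using finite_subset by auto
    then have "(\<Sum>j\<in>insert ?n A. ?len j) = ?H" using A sub len2 by simp
    moreover have "insert ?n A \<subseteq> {..<length ?js}" using A by auto
    ultimately show ?P by blast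
  next
    assume ?P
    then obtain A where A: "A \<subseteq> {..<length ?js}" "(\<Sum>j\<in>A. ?len j) = ?H" by blast
    define B where "B = A \<inter> {..<?n}"
    have B: "B \<subseteq> {..<?n}" "finite B" "?n \<notin> B" "Suc ?n \<notin> B" by (auto simp: B_def)
    have "A = B \<union> (A \<inter> {?n, Suc ?n})" using A(1) by (auto simp: B_def less_Suc_eq)
    then have "(\<Sum>j\<in>A. ?len j) = (\<Sum>j\<in>B \<union> (A \<inter> {?n, Suc ?n}). ?len j)"
      by (rule arg_cong)
    also have "\<dots> = (\<Sum>j\<in>B. ?len j) + (\<Sum>j\<in>A \<inter> {?n, Suc ?n}. ?len j)"
      using B by (intro sum.union_disjoint) auto
    finally have "(\<Sum>j\<in>A. ?len j) = (\<Sum>j\<in>B. ?len j) + (\<Sum>j\<in>A \<inter> {?n, Suc ?n}. ?len j)" .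
    then have H: "(\<Sum>i\<in>B. as ! i) + (\<Sum>j\<in>A \<inter> {?n, Suc ?n}. ?len j) = ?H" using A(2) sub[OF B(1)] by simp
    have le: "(\<Sum>i\<in>B. as ! i) \<le> ?S" unfolding S[symmetric] using B by (intro sum_mono2) auto
    have diff: "(\<Sum>i\<in>{..<?n} - B. as ! i) + (\<Sum>i\<in>B. as ! i) = ?S"
      unfolding S[symmetric] using B by (simp add: sum.subset_diff)
    \<comment> \<open>The set holds exactly one of the two additional jobs: both together exceed
      \<open>?H\<close>, and without them the numbers fall short of it, as \<open>b\<close> is
      positive.\<close>
    consider "?n \<in> A" "Suc ?n \<in> A" | "?n \<in> A" "Suc ?n \<notin> A" | "?n \<notin> A" "Suc ?n \<in> A"
      | "?n \<notin> A" "Suc ?n \<notin> A" by blast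
    then show ?L
    proof cases
      case 1
      then show ?thesis using H assms len2 by simp
    next
      case 2
      then have "(\<Sum>i\<in>B. as ! i) = b" using H len2 by simp
      then show ?thesis using B(1) by (intro exI[of _ B]) simp
    next
      case 3
      then have "(\<Sum>i\<in>{..<?n} - B. as ! i) = b" using H len2 diff by simp
      then show ?thesis by (intro exI[of _ "{..<?n} - B"]) auto
    next
      case 4
      then show ?thesis using H le assms by simp
    qed
  qed
  also have "\<dots> \<longleftrightarrow> has_feasible_solution (sched_instance ?js ?H)"
    unfolding feasible_sched_instance
  proof
    assume ?P
    then obtain A where A: "A \<subseteq> {..<length ?js}" "(\<Sum>j\<in>A. ?len j) = ?H" by blast
    show "\<exists>st. (\<forall>j<length ?js. 1 \<le> st j \<and> st j + ?len j \<le> Suc ?H) \<and>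
        (\<forall>t\<in>{1..Suc ?H}. card (active (length ?js) st ?len t) \<le> 2)"
    proof (rule partition_imp_schedule[OF A total])
      fix st
      assume "\<And>j. j < length ?js \<Longrightarrow> 1 \<le> st j \<and> st j + ?len j \<le> Suc ?H"
        "\<And>t. card (active (length ?js) st ?len t) \<le> 2"
      then show ?thesis by (intro exI[of _ st]) simp
    qed
  next
    assume "\<exists>st. (\<forall>j<length ?js. 1 \<le> st j \<and> st j + ?len j \<le> Suc ?H) \<and>
        (\<forall>t\<in>{1..Suc ?H}. card (active (length ?js) st ?len t) \<le> 2)"
    then obtain st where "\<forall>j<length ?js. 1 \<le> st j \<and> st j + ?len j \<le> Suc ?H"
        "\<forall>t\<in>{1..Suc ?H}. card (active (length ?js) st ?len t) \<le> 2" by (elim exE conjE)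
    then show ?P by (intro schedule_imp_partition[OF _ _ total, of st]) simp_all
  qed
  finally show ?thesis .
qed

section \<open>Decoding certificates\<close>

lemma pt_Node [pt_intros]:
  assumes "pt f" "pt g" shows "pt (\<lambda>x. Node (f x) (g x))"
  using pt_Pair[OF assms] by (rule pt_coerce) (simp add: rep_prod)

lemma pt_rep [pt_intros]: "pt f \<Longrightarrow> pt (\<lambda>x. rep (f x))"
  by (erule pt_coerce) simp

text \<open>A tree and the list of the left subtrees along its right branch have the same code. Case
  distinctions on trees are thus obtained from those on lists.\<close>

fun spine :: "tree \<Rightarrow> tree list" where
  "spine Leaf = []"
| "spine (Node l r) = l # spine r"

lemma pt_spine [pt_intros]: "pt f \<Longrightarrow> pt (\<lambda>x. spine (f x))"
proof (erule pt_coerce)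
  have "rep (spine t) = t" for t by (induction t) auto
  then show "rep (spine (f x)) = rep (f x)" for x by simp
qed

lemma spine_rep: "spine (rep l) = map rep l"
  by (induction l) auto

definition left :: "tree \<Rightarrow> tree" where
  "left t = (case spine t of [] \<Rightarrow> Leaf | l # _ \<Rightarrow> l)"

definition right :: "tree \<Rightarrow> tree" where
  "right t = (case spine t of [] \<Rightarrow> Leaf | _ # r \<Rightarrow> rep r)"

lemma left_Node [simp]: "left (Node l r) = l"
  by (simp add: left_def)

lemma right_Node [simp]: "right (Node l r) = r"
proof -
  have "rep (spine t) = t" for t by (induction t) auto
  then show ?thesis by (simp add: right_def)
qed

lemma pt_left [pt_intros]: "pt f \<Longrightarrow> pt (\<lambda>x. left (f x))"
  unfolding left_def by (intro pt_intros)

lemma pt_right [pt_intros]: "pt f \<Longrightarrow> pt (\<lambda>x. right (f x))"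
  unfolding right_def by (intro pt_intros)

text \<open>On trees that represent no element the result is arbitrary.\<close>

class cast = code +
  fixes cast :: "tree \<Rightarrow> 'a"
  assumes cast_rep [simp]: "cast (rep a) = a"
    and ptime_cast: "ptime UNIV flat (\<lambda>t. flat (rep (cast t)))"

lemma pt_cast_iff: "pt f \<longleftrightarrow> ptime UNIV flat (\<lambda>t. flat (rep (f t)))"
  by (simp add: pt_def code_def[abs_def])

lemma pt_cast [pt_intros]: "pt f \<Longrightarrow> pt (\<lambda>x. cast (f x))"
  using pt_comp[of cast] ptime_cast by (simp add: pt_cast_iff)

instantiation unit :: cast
begin
definition cast_unit :: "tree \<Rightarrow> unit" where "cast_unit _ = ()"
instance
proof
  show "ptime UNIV flat (\<lambda>t. flat (rep (cast t :: unit)))"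
    unfolding pt_cast_iff[symmetric] cast_unit_def by (intro pt_intros)
qed simp
end

instantiation bool :: cast
begin
definition cast_bool :: "tree \<Rightarrow> bool" where "cast_bool t \<longleftrightarrow> t \<noteq> Leaf"
instance
proof
  show "ptime UNIV flat (\<lambda>t. flat (rep (cast t :: bool)))"
    unfolding pt_cast_iff[symmetric] cast_bool_def by (intro pt_intros)
qed (simp add: cast_bool_def rep_bool_def bool_tree_def)
end

instantiation prod :: (cast, cast) cast
begin
definition cast_prod :: "tree \<Rightarrow> 'a \<times> 'b" where "cast_prod t = (cast (left t), cast (right t))"
instance
proof
  show "ptime UNIV flat (\<lambda>t. flat (rep (cast t :: 'a \<times> 'b)))"
    unfolding pt_cast_iff[symmetric] cast_prod_def by (intro pt_intros)
qed (simp add: cast_prod_def rep_prod)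
end

instantiation list :: (cast) cast
begin
definition cast_list :: "tree \<Rightarrow> 'a list" where "cast_list t = map cast (spine t)"
instance
proof
  show "ptime UNIV flat (\<lambda>t. flat (rep (cast t :: 'a list)))"
    unfolding pt_cast_iff[symmetric] cast_list_def by (intro pt_intros)
qed (simp add: cast_list_def spine_rep comp_def)
end

instantiation nat :: cast
begin
definition cast_nat :: "tree \<Rightarrow> nat" where "cast_nat t = bits_nat (cast t)"
instance
proof
  show "ptime UNIV flat (\<lambda>t. flat (rep (cast t :: nat)))"
    unfolding pt_cast_iff[symmetric] cast_nat_def by (intro pt_intros)
qed (simp add: cast_nat_def rep_nat_def)
end

definition int_of :: "bool \<times> nat \<Rightarrow> int" where
  "int_of p = (if fst p then - int (snd p) else int (snd p))"

lemma pt_int_of [pt_intros]: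
  assumes "pt f" shows "pt (\<lambda>x. int_of (f x))"
proof (rule pt_coerce)
  \<comment> \<open>A negative zero has to lose its sign, since \<open>rep\<close> is unique for
    every integer.\<close>
  show "pt (\<lambda>x. (fst (f x) \<and> snd (f x) \<noteq> 0, snd (f x)))" by (intro pt_intros assms)
  show "rep (int_of (f x)) = rep (fst (f x) \<and> snd (f x) \<noteq> 0, snd (f x))" for x
    by (auto simp: rep_int_def int_of_def)
qed

instantiation int :: cast
begin
definition cast_int :: "tree \<Rightarrow> int" where "cast_int t = int_of (cast t)"
instance
proof
  show "ptime UNIV flat (\<lambda>t. flat (rep (cast t :: int)))"
    unfolding pt_cast_iff[symmetric] cast_int_def by (intro pt_intros)
qed (simp add: cast_int_def rep_int_def int_of_def)
end

text \<open>Read from the right, the prefix notation \<open>flat\<close> is evaluated like a postfix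
  expression on a stack of trees. Malformed words end in some arbitrary tree.\<close>

definition parse_step :: "bool \<Rightarrow> tree list \<Rightarrow> tree list" where
  "parse_step b st = (if b then case st of [] \<Rightarrow> [] | l # st' \<Rightarrow>
     (case st' of [] \<Rightarrow> [] | r # st'' \<Rightarrow> Node l r # st'') else Leaf # st)"

definition parse :: "bool list \<Rightarrow> tree" where
  "parse w = (case foldl (\<lambda>st b. parse_step b st) [] (rev w) of [] \<Rightarrow> Leaf | t # _ \<Rightarrow> t)"

lemma parse_flat: "parse (flat t) = t"
proof -
  have "foldr parse_step (flat t) st = t # st" for st
    by (induction t arbitrary: st) (simp_all add: parse_step_def)
  then show ?thesis by (simp add: parse_def foldl_conv_foldr)
qed

lemma pt_parse [pt_intros]:
  assumes "pt f" shows "pt (\<lambda>x. parse (f x))"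
proof -
  have "pt (\<lambda>x. foldl (\<lambda>st b. parse_step b st) [] (rev (f x)))"
  proof (rule pt_foldl[where d = "[:2:]"])
    show "sz (parse_step a acc) \<le> sz acc + poly [:2:] (sz x + sz a)" for x :: 'a and a acc
      by (auto simp: parse_step_def sz_Cons sz_Nil code_def split: list.splits)
  qed (simp_all only: parse_step_def, (intro pt_intros assms)+)
  then show ?thesis unfolding parse_def by (intro pt_intros)
qed

type_synonym split_state = "bool \<times> bool \<times> bool list \<times> bool list"

text \<open>The first flag is set after the end marker of the first word, the second when the next
  bit is a letter of that word. Both words are collected in reverse.\<close>

definition split_step :: "split_state \<Rightarrow> bool \<Rightarrow> split_state" where
  "split_step = (\<lambda>st b.
     if fst st then (True, False, fst (snd (snd st)), b # snd (snd (snd st)))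
     else if fst (snd st) then (False, False, b # fst (snd (snd st)), snd (snd (snd st)))
     else (\<not> b, b, snd (snd st)))"

definition split_pair :: "bool list \<Rightarrow> bool list \<times> bool list" where
  "split_pair w = (let st = foldl split_step (False, False, [], []) w
     in (rev (fst (snd (snd st))), rev (snd (snd (snd st)))))"

lemma split_pair_enc_pair: "split_pair (enc_pair x u) = (x, u)"
proof -
  have "foldl split_step (True, False, xs, us) u = (True, False, xs, rev u @ us)" for xs us
    by (induction u arbitrary: us) (auto simp: split_step_def)
  then have "foldl split_step (False, False, xs, us) (enc_pair x u) = (True, False, rev x @ xs, rev u @ us)"
    for xs us
  proof (induction x arbitrary: xs)
    case Nil
    then show ?case by (simp add: enc_pair_def enc_list_def split_step_def)
  next
    case (Cons b x)
    have "enc_pair (b # x) u = True # b # enc_pair x u" by (simp add: enc_pair_def enc_list_def)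
    moreover have "split_step (split_step (False, False, xs, us) True) b = (False, False, b # xs, us)"
      by (simp add: split_step_def)
    ultimately show ?case using Cons by simp
  qed
  then show ?thesis by (simp add: split_pair_def)
qed

lemma pt_split_pair [pt_intros]:
  assumes "pt f" shows "pt (\<lambda>x. split_pair (f x))"
proof -
  have "pt (\<lambda>x. foldl split_step (False, False, [], []) (f x))"
  proof (rule pt_foldl[where d = "[:10:]"])
    show "sz (split_step acc a) \<le> sz acc + poly [:10:] (sz x + sz a)" for x :: 'a and a acc
      by (cases acc) (auto simp: split_step_def sz_Pair sz_Cons code_bool)
  qed (simp_all only: split_step_def, (intro pt_intros assms)+)
  then show ?thesis unfolding split_pair_def Let_def by (intro pt_intros)
qed

subsection \<open>Indexed access\<close>

lemma pt_zip [pt_intros]: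
  assumes "pt f" "pt g" shows "pt (\<lambda>x. zip (f x) (g x))"
proof -
  define step :: "'c list \<times> ('b \<times> 'c) list \<Rightarrow> 'b \<Rightarrow> 'c list \<times> ('b \<times> 'c) list" where
    "step = (\<lambda>st a. case fst st of [] \<Rightarrow> st | b # bs \<Rightarrow> (bs, (a, b) # snd st))"
  have run: "rev (snd (foldl step (bs, acc) as)) = rev acc @ zip as bs" for as bs acc
  proof (induction as arbitrary: bs acc)
    case (Cons a as)
    then show ?case by (cases bs) (auto simp: step_def)
  qed simp
  have "pt (\<lambda>x. foldl step (g x, []) (f x))"
    unfolding step_def
  proof (rule pt_foldl[where d = "[:1, 1:]"])
    show "sz (case fst acc of [] \<Rightarrow> acc | b # bs \<Rightarrow> (bs, (a, b) # snd acc))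
        \<le> sz acc + poly [:1, 1:] (sz x + sz a)" for x :: 'a and a and acc :: "'c list \<times> ('b \<times> 'c) list"
      by (cases acc) (auto simp: sz_Pair sz_Cons sz_Nil split: list.splits)
  qed (intro pt_intros assms)+
  then have "pt (\<lambda>x. rev (snd (foldl step (g x, []) (f x))))"
    by (intro pt_intros)
  then show ?thesis by (simp add: run)
qed

text \<open>The value of \<open>!\<close> beyond the end of a list is unspecified, so computations
  use \<open>nth_default\<close>. The entry is found by searching the numbered list.\<close>

lemma pt_nth_default [pt_intros]:
  assumes "pt d" "pt l" "pt n" shows "pt (\<lambda>x. nth_default (d x) (l x) (n x))"
proof -
  have "nth_default c as k = (case filter (\<lambda>e. fst e = k) (zip [0..<length as] as) of [] \<Rightarrow> c | e # _ \<Rightarrow> snd e)"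
    for c :: 'b and as k
  proof -
    have *: "set (filter (\<lambda>e. fst e = k) (zip [0..<length as] as)) = {e. fst e = k \<and> k < length as \<and> snd e = as ! k}"
      by (auto simp: set_zip intro: exI[of _ k])
    show ?thesis
    proof (cases "filter (\<lambda>e. fst e = k) (zip [0..<length as] as)")
      case Nil
      then have "{e :: nat \<times> 'b. fst e = k \<and> k < length as \<and> snd e = as ! k} = {}" using * by simp
      then have "\<not> k < length as" by auto
      with Nil show ?thesis by (simp add: nth_default_def)
    next
      case (Cons e es)
      then have "e \<in> {e. fst e = k \<and> k < length as \<and> snd e = as ! k}" unfolding *[symmetric] by simp
      with Cons show ?thesis by (simp add: nth_default_def)
    qed
  qed
  moreover have "pt (\<lambda>x. case filter (\<lambda>e. fst e = n x) (zip [0..<length (l x)] (l x)) of [] \<Rightarrow> d x | e # _ \<Rightarrow> snd e)"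
    by (rule pt_case_list) (intro pt_intros assms pt_comp[OF assms(3)])+
  ultimately show ?thesis by simp
qed

text \<open>Integers are compared in the naturals: each is written as the difference of its two
  parts, and subtracted parts move to the other side of the comparison.\<close>

definition pos_part :: "int \<Rightarrow> nat" where "pos_part i = nat i"
definition neg_part :: "int \<Rightarrow> nat" where "neg_part i = nat (- i)"

lemma int_parts: "int (pos_part i) - int (neg_part i) = i"
  by (simp add: pos_part_def neg_part_def)

lemma pt_sign_abs:
  assumes "pt f" shows "pt (\<lambda>x. (f x < 0, nat \<bar>f x\<bar>))"
  using assms by (rule pt_coerce) (simp add: rep_int_def)

lemma pt_neg_int [pt_intros]: "pt f \<Longrightarrow> pt (\<lambda>x. f x < (0 :: int))"
  using pt_fst[OF pt_sign_abs] by simp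

lemma pt_abs_int [pt_intros]: "pt f \<Longrightarrow> pt (\<lambda>x. nat \<bar>f x\<bar>)"
  using pt_snd[OF pt_sign_abs] by simp

lemma pt_pos_part [pt_intros]:
  assumes "pt f" shows "pt (\<lambda>x. pos_part (f x))"
proof -
  have "pos_part i = (if i < 0 then 0 else nat \<bar>i\<bar>)" for i by (simp add: pos_part_def)
  then show ?thesis using assms by (simp only:) (intro pt_intros)
qed

lemma pt_neg_part [pt_intros]:
  assumes "pt f" shows "pt (\<lambda>x. neg_part (f x))"
proof -
  have "neg_part i = (if i < 0 then nat \<bar>i\<bar> else 0)" for i by (simp add: neg_part_def)
  then show ?thesis using assms by (simp only:) (intro pt_intros)
qed

subsection \<open>Encodings as polynomial-time functions\<close>

lemma pt_enc_list [pt_intros]: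
  assumes "pt (\<lambda>z. e (fst z) (snd z))" "pt l"
  shows "pt (\<lambda>x. enc_list (e x) (l x))"
  unfolding enc_list_def by (intro pt_intros assms)

lemma pt_enc_nat [pt_intros]: "pt f \<Longrightarrow> pt (\<lambda>x. enc_nat (f x))"
  unfolding enc_nat_def by (intro pt_intros)

lemma pt_enc_int [pt_intros]: "pt f \<Longrightarrow> pt (\<lambda>x. enc_int (f x))"
  unfolding enc_int_def by (intro pt_intros)

lemma enc_card_length: "enc_card (length l) = enc_list (\<lambda>_. []) l"
  by (induction l) (auto simp: enc_card_def enc_list_def replicate_append_same[symmetric] map_replicate_const)

lemma pt_enc_card [pt_intros]: "pt l \<Longrightarrow> pt (\<lambda>x. enc_card (length (l x)))"
  unfolding enc_card_length by (intro pt_intros)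

section \<open>Membership in NP\<close>

text \<open>
  Groups are described by a representative \<open>\<rho> j\<close> of the group of each passenger. The number of
  vehicles in use can only increase at departure times, so it suffices to count there.
\<close>

definition assignment_ok :: "ilmtp \<Rightarrow> (nat \<Rightarrow> nat) \<Rightarrow> (nat \<Rightarrow> nat) \<Rightarrow> bool" where
  "assignment_ok I \<rho> t \<longleftrightarrow> (\<forall>j<length (passengers I).
     \<rho> j < length (passengers I) \<and> \<rho> (\<rho> j) = \<rho> j \<and>
     dest (passengers I ! \<rho> j) = dest (passengers I ! j) \<and> t (\<rho> j) = t j \<and> 1 \<le> t j \<and>
     t j + round_trip_time (destinations I ! dest (passengers I ! j)) \<le> t_max I \<and>
     (\<exists>c\<in>set (trips I). arr_time c \<le> int (t j)) \<and>
     req_time (passengers I ! j) - int (T_w I)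
       \<le> int (t j) + int (time_to (destinations I ! dest (passengers I ! j))) \<and>
     int (t j) + int (time_to (destinations I ! dest (passengers I ! j)))
       \<le> req_time (passengers I ! j) + int (T_w I) \<and>
     card {i. i < length (passengers I) \<and> \<rho> i = \<rho> j} \<le> v_cap I \<and>
     card {i. i < length (passengers I) \<and> \<rho> i = i \<and> t i \<le> t j \<and>
       t j < t i + round_trip_time (destinations I ! dest (passengers I ! i))} \<le> n_vehicles I)"

lemma feasible_imp_assignment:
  assumes "feasible_solution I G dst dep"
  shows "\<exists>\<rho> t. assignment_ok I \<rho> t"
proof -
  let ?n = "length (passengers I)" and ?P = "\<lambda>j. passengers I ! j"
  have part: "partition_on {..<?n} G"
    and dep_range: "\<And>g. g \<in> G \<Longrightarrow> dep g \<in> {1..int (t_max I)}"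
    and grp: "\<And>g. g \<in> G \<Longrightarrow> (\<forall>j\<in>g. dest (?P j) = dst g) \<and> card g \<le> v_cap I"
    and win: "\<And>g j. g \<in> G \<Longrightarrow> j \<in> g \<Longrightarrow> req_time (?P j) - int (T_w I)
          \<le> dep g + int (time_to (destinations I ! dst g)) \<and>
        dep g + int (time_to (destinations I ! dst g)) \<le> req_time (?P j) + int (T_w I)"
    and trip: "\<And>g. g \<in> G \<Longrightarrow> \<exists>c\<in>set (trips I). arr_time c \<le> dep g"
    and ret: "\<And>g. g \<in> G \<Longrightarrow> dep g + int (round_trip_time (destinations I ! dst g)) \<le> int (t_max I)"
    and veh: "\<And>t. t \<in> {1..int (t_max I)} \<Longrightarrow> card {g \<in> G. dep g \<le> t \<and>
        t < dep g + int (round_trip_time (destinations I ! dst g))} \<le> n_vehicles I"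
    using assms unfolding feasible_solution_def by blast+
  have sub: "g \<subseteq> {..<?n}" if "g \<in> G" for g using part that by (auto simp: partition_on_def)
  have fin: "finite G" "\<And>g. g \<in> G \<Longrightarrow> finite g"
    using finite_elements[OF _ part] sub finite_subset by auto
  define blk where "blk j = (THE g. g \<in> G \<and> j \<in> g)" for j
  have blk: "blk j = g" if "g \<in> G" "j \<in> g" for g j
    unfolding blk_def using that part
    by (intro the_equality) (auto simp: partition_on_def disjoint_def)
  have blk_mem: "blk j \<in> G" "j \<in> blk j" if "j < ?n" for j
  proof -
    have "j \<in> \<Union>G" using part that by (auto simp: partition_on_def)
    then show "blk j \<in> G" "j \<in> blk j" using blk by blast+
  qed
  \<comment> \<open>The minimum serves as representative because it depends on the block
    alone.\<close>
  define \<rho> where "\<rho> j = Min (blk j)" for j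
  define t where "t j = nat (dep (blk j))" for j
  have \<rho>: "\<rho> j \<in> blk j" "\<rho> j < ?n" "blk (\<rho> j) = blk j" if "j < ?n" for j
  proof -
    show "\<rho> j \<in> blk j" unfolding \<rho>_def using blk_mem[OF that] fin(2) by (intro Min_in) auto
    then show "\<rho> j < ?n" "blk (\<rho> j) = blk j" using blk_mem[OF that] sub blk by blast+
  qed
  have t: "int (t j) = dep (blk j)" if "j < ?n" for j
    using dep_range[OF blk_mem(1)[OF that]] by (simp add: t_def)
  have dst: "dest (?P j) = dst (blk j)" if "j < ?n" for j
    using grp blk_mem[OF that] by blast
  have blk_eq: "{i. i < ?n \<and> \<rho> i = \<rho> j} = blk j" if "j < ?n" for j
  proof (intro equalityI subsetI)
    fix i assume "i \<in> {i. i < ?n \<and> \<rho> i = \<rho> j}"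
    then have "i < ?n" "blk i = blk j" using \<rho>(3)[of i] \<rho>(3)[OF that] by auto
    then show "i \<in> blk j" using blk_mem(2)[of i] by simp
  next
    fix i assume i: "i \<in> blk j"
    then have "blk i = blk j" using blk blk_mem(1)[OF that] by blast
    then have "\<rho> i = \<rho> j" unfolding \<rho>_def by (rule arg_cong)
    moreover have "i < ?n" using i sub[OF blk_mem(1)[OF that]] by blast
    ultimately show "i \<in> {i. i < ?n \<and> \<rho> i = \<rho> j}" by blast
  qed
  have veh': "card {i. i < ?n \<and> \<rho> i = i \<and> t i \<le> t j \<and>
      t j < t i + round_trip_time (destinations I ! dest (?P i))} \<le> n_vehicles I" (is "card ?S \<le> _")
    if j: "j < ?n" for j
  proof -
    let ?T = "{g \<in> G. dep g \<le> int (t j) \<and>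
        int (t j) < dep g + int (round_trip_time (destinations I ! dst g))}"
    have "card ?S \<le> card ?T"
    proof (rule card_inj_on_le[of blk])
      show "inj_on blk ?S"
      proof (rule inj_onI)
        fix i k assume "i \<in> ?S" "k \<in> ?S" "blk i = blk k"
        moreover from this(3) have "\<rho> i = \<rho> k" unfolding \<rho>_def by (rule arg_cong)
        ultimately show "i = k" by simp
      qed
      show "blk ` ?S \<subseteq> ?T"
      proof (intro image_subsetI)
        fix i assume "i \<in> ?S"
        then have i: "i < ?n" "t i \<le> t j" "t j < t i + round_trip_time (destinations I ! dst (blk i))"
          using dst by auto
        then have "int (t i) \<le> int (t j)"
            "int (t j) < int (t i) + int (round_trip_time (destinations I ! dst (blk i)))"
          by linarith+
        then show "blk i \<in> ?T" using t[OF i(1)] blk_mem[OF i(1)] by simp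
      qed
    qed (use fin in simp)
    also have "\<dots> \<le> n_vehicles I" using veh dep_range[OF blk_mem(1)[OF j]] t[OF j] by simp
    finally show ?thesis .
  qed
  have "assignment_ok I \<rho> t"
    unfolding assignment_ok_def
  proof (intro allI impI)
    fix j assume j: "j < ?n"
    have "\<rho> (\<rho> j) = \<rho> j" "t (\<rho> j) = t j" "dest (?P (\<rho> j)) = dest (?P j)"
      using \<rho>[OF j] dst[of j] dst[of "\<rho> j"] j by (simp_all add: \<rho>_def t_def)
    moreover have "1 \<le> t j" using dep_range[OF blk_mem(1)[OF j]] t[OF j] by simp
    moreover have "t j + round_trip_time (destinations I ! dest (?P j)) \<le> t_max I"
      using ret[OF blk_mem(1)[OF j]] t[OF j] dst[OF j] by simp
    moreover have "\<exists>c\<in>set (trips I). arr_time c \<le> int (t j)"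
      using trip[OF blk_mem(1)[OF j]] t[OF j] by simp
    moreover have "card {i. i < ?n \<and> \<rho> i = \<rho> j} \<le> v_cap I"
      using grp[OF blk_mem(1)[OF j]] blk_eq[OF j] by simp
    ultimately show "\<rho> j < ?n \<and> \<rho> (\<rho> j) = \<rho> j \<and> dest (?P (\<rho> j)) = dest (?P j) \<and> t (\<rho> j) = t j \<and>
      1 \<le> t j \<and> t j + round_trip_time (destinations I ! dest (?P j)) \<le> t_max I \<and>
      (\<exists>c\<in>set (trips I). arr_time c \<le> int (t j)) \<and>
      req_time (?P j) - int (T_w I) \<le> int (t j) + int (time_to (destinations I ! dest (?P j))) \<and>
      int (t j) + int (time_to (destinations I ! dest (?P j))) \<le> req_time (?P j) + int (T_w I) \<and>
      card {i. i < ?n \<and> \<rho> i = \<rho> j} \<le> v_cap I \<and>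
      card {i. i < ?n \<and> \<rho> i = i \<and> t i \<le> t j \<and>
        t j < t i + round_trip_time (destinations I ! dest (?P i))} \<le> n_vehicles I"
      using \<rho>(2)[OF j] win[OF blk_mem[OF j]] t[OF j] dst[OF j] veh'[OF j] by simp
  qed
  then show ?thesis by blast
qed

lemma assignment_imp_feasible:
  assumes "assignment_ok I \<rho> t"
  shows "has_feasible_solution I"
proof -
  let ?n = "length (passengers I)" and ?P = "\<lambda>j. passengers I ! j"
  define R where "R = {r. r < ?n \<and> \<rho> r = r}"
  define cls where "cls r = {i. i < ?n \<and> \<rho> i = r}" for r
  define G where "G = cls ` R"
  define rp where "rp = inv_into R cls"
  note ok = assms[unfolded assignment_ok_def, rule_format]
  have rR: "\<rho> j \<in> R" if "j < ?n" for j using ok[OF that] by (simp add: R_def)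
  have cls: "r \<in> cls r" if "r \<in> R" for r using that by (simp add: cls_def R_def)
  have inj: "inj_on cls R"
    by (rule inj_onI) (metis (mono_tags, lifting) cls cls_def mem_Collect_eq)
  have rp: "rp (cls r) = r" if "r \<in> R" for r unfolding rp_def using inj that by simp
  have fin: "finite R" by (simp add: R_def)
  have "partition_on {..<?n} G"
  proof (rule partition_onI)
    show "\<Union>G = {..<?n}" using rR by (auto simp: G_def cls_def)
    show "disjnt p q" if "p \<in> G" "q \<in> G" "p \<noteq> q" for p q
      using that by (auto simp: G_def cls_def disjnt_def)
    show "{} \<notin> G" using cls by (auto simp: G_def)
  qed
  moreover have mem: "j < ?n \<and> \<rho> j = r" if "j \<in> cls r" for j r using that by (simp add: cls_def)
  have eqs: "t r = t j" "dest (?P r) = dest (?P j)" if "j \<in> cls r" for j r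
    using ok[of j] mem[OF that] by auto
  have veh: "card {g \<in> G. int (t (rp g)) \<le> \<theta> \<and>
      \<theta> < int (t (rp g)) + int (round_trip_time (destinations I ! dest (?P (rp g))))} \<le> n_vehicles I"
    (is "card ?S \<le> _") for \<theta>
  proof -
    define A where "A = {r \<in> R. int (t r) \<le> \<theta> \<and>
      \<theta> < int (t r) + int (round_trip_time (destinations I ! dest (?P r)))}"
    have "?S = cls ` A" using rp by (auto simp: G_def A_def)
    then have "card ?S \<le> card A" using fin by (simp add: A_def card_image_le)
    also have "card A \<le> n_vehicles I"
    proof (cases "A = {}")
      case False
      have finA: "finite (t ` A)" using fin by (simp add: A_def)
      \<comment> \<open>All trips under way at time \<open>\<theta>\<close> are also under way at
        the latest of their departures, where the assignment bounds their number.\<close>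
      have "Max (t ` A) \<in> t ` A" using False finA by (intro Max_in) auto
      then obtain j where j: "j \<in> A" "Max (t ` A) = t j" by auto
      have le: "t r \<le> t j" if "r \<in> A" for r using that finA j(2) Max_ge[of "t ` A" "t r"] by simp
      have "A \<subseteq> {i. i < ?n \<and> \<rho> i = i \<and> t i \<le> t j \<and>
          t j < t i + round_trip_time (destinations I ! dest (?P i))}"
      proof
        fix r assume r: "r \<in> A"
        then have "int (t j) < int (t r) + int (round_trip_time (destinations I ! dest (?P r)))"
          using j(1) by (auto simp: A_def)
        then show "r \<in> {i. i < ?n \<and> \<rho> i = i \<and> t i \<le> t j \<and>
            t j < t i + round_trip_time (destinations I ! dest (?P i))}"
          using r le[OF r] by (simp add: A_def R_def)
      qed
      then have "card A \<le> card {i. i < ?n \<and> \<rho> i = i \<and> t i \<le> t j \<and>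
          t j < t i + round_trip_time (destinations I ! dest (?P i))}"
        by (intro card_mono) auto
      also have "\<dots> \<le> n_vehicles I" using ok[of j] j(1) by (simp add: A_def R_def)
      finally show ?thesis .
    qed simp
    finally show ?thesis .
  qed
  have "feasible_solution I G (\<lambda>g. dest (?P (rp g))) (\<lambda>g. int (t (rp g)))"
    unfolding feasible_solution_def
  proof (intro conjI ballI)
    show "partition_on {..<?n} G" by fact
    fix g assume "g \<in> G"
    then obtain r where r: "r \<in> R" "g = cls r" "rp g = r" using rp by (auto simp: G_def)
    then have rn: "r < ?n" "\<rho> r = r" by (auto simp: R_def)
    note okr = ok[OF rn(1)]
    show "int (t (rp g)) \<in> {1..int (t_max I)}" using okr r by simp
    show "card g \<le> v_cap I" using okr r rn by (simp add: cls_def)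
    show "\<exists>c\<in>set (trips I). arr_time c \<le> int (t (rp g))" using okr r by simp
    show "int (t (rp g)) + int (round_trip_time (destinations I ! dest (?P (rp g)))) \<le> int (t_max I)"
      using okr r by simp
    fix j assume j: "j \<in> g"
    show "dest (?P j) = dest (?P (rp g))" using eqs j r by metis
    have "t j = t r" "dest (?P j) = dest (?P r)" using eqs j r by metis+
    moreover have "j < ?n" using mem j r by blast
    ultimately show "req_time (?P j) - int (T_w I)
          \<le> int (t (rp g)) + int (time_to (destinations I ! dest (?P (rp g))))"
        "int (t (rp g)) + int (time_to (destinations I ! dest (?P (rp g))))
          \<le> req_time (?P j) + int (T_w I)"
      using ok[of j] r by auto
  qed (use veh in simp)
  then show ?thesis unfolding has_feasible_solution_def by blast
qed

theorem feasible_iff_assignment: "has_feasible_solution I \<longleftrightarrow> (\<exists>\<rho> t. assignment_ok I \<rho> t)"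
  using feasible_imp_assignment assignment_imp_feasible unfolding has_feasible_solution_def by blast

subsection \<open>The verifier\<close>

text \<open>The data of an instance in types of class \<open>cast\<close>, so that an instance can
  be a part of a certificate. Lists of units replace the cardinalities that are encoded in
  unary.\<close>

type_synonym raw_trip = "int list \<times> int"
type_synonym raw_dest = "nat \<times> nat \<times> nat"
type_synonym raw_pass = "nat \<times> nat \<times> int"
type_synonym raw = "unit list \<times> raw_trip list \<times> raw_dest list \<times> nat \<times> unit list \<times> nat \<times>
  raw_pass list \<times> nat \<times> nat \<times> nat"

lemma raw_cases:
  obtains ns trs dts tm vs vc ps tw an ad where "(r :: raw) = (ns, trs, dts, tm, vs, vc, ps, tw, an, ad)"
proof -
  obtain ns trs dts tm vs vc z where r: "r = (ns, trs, dts, tm, vs, vc, z)" by (cases r)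
  obtain ps tw an ad where "z = (ps, tw, an, ad)" by (cases z)
  with r that show thesis by simp
qed

definition of_raw_trip :: "raw_trip \<Rightarrow> trip" where
  "of_raw_trip c = \<lparr>dep_times = fst c, arr_time = snd c\<rparr>"

definition of_raw_dest :: "raw_dest \<Rightarrow> destination" where
  "of_raw_dest d = \<lparr>time_to = fst d, time_stop = fst (snd d), time_back = snd (snd d)\<rparr>"

definition of_raw_pass :: "raw_pass \<Rightarrow> passenger" where
  "of_raw_pass j = \<lparr>origin = fst j, dest = fst (snd j), req_time = snd (snd j)\<rparr>"

definition of_raw :: "raw \<Rightarrow> ilmtp" where
  "of_raw = (\<lambda>(ns, trs, dts, tm, vs, vc, ps, tw, an, ad).
     \<lparr>n_stations = length ns, trips = map of_raw_trip trs, destinations = map of_raw_dest dts,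
      t_max = tm, n_vehicles = length vs, v_cap = vc, passengers = map of_raw_pass ps,
      T_w = tw, alpha_num = an, alpha_den = ad\<rparr>)"

lemma surj_of_raw: "\<exists>r. of_raw r = I"
proof -
  have "of_raw_trip (dep_times c, arr_time c) = c" for c by (simp add: of_raw_trip_def)
  moreover have "of_raw_dest (time_to d, time_stop d, time_back d) = d" for d
    by (simp add: of_raw_dest_def)
  moreover have "of_raw_pass (origin j, dest j, req_time j) = j" for j
    by (simp add: of_raw_pass_def)
  ultimately show ?thesis
    by (intro exI[of _ "(replicate (n_stations I) (), map (\<lambda>c. (dep_times c, arr_time c)) (trips I),
      map (\<lambda>d. (time_to d, time_stop d, time_back d)) (destinations I), t_max I,
      replicate (n_vehicles I) (), v_cap I,
      map (\<lambda>j. (origin j, dest j, req_time j)) (passengers I), T_w I, alpha_num I, alpha_den I)"])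
      (simp add: of_raw_def comp_def)
qed

definition enc_raw :: "raw \<Rightarrow> bool list" where
  "enc_raw = (\<lambda>(ns, trs, dts, tm, vs, vc, ps, tw, an, ad).
     enc_card (length ns) @
     enc_list (\<lambda>c. enc_list enc_int (fst c) @ enc_int (snd c)) trs @
     enc_list (\<lambda>d. enc_nat (fst d) @ enc_nat (fst (snd d)) @ enc_nat (snd (snd d))) dts @
     enc_nat tm @ enc_card (length vs) @ enc_nat vc @
     enc_list (\<lambda>j. enc_nat (fst j) @ enc_nat (fst (snd j)) @ enc_int (snd (snd j))) ps @
     enc_nat tw @ enc_nat an @ enc_nat ad)"

lemma enc_list_map: "enc_list e (map f l) = enc_list (\<lambda>x. e (f x)) l"
  by (simp add: enc_list_def comp_def)

lemma enc_raw: "enc_raw r = enc_ilmtp (of_raw r)"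
  by (rule raw_cases[of r]) (simp add: enc_raw_def of_raw_def enc_ilmtp_def enc_list_map enc_trip_def
    of_raw_trip_def enc_destination_def of_raw_dest_def enc_passenger_def of_raw_pass_def)

lemma pt_enc_raw [pt_intros]:
  assumes "pt f" shows "pt (\<lambda>x. enc_raw (f x))"
  unfolding enc_raw_def split_beta by (intro pt_intros assms pt_comp[OF assms])

definition raw_valid :: "raw \<Rightarrow> bool" where
  "raw_valid = (\<lambda>(ns, trs, dts, tm, vs, vc, ps, tw, an, ad).
     (\<forall>c\<in>set trs. length (fst c) = length ns) \<and>
     (\<forall>c\<in>set trs. \<forall>c'\<in>set trs. \<forall>d\<in>set (zip (fst c) (fst c')).
       pos_part (snd c) + pos_part (snd d) + neg_part (snd c') + neg_part (fst d)
         = pos_part (snd c') + pos_part (fst d) + neg_part (snd c) + neg_part (snd d)) \<and>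
     dts \<noteq> [] \<and> 1 \<le> tm \<and> 1 \<le> vc \<and>
     (\<forall>j\<in>set ps. fst j < length ns \<and> fst (snd j) < length dts) \<and>
     0 < ad \<and> an \<le> ad)"

lemma raw_valid: "raw_valid r \<longleftrightarrow> valid_instance (of_raw r)"
proof -
  obtain ns trs dts tm vs vc ps tw an ad where r: "r = (ns, trs, dts, tm, vs, vc, ps, tw, an, ad)"
    by (rule raw_cases)
  have parts: "pos_part a + pos_part d' + neg_part a' + neg_part d
      = pos_part a' + pos_part d + neg_part a + neg_part d' \<longleftrightarrow> a - d = a' - d'" for a d a' d' :: int
    using int_parts[of a] int_parts[of a'] int_parts[of d] int_parts[of d'] by linarith
  have "(\<forall>d\<in>set (zip xs ys). a - fst d = a' - snd d) \<longleftrightarrow> (\<forall>s<n. a - xs ! s = a' - ys ! s)"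
    if "length xs = n" "length ys = n" for xs ys :: "int list" and a a' n
    using that by (auto simp: set_zip)
  then have "(\<forall>c\<in>set trs. length (fst c) = length ns) \<Longrightarrow>
     (\<forall>c\<in>set trs. \<forall>c'\<in>set trs. \<forall>d\<in>set (zip (fst c) (fst c')). snd c - fst d = snd c' - snd d) \<longleftrightarrow>
     (\<forall>c\<in>set trs. \<forall>c'\<in>set trs. \<forall>s<length ns. snd c - fst c ! s = snd c' - fst c' ! s)"
    by (intro ball_cong refl) auto
  then have 1: "(\<forall>c\<in>set trs. length (fst c) = length ns) \<and>
     (\<forall>c\<in>set trs. \<forall>c'\<in>set trs. \<forall>d\<in>set (zip (fst c) (fst c')). snd c - fst d = snd c' - snd d) \<longleftrightarrow>
     (\<forall>c\<in>set trs. length (fst c) = length ns) \<and>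
     (\<forall>s<length ns. \<forall>c\<in>set trs. \<forall>c'\<in>set trs. snd c - fst c ! s = snd c' - fst c' ! s)"
    by blast
  have 2: "raw_valid r \<longleftrightarrow>
     ((\<forall>c\<in>set trs. length (fst c) = length ns) \<and>
     (\<forall>c\<in>set trs. \<forall>c'\<in>set trs. \<forall>d\<in>set (zip (fst c) (fst c')). snd c - fst d = snd c' - snd d)) \<and>
     dts \<noteq> [] \<and> 1 \<le> tm \<and> 1 \<le> vc \<and>
     (\<forall>j\<in>set ps. fst j < length ns \<and> fst (snd j) < length dts) \<and> 0 < ad \<and> an \<le> ad"
    unfolding r raw_valid_def prod.case parts by blast
  have 3: "valid_instance (of_raw r) \<longleftrightarrow>
     ((\<forall>c\<in>set trs. length (fst c) = length ns) \<and>
     (\<forall>s<length ns. \<forall>c\<in>set trs. \<forall>c'\<in>set trs. snd c - fst c ! s = snd c' - fst c' ! s)) \<and>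
     dts \<noteq> [] \<and> 1 \<le> tm \<and> 1 \<le> vc \<and>
     (\<forall>j\<in>set ps. fst j < length ns \<and> fst (snd j) < length dts) \<and> 0 < ad \<and> an \<le> ad"
    unfolding r valid_instance_def of_raw_def prod.case
    by (simp add: of_raw_trip_def of_raw_pass_def travel_time_def)
  show ?thesis unfolding 2 3 1 ..
qed

lemma pt_raw_valid [pt_intros]:
  assumes "pt f" shows "pt (\<lambda>x. raw_valid (f x))"
  unfolding raw_valid_def split_beta by (intro pt_intros assms pt_comp[OF assms])

type_synonym cert = "(nat \<times> nat) list"

definition raw_rtt :: "raw_dest list \<Rightarrow> raw_pass list \<Rightarrow> nat \<Rightarrow> nat" where
  "raw_rtt dts ps j = (let d = nth_default (0, 0, 0) dts (fst (snd (nth_default (0, 0, 0) ps j)))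
     in fst d + fst (snd d) + snd (snd d))"

lemma pt_raw_rtt [pt_intros]:
  assumes "pt f" "pt g" "pt h" shows "pt (\<lambda>x. raw_rtt (f x) (g x) (h x))"
  unfolding raw_rtt_def Let_def by (intro pt_intros assms)

definition raw_ok :: "raw \<Rightarrow> cert \<Rightarrow> bool" where
  "raw_ok r sol \<longleftrightarrow> (case r of (ns, trs, dts, tm, vs, vc, ps, tw, an, ad) \<Rightarrow>
     \<forall>j\<in>set [0..<length ps].
       fst (nth_default (0, 0) sol j) < length ps \<and>
       fst (nth_default (0, 0) sol (fst (nth_default (0, 0) sol j))) = fst (nth_default (0, 0) sol j) \<and>
       fst (snd (nth_default (0, 0, 0) ps (fst (nth_default (0, 0) sol j))))
         = fst (snd (nth_default (0, 0, 0) ps j)) \<and>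
       snd (nth_default (0, 0) sol (fst (nth_default (0, 0) sol j))) = snd (nth_default (0, 0) sol j) \<and>
       1 \<le> snd (nth_default (0, 0) sol j) \<and>
       snd (nth_default (0, 0) sol j) + raw_rtt dts ps j \<le> tm \<and>
       (\<exists>c\<in>set trs. pos_part (snd c) \<le> snd (nth_default (0, 0) sol j) + neg_part (snd c)) \<and>
       pos_part (snd (snd (nth_default (0, 0, 0) ps j)))
         \<le> snd (nth_default (0, 0) sol j)
           + fst (nth_default (0, 0, 0) dts (fst (snd (nth_default (0, 0, 0) ps j)))) + tw
           + neg_part (snd (snd (nth_default (0, 0, 0) ps j))) \<and>
       snd (nth_default (0, 0) sol j)
           + fst (nth_default (0, 0, 0) dts (fst (snd (nth_default (0, 0, 0) ps j))))
           + neg_part (snd (snd (nth_default (0, 0, 0) ps j)))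
         \<le> pos_part (snd (snd (nth_default (0, 0, 0) ps j))) + tw \<and>
       length (filter (\<lambda>i. fst (nth_default (0, 0) sol i) = fst (nth_default (0, 0) sol j)) [0..<length ps])
         \<le> vc \<and>
       length (filter (\<lambda>i. fst (nth_default (0, 0) sol i) = i \<and>
           snd (nth_default (0, 0) sol i) \<le> snd (nth_default (0, 0) sol j) \<and>
           snd (nth_default (0, 0) sol j) < snd (nth_default (0, 0) sol i) + raw_rtt dts ps i) [0..<length ps])
         \<le> length vs)"

lemma pt_raw_ok [pt_intros]:
  assumes "pt f" "pt g" shows "pt (\<lambda>x. raw_ok (f x) (g x))"
  unfolding raw_ok_def split_beta by (intro pt_intros assms pt_comp[OF assms(1)] pt_comp[OF assms(2)])

text \<open>Validity keeps the destinations of passengers in range, where \<open>nth_default\<close>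
  and \<open>!\<close> agree.\<close>

lemma raw_ok:
  assumes "raw_valid r"
  shows "raw_ok r sol \<longleftrightarrow> assignment_ok (of_raw r)
    (\<lambda>j. fst (nth_default (0, 0) sol j)) (\<lambda>j. snd (nth_default (0, 0) sol j))"
proof -
  obtain ns trs dts tm vs vc ps tw an ad where r: "r = (ns, trs, dts, tm, vs, vc, ps, tw, an, ad)"
    by (rule raw_cases)
  let ?I = "of_raw r"
  let ?\<rho> = "\<lambda>j. fst (nth_default (0, 0) sol j)" and ?t = "\<lambda>j. snd (nth_default (0, 0) sol j)"
  have I: "trips ?I = map of_raw_trip trs" "t_max ?I = tm" "n_vehicles ?I = length vs" "v_cap ?I = vc"
    "T_w ?I = tw" "length (passengers ?I) = length ps"
    by (simp_all add: r of_raw_def)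
  have P: "nth_default (0, 0, 0) ps j = ps ! j" "passengers ?I ! j = of_raw_pass (ps ! j)"
    if "j < length ps" for j
    using that by (simp_all add: nth_default_nth r of_raw_def)
  have D: "nth_default (0, 0, 0) dts (fst (snd (ps ! j))) = dts ! fst (snd (ps ! j))"
    "destinations ?I ! fst (snd (ps ! j)) = of_raw_dest (dts ! fst (snd (ps ! j)))"
    if "j < length ps" for j
  proof -
    have "fst (snd (ps ! j)) < length dts"
      using assms that by (auto simp: r raw_valid_def)
    then show "nth_default (0, 0, 0) dts (fst (snd (ps ! j))) = dts ! fst (snd (ps ! j))"
      "destinations ?I ! fst (snd (ps ! j)) = of_raw_dest (dts ! fst (snd (ps ! j)))"
      using that by (simp_all add: nth_default_nth r of_raw_def of_raw_pass_def)
  qed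
  have rtt: "raw_rtt dts ps j = round_trip_time (destinations ?I ! dest (passengers ?I ! j))"
    if "j < length ps" for j
    using that by (simp add: raw_rtt_def Let_def P D round_trip_time_def of_raw_dest_def of_raw_pass_def)
  have len: "length (filter Q [0..<n]) = card {i. i < n \<and> Q i}" for Q and n :: nat
    by (subst distinct_card[symmetric]) (auto intro: arg_cong[of _ _ card])
  have arr: "pos_part a \<le> k + neg_part a \<longleftrightarrow> a \<le> int k" for a k
    using int_parts[of a] by linarith
  have win: "pos_part a \<le> k + l + m + neg_part a \<longleftrightarrow> a - int m \<le> int k + int l"
    "k + l + neg_part a \<le> pos_part a + m \<longleftrightarrow> int k + int l \<le> a + int m" for a k l m
    using int_parts[of a] by linarith+
  have cnt: "{i. i < length ps \<and> ?\<rho> i = i \<and> ?t i \<le> u \<and> u < ?t i + raw_rtt dts ps i}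
     = {i. i < length ps \<and> ?\<rho> i = i \<and> ?t i \<le> u \<and>
       u < ?t i + round_trip_time (destinations ?I ! dest (passengers ?I ! i))}" for u
    using rtt by auto
  show ?thesis
    unfolding raw_ok_def assignment_ok_def I
    unfolding r prod.case len arr win cnt[unfolded r]
    unfolding r[symmetric] set_upt atLeast0LessThan lessThan_iff Ball_def
    by (intro all_cong1 imp_cong refl conj_cong)
      (auto simp: P D rtt of_raw_pass_def of_raw_dest_def of_raw_trip_def)
qed

text \<open>The certificate contains the instance besides the solution. Then \<open>x\<close> need
  not be decoded: it suffices to encode the proposed instance and to compare, which also rejects
  words that encode nothing.\<close>

definition verifier :: language where
  "verifier = {w. case split_pair w of (x, u) \<Rightarrow> (case cast (parse u) :: raw \<times> cert of (r, sol) \<Rightarrow>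
     enc_raw r = x \<and> raw_valid r \<and> raw_ok r sol)}"

lemma polytime_decidable_verifier: "polytime_decidable verifier"
proof -
  have "pt (\<lambda>w. [w \<in> verifier])"
    unfolding verifier_def mem_Collect_eq split_beta by (intro pt_intros)
  then show ?thesis unfolding polytime_decidable_def by (rule polytime_pt)
qed

lemma enc_pair_in_verifier:
  "enc_pair x (code (r :: raw, sol :: cert)) \<in> verifier \<longleftrightarrow> enc_raw r = x \<and> raw_valid r \<and> raw_ok r sol"
  by (simp add: verifier_def split_pair_enc_pair code_def parse_flat)

section \<open>Size of certificates\<close>

lemma length_enc_list: "length (enc_list e l) = (\<Sum>a\<leftarrow>l. Suc (length (e a))) + 1"
  by (induction l) (simp_all add: enc_list_def)

lemma length_enc_nat: "length (enc_nat n) = 2 * bitlen n + 1"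
  by (simp add: enc_nat_def length_enc_list bitlen_def sum_list_triv)

lemma sz_nat_enc: "sz n \<le> 2 * length (enc_nat n)"
  using sz_nat_le[of n] by (simp add: length_enc_nat)

lemma sz_int_enc: "sz i \<le> 4 * length (enc_int i)"
proof -
  have "sz i = sz (i < 0, nat \<bar>i\<bar>)" by (simp add: code_def rep_int_def)
  also have "\<dots> \<le> 4 * length (enc_int i)"
    using sz_nat_enc[of "nat \<bar>i\<bar>"] sz_bool[of "i < 0"] by (simp add: sz_Pair enc_int_def)
  finally show ?thesis .
qed

lemma sz_list_enc:
  assumes "\<And>a. sz a \<le> K * length (e a)" "1 \<le> K"
  shows "sz l \<le> K * length (enc_list e l)"
proof (induction l)
  case Nil
  then show ?case using assms(2) by (simp add: sz_Nil length_enc_list)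
next
  case (Cons a l)
  have "sz (a # l) \<le> K + K * length (e a) + K * length (enc_list e l)"
    using Cons assms(1)[of a] assms(2) by (simp add: sz_Cons)
  then show ?case by (simp add: length_enc_list algebra_simps)
qed

text \<open>The certificate includes the instance, so the code of an instance must not be much
  longer than its encoding. The constants are generous.\<close>

lemma sz_raw: "sz (r :: raw) \<le> 20 * length (enc_raw r)"
proof -
  obtain ns trs dts tm vs vc ps tw an ad where r: "r = (ns, trs, dts, tm, vs, vc, ps, tw, an, ad)"
    by (rule raw_cases)
  have unit: "sz (l :: unit list) \<le> 2 * length (enc_card (length l))" for l
    unfolding enc_card_length by (induction l) (simp_all add: sz_Cons sz_Nil length_enc_list code_def)
  have pos: "1 \<le> length (enc_list e l)" "1 \<le> length (enc_nat n)" "1 \<le> length (enc_int i)"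
    for e :: "'x \<Rightarrow> _" and l n i
    by (simp_all add: length_enc_list length_enc_nat enc_int_def)
  have "sz c \<le> 8 * length (enc_list enc_int (fst c) @ enc_int (snd c))" for c :: raw_trip
    using sz_list_enc[of 4 enc_int "fst c", OF sz_int_enc] sz_int_enc[of "snd c"] pos(3)[of "snd c"]
    by (cases c) (simp add: sz_Pair)
  then have trs: "sz trs \<le> 8 * length (enc_list (\<lambda>c. enc_list enc_int (fst c) @ enc_int (snd c)) trs)"
    by (intro sz_list_enc) auto
  have "sz d \<le> 8 * length (enc_nat (fst d) @ enc_nat (fst (snd d)) @ enc_nat (snd (snd d)))" for d :: raw_dest
    using sz_nat_enc[of "fst d"] sz_nat_enc[of "fst (snd d)"] sz_nat_enc[of "snd (snd d)"] pos(2)[of "fst d"]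
    by (cases d) (simp add: sz_Pair)
  then have dts: "sz dts \<le> 8 * length (enc_list (\<lambda>d. enc_nat (fst d) @ enc_nat (fst (snd d))
      @ enc_nat (snd (snd d))) dts)"
    by (intro sz_list_enc) auto
  have "sz j \<le> 8 * length (enc_nat (fst j) @ enc_nat (fst (snd j)) @ enc_int (snd (snd j)))" for j :: raw_pass
    using sz_nat_enc[of "fst j"] sz_nat_enc[of "fst (snd j)"] sz_int_enc[of "snd (snd j)"] pos(2)[of "fst j"]
    by (cases j) (simp add: sz_Pair)
  then have ps: "sz ps \<le> 8 * length (enc_list (\<lambda>j. enc_nat (fst j) @ enc_nat (fst (snd j))
      @ enc_int (snd (snd j))) ps)"
    by (intro sz_list_enc) auto
  show ?thesis
    using trs dts ps unit[of ns] unit[of vs] sz_nat_enc[of tm] sz_nat_enc[of vc] sz_nat_enc[of tw]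
      sz_nat_enc[of an] sz_nat_enc[of ad] pos(2)[of tm]
    by (simp add: r enc_raw_def sz_Pair)
qed

theorem ILMTP_SD_in_NP: "ILMTP_SD \<in> NP"
proof -
  \<comment> \<open>With \<open>n\<close> for the length of the input, \<open>20 * n\<close> covers
    the instance. There are at most \<open>n\<close> entries, each of size at most
    \<open>8 * n + 5\<close>: representatives are below the number of passengers and departure times
    at most \<open>t_max\<close>, so both have at most \<open>n\<close> bits. The rest is rounded
    up.\<close>
  define p :: "nat poly" where "p = [:2, 20:] + [:0, 1:] * [:10, 20:]"
  have "x \<in> ILMTP_SD \<longleftrightarrow> (\<exists>u. length u \<le> poly p (length x) \<and> enc_pair x u \<in> verifier)" for x
  proof
    assume "x \<in> ILMTP_SD"
    then obtain I where I: "x = enc_ilmtp I" "valid_instance I" "has_feasible_solution I"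
      by (auto simp: ILMTP_SD_def)
    obtain r where r: "of_raw r = I" using surj_of_raw by blast
    then have x: "enc_raw r = x" by (simp add: enc_raw I)
    have val: "raw_valid r" using I r by (simp add: raw_valid)
    obtain \<rho> t where "assignment_ok I \<rho> t"
      using I(3) feasible_iff_assignment by blast
    note ok = this
    obtain ns trs dts tm vs vc ps tw an ad where rr: "r = (ns, trs, dts, tm, vs, vc, ps, tw, an, ad)"
      by (rule raw_cases)
    let ?n = "length ps"
    have n: "length (passengers I) = ?n" "t_max I = tm" using r by (auto simp: rr of_raw_def)
    have bnd: "\<rho> j < ?n" "t j \<le> tm" if "j < ?n" for j
      using ok that n unfolding assignment_ok_def by force+
    define sol where "sol = map (\<lambda>j. (\<rho> j, t j)) [0..<?n]"
    have sol: "fst (nth_default (0, 0) sol j) = \<rho> j" "snd (nth_default (0, 0) sol j) = t j"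
      if "j < ?n" for j
      using that by (simp_all add: sol_def nth_default_nth)
    have "assignment_ok I (\<lambda>j. fst (nth_default (0, 0) sol j)) (\<lambda>j. snd (nth_default (0, 0) sol j))"
    proof -
      have sets: "{i. i < ?n \<and> fst (nth_default (0, 0) sol i) = k} = {i. i < ?n \<and> \<rho> i = k}"
        "{i. i < ?n \<and> fst (nth_default (0, 0) sol i) = i \<and> snd (nth_default (0, 0) sol i) \<le> k \<and>
           k < snd (nth_default (0, 0) sol i) + d i}
         = {i. i < ?n \<and> \<rho> i = i \<and> t i \<le> k \<and> k < t i + d i}" for k d
        using sol by auto
      show ?thesis
        using ok bnd unfolding assignment_ok_def n sets by (auto simp: sol)
    qed
    then have "enc_pair x (code (r, sol)) \<in> verifier"
      using x val by (simp add: enc_pair_in_verifier raw_ok r)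
    moreover have "length (code (r, sol)) \<le> poly p (length x)"
    proof -
      have len_x: "?n \<le> length x" "bitlen tm \<le> length x"
      proof -
        have "length l \<le> length (enc_list e l)" for e :: "raw_pass \<Rightarrow> bool list" and l
          by (induction l) (simp_all add: length_enc_list)
        then have "?n \<le> length (enc_list (\<lambda>j. enc_nat (fst j) @ enc_nat (fst (snd j)) @ enc_int (snd (snd j))) ps)"
          by blast
        then show "?n \<le> length x" unfolding x[symmetric] by (simp add: rr enc_raw_def)
        show "bitlen tm \<le> length x" unfolding x[symmetric] by (simp add: rr enc_raw_def length_enc_nat)
      qed
      have "sz (\<rho> j, t j) \<le> 8 * length x + 5" if "j < ?n" for j
      proof -
        have "bitlen (\<rho> j) \<le> length x"
          using bitlen_le_self[of "\<rho> j"] bnd(1)[OF that] len_x(1) by simp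
        moreover have "bitlen (t j) \<le> length x"
          using bitlen_mono[OF bnd(2)[OF that]] len_x(2) by simp
        ultimately show ?thesis
          using sz_nat_le[of "\<rho> j"] sz_nat_le[of "t j"] by (simp add: sz_Pair)
      qed
      then have "sz (map (\<lambda>j. (\<rho> j, t j)) l) \<le> length l * (8 * length x + 6) + 1"
        if "set l \<subseteq> {..<?n}" for l
        using that
      proof (induction l)
        case (Cons j l)
        then have "sz (\<rho> j, t j) \<le> 8 * length x + 5"
          "sz (map (\<lambda>j. (\<rho> j, t j)) l) \<le> length l * (8 * length x + 6) + 1" by simp_all
        moreover have "sz (map (\<lambda>j. (\<rho> j, t j)) (j # l)) = Suc (sz (\<rho> j, t j) + sz (map (\<lambda>j. (\<rho> j, t j)) l))"
          by (simp add: sz_Cons)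
        ultimately show ?case by simp
      qed (simp add: sz_Nil)
      from this[of "[0..<?n]"] have "sz sol \<le> ?n * (8 * length x + 6) + 1"
        by (simp add: sol_def atLeast0LessThan)
      also have "\<dots> \<le> length x * (8 * length x + 6) + 1"
        using len_x(1) by simp
      finally have "sz (r, sol) \<le> Suc (20 * length x + (length x * (8 * length x + 6) + 1))"
        using sz_raw[of r] x by (simp add: sz_Pair)
      then show ?thesis by (simp add: p_def algebra_simps)
    qed
    ultimately show "\<exists>u. length u \<le> poly p (length x) \<and> enc_pair x u \<in> verifier" by blast
  next
    assume "\<exists>u. length u \<le> poly p (length x) \<and> enc_pair x u \<in> verifier"
    then obtain u where "enc_pair x u \<in> verifier" by blast
    then obtain r sol where "enc_raw r = x" "raw_valid r" "raw_ok r sol"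
      by (auto simp: verifier_def split_pair_enc_pair split: prod.splits)
    then show "x \<in> ILMTP_SD"
      unfolding ILMTP_SD_def using raw_ok raw_valid enc_raw feasible_iff_assignment
      by (metis (mono_tags, lifting) image_eqI mem_Collect_eq)
  qed
  then show ?thesis unfolding NP_def using polytime_decidable_verifier by blast
qed

section \<open>From vector sums to instances\<close>

text \<open>
  Vectors of natural numbers, indexed by blocks, are multisets of blocks, written as lists.
\<close>

definition vector_sum :: "'b list list \<Rightarrow> 'b list \<Rightarrow> 'b list \<Rightarrow> bool" where
  "vector_sum items blocks target \<longleftrightarrow> (\<exists>A\<subseteq>{..<length items}.
     \<forall>b\<in>set blocks. (\<Sum>i\<in>A. count_list (items ! i) b) = count_list target b)"

definition horner :: "nat \<Rightarrow> ('b \<Rightarrow> nat) \<Rightarrow> 'b list \<Rightarrow> nat" where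
  "horner w f bs = foldl (\<lambda>acc b. f b + 2 ^ w * acc) 0 bs"

lemma horner_snoc: "horner w f (bs @ [b]) = f b + 2 ^ w * horner w f bs"
  by (simp add: horner_def)

lemma horner_sum: "(\<Sum>i\<in>A. horner w (f i) bs) = horner w (\<lambda>b. \<Sum>i\<in>A. f i b) bs"
proof (induction bs rule: rev_induct)
  case (snoc b bs)
  then show ?case by (simp add: horner_snoc sum.distrib flip: sum_distrib_left)
qed (simp add: horner_def)

text \<open>Digits below the base are recovered by division with remainder.\<close>

lemma horner_inject:
  assumes "\<And>b. b \<in> set bs \<Longrightarrow> f b < 2 ^ w \<and> g b < 2 ^ w"
  shows "horner w f bs = horner w g bs \<longleftrightarrow> (\<forall>b\<in>set bs. f b = g b)"
  using assms
proof (induction bs rule: rev_induct)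
  case (snoc b bs)
  have "f b < 2 ^ w" "g b < 2 ^ w" using snoc.prems by auto
  then have "x = (f b + 2 ^ w * x) div 2 ^ w" "f b = (f b + 2 ^ w * x) mod 2 ^ w"
      "x = (g b + 2 ^ w * x) div 2 ^ w" "g b = (g b + 2 ^ w * x) mod 2 ^ w" for x
    by simp_all
  then have "f b + 2 ^ w * x = g b + 2 ^ w * y \<longleftrightarrow> f b = g b \<and> x = y" for x y
    by metis
  with snoc show ?case by (auto simp: horner_snoc)
qed (simp add: horner_def)

lemma horner_pos: "b \<in> set bs \<Longrightarrow> 0 < f b \<Longrightarrow> 0 < horner w f bs"
  by (induction bs rule: rev_induct) (auto simp: horner_snoc)

text \<open>The width \<open>w\<close> of a digit is the total number of occurrences of blocks. No
  digit of a sum of distinct items can exceed it, hence there are no carries. With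
  \<open>b + b\<close> for twice \<open>b\<close>, addition is all that has to be computed.\<close>

definition vector_instance :: "'b list list \<Rightarrow> 'b list \<Rightarrow> 'b list \<Rightarrow> ilmtp" where
  "vector_instance items blocks target =
     (let w = length (concat items @ target);
          as = map (\<lambda>it. horner w (count_list it) blocks) items;
          b = horner w (count_list target) blocks
      in sched_instance (as @ [sum_list as, b + b]) (sum_list as + b))"

lemma count_list_le_length: "count_list l b \<le> length l"
  by (induction l) auto

text \<open>The common block \<open>b\<close> makes the target number positive, as
  \<open>subset_sum_iff_feasible\<close> demands.\<close>

lemma feasible_vector_instance:
  assumes "b \<in> set blocks" "b \<in> set target"
  shows "vector_sum items blocks target \<longleftrightarrow> has_feasible_solution (vector_instance items blocks target)"
proof -
  define w where "w = length (concat items @ target)"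
  define as where "as = map (\<lambda>it. horner w (count_list it) blocks) items"
  define t where "t = horner w (count_list target) blocks"
  have "0 < count_list target b" using assms(2) by (simp add: count_list_0_iff neq0_conv[symmetric])
  then have t: "0 < t" unfolding t_def using assms(1) horner_pos by metis
  have bound: "(\<Sum>i\<in>A. count_list (items ! i) c) < 2 ^ w" if "A \<subseteq> {..<length items}" for A c
  proof -
    have "(\<Sum>i\<in>A. count_list (items ! i) c) \<le> (\<Sum>i<length items. length (items ! i))"
      using that count_list_le_length by (intro order_trans[OF sum_mono sum_mono2]) auto
    also have "\<dots> = length (concat items)"
      by (simp add: length_concat sum_list_sum_nth atLeast0LessThan)
    also have "\<dots> \<le> w" by (simp add: w_def)
    also have "w < 2 ^ w" by simp
    finally show ?thesis .
  qed
  have bound2: "count_list target c < 2 ^ w" for c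
  proof -
    have "count_list target c \<le> w" using count_list_le_length[of target c] by (simp add: w_def)
    also have "w < 2 ^ w" by simp
    finally show ?thesis .
  qed
  have "(\<forall>c\<in>set blocks. (\<Sum>i\<in>A. count_list (items ! i) c) = count_list target c)
      \<longleftrightarrow> (\<Sum>i\<in>A. as ! i) = t" if A: "A \<subseteq> {..<length items}" for A
  proof -
    have "(\<Sum>i\<in>A. as ! i) = (\<Sum>i\<in>A. horner w (count_list (items ! i)) blocks)"
      using A by (intro sum.cong) (auto simp: as_def)
    also have "\<dots> = horner w (\<lambda>c. \<Sum>i\<in>A. count_list (items ! i) c) blocks"
      by (rule horner_sum)
    finally show ?thesis
      unfolding t_def using bound[OF A] bound2 by (simp add: horner_inject)
  qed
  then have "vector_sum items blocks target \<longleftrightarrow> (\<exists>A\<subseteq>{..<length as}. (\<Sum>i\<in>A. as ! i) = t)"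
    unfolding vector_sum_def by (auto simp: as_def)
  also have "\<dots> \<longleftrightarrow> has_feasible_solution (vector_instance items blocks target)"
  proof -
    have "vector_instance items blocks target = sched_instance (as @ [sum_list as, t + t]) (sum_list as + t)"
      by (simp only: vector_instance_def Let_def w_def as_def t_def)
    then show ?thesis using subset_sum_iff_feasible[OF t, of as] by (simp only: mult_2)
  qed
  finally show ?thesis .
qed

lemma valid_vector_instance: "valid_instance (vector_instance items blocks target)"
  unfolding vector_instance_def Let_def by (intro valid_sched_instance) simp

lemma bitlen_shift: "bitlen (2 ^ k * n) \<le> k + bitlen n"
  using less_exp_bitlen[of n] by (intro bitlen_le) (simp add: power_add)

text \<open>The exponent is given in unary: each element of \<open>l x\<close> doubles the number
  and so adds at most one bit.\<close>

lemma pt_shift [pt_intros]: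
  assumes "pt l" "pt n" shows "pt (\<lambda>x. 2 ^ length (l x) * n x :: nat)"
proof -
  obtain r where r: "\<And>x. sz (n x) \<le> poly r (sz x)" using pt_size[OF assms(2)] by metis
  have "pt (\<lambda>x. foldl (\<lambda>acc _. acc + acc) (n x) (l x))"
  proof (rule pt_foldl_measure[where \<mu> = bitlen and s = "[:1, 4:]" and r = r and d = "[:1:]"])
    show "sz acc \<le> poly [:1, 4:] (bitlen acc)" for acc
      using sz_nat_le[of acc] by (simp add: mult.commute)
    show "bitlen (n x) \<le> poly r (sz x)" for x using bitlen_le_sz[of "n x"] r[of x] by simp
    show "bitlen (acc + acc) \<le> bitlen acc + poly [:1:] (sz x + sz a)" for acc a and x :: 'a
      using bitlen_shift[of 1 acc] by (simp add: mult_2)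
  qed (intro pt_intros assms)+
  moreover have "foldl (\<lambda>acc _. acc + acc) m as = 2 ^ length as * m" for m :: nat and as :: "'b list"
    by (induction as arbitrary: m) auto
  ultimately show ?thesis by simp
qed

lemma pt_count_list [pt_intros]:
  assumes "pt l" "pt b" shows "pt (\<lambda>x. count_list (l x) (b x))"
proof -
  have "pt (\<lambda>x. length (filter (\<lambda>a. b x = a) (l x)))"
    by (intro pt_intros assms pt_comp[OF assms(2)])
  then show ?thesis by (simp add: count_list_eq_length_filter)
qed

lemma pt_horner [pt_intros]:
  assumes "pt l" "pt k" "pt bs" shows "pt (\<lambda>x. horner (length (l x)) (count_list (k x)) (bs x))"
  unfolding horner_def
proof -
  obtain t where t: "\<And>x. sz (l x) \<le> poly t (sz x)" using pt_size[OF assms(1)] by metis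
  obtain u where u: "\<And>x. sz (k x) \<le> poly u (sz x)" using pt_size[OF assms(2)] by metis
  show "pt (\<lambda>x. foldl (\<lambda>acc b. count_list (k x) b + 2 ^ length (l x) * acc) 0 (bs x))"
  proof (rule pt_foldl_measure[where \<mu> = bitlen and s = "[:1, 4:]" and r = 0 and d = "u + t + 1"])
    show "sz acc \<le> poly [:1, 4:] (bitlen acc)" for acc
      using sz_nat_le[of acc] by (simp add: mult.commute)
    show "bitlen (count_list (k x) b + 2 ^ length (l x) * acc)
        \<le> bitlen acc + poly (u + t + 1) (sz x + sz b)" for x acc b
    proof -
      have "bitlen (count_list (k x) b) \<le> poly u (sz x)"
        using bitlen_le_self[of "count_list (k x) b"] count_list_le_length[of "k x" b]
          length_le_sz[of "k x"] u[of x] by linarith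
      moreover have "length (l x) \<le> poly t (sz x)"
        using length_le_sz[of "l x"] t[of x] by linarith
      moreover have "poly u (sz x) \<le> poly u (sz x + sz b)" "poly t (sz x) \<le> poly t (sz x + sz b)"
        by (auto intro: poly_nat_mono)
      ultimately show ?thesis
        using bitlen_add[of "count_list (k x) b" "2 ^ length (l x) * acc"]
          bitlen_shift[of "length (l x)" acc] by simp
    qed
  qed (auto simp: bitlen_def intro!: pt_intros assms pt_comp[OF assms(1)] pt_comp[OF assms(2)])
qed

text \<open>Written as \<open>of_raw\<close> of a tuple, the instance is within reach of the closure
  rules.\<close>

lemma pt_enc_sched_instance:
  assumes "pt js" "pt H" shows "pt (\<lambda>x. enc_ilmtp (sched_instance (js x) (H x)))"
proof -
  have "sched_instance ks h = of_raw ([()], [([0], 0)], map (\<lambda>a. (0, a, 0)) ks, Suc h, [(), ()], 1,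
      map (\<lambda>i. (0, i, 0)) [0..<length ks], Suc h, 0, 1)" for ks h
    by (simp add: of_raw_def sched_instance_def comp_def of_raw_trip_def of_raw_dest_def of_raw_pass_def)
  moreover have "pt (\<lambda>x. enc_raw ([()], [([0], 0)], map (\<lambda>a. (0, a, 0)) (js x), Suc (H x), [(), ()], 1,
      map (\<lambda>i. (0, i, 0)) [0..<length (js x)], Suc (H x), 0, 1))"
    by (intro pt_intros assms)
  ultimately show ?thesis by (simp add: enc_raw)
qed

lemma pt_enc_vector_instance:
  assumes "pt items" "pt blocks" "pt target"
  shows "pt (\<lambda>x. enc_ilmtp (vector_instance (items x) (blocks x) (target x)))"
  unfolding vector_instance_def Let_def
  by (intro pt_enc_sched_instance pt_intros assms pt_comp[OF assms(1)] pt_comp[OF assms(2)]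
    pt_comp[OF assms(3)])

text \<open>
  An item is an option for a slot. If every slot has its own block, filled by one unit, then a
  solution chooses exactly one option for each slot.
\<close>

lemma vector_sum_choice:
  fixes L :: "('v \<times> 'o) list" and con :: "'v \<times> 'o \<Rightarrow> 'b list"
  assumes L: "distinct L" "fst ` set L \<subseteq> V" and finV: "finite V"
    and one: "\<And>l v. l \<in> set L \<Longrightarrow> v \<in> V \<Longrightarrow> count_list (con l) (unit_block v) = (if fst l = v then 1 else 0)"
    and target: "\<And>v. v \<in> V \<Longrightarrow> count_list target (unit_block v) = 1"
    and blocks: "set blocks = unit_block ` V \<union> B"
  shows "vector_sum (map con L) blocks target \<longleftrightarrow>
    (\<exists>c. (\<forall>v\<in>V. (v, c v) \<in> set L) \<and>
      (\<forall>b\<in>B. (\<Sum>v\<in>V. count_list (con (v, c v)) b) = count_list target b))"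
    (is "?L \<longleftrightarrow> ?R")
proof -
  have inj: "inj_on ((!) L) {..<length L}"
    using L(1) by (auto simp: inj_on_def distinct_conv_nth)
  have img: "(!) L ` {..<length L} = set L"
    using nth_image[of "length L" L] by (simp add: atLeast0LessThan)
  have sum_nth: "(\<Sum>i\<in>A. count_list (map con L ! i) b) = (\<Sum>l\<in>(!) L ` A. count_list (con l) b)"
    if "A \<subseteq> {..<length L}" for A b
  proof -
    have "(\<Sum>l\<in>(!) L ` A. count_list (con l) b) = (\<Sum>i\<in>A. count_list (con (L ! i)) b)"
      using inj_on_subset[OF inj that] by (simp add: sum.reindex comp_def)
    also have "\<dots> = (\<Sum>i\<in>A. count_list (map con L ! i) b)"
      using that by (intro sum.cong) auto
    finally show ?thesis ..
  qed
  \<comment> \<open>As \<open>L\<close> is distinct, sets of indices correspond to sets of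
    items.\<close>
  have "?L \<longleftrightarrow> (\<exists>X\<subseteq>set L. \<forall>b\<in>set blocks. (\<Sum>l\<in>X. count_list (con l) b) = count_list target b)"
    (is "_ \<longleftrightarrow> ?M")
  proof
    assume ?L
    then obtain A where A: "A \<subseteq> {..<length L}"
      "\<forall>b\<in>set blocks. (\<Sum>i\<in>A. count_list (map con L ! i) b) = count_list target b"
      by (auto simp: vector_sum_def)
    then have "(!) L ` A \<subseteq> set L" using img by blast
    with A show ?M by (intro exI[of _ "(!) L ` A"]) (simp add: sum_nth)
  next
    assume ?M
    then obtain X where X: "X \<subseteq> (!) L ` {..<length L}"
      "\<forall>b\<in>set blocks. (\<Sum>l\<in>X. count_list (con l) b) = count_list target b"
      unfolding img by blast
    from subset_imageE[OF X(1)] obtain A where A: "A \<subseteq> {..<length L}" "X = (!) L ` A" by metis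
    with X(2) show ?L unfolding vector_sum_def by (intro exI[of _ A]) (simp add: sum_nth)
  qed
  also have "?M \<longleftrightarrow> ?R"
  proof
    assume ?M
    then obtain X where X: "X \<subseteq> set L"
      "\<And>b. b \<in> set blocks \<Longrightarrow> (\<Sum>l\<in>X. count_list (con l) b) = count_list target b" by blast
    have finX: "finite X" using X(1) finite_subset by blast
    \<comment> \<open>The unit block of \<open>v\<close> counts the chosen options for the slot
      \<open>v\<close>, and its target is 1.\<close>
    have "\<exists>y. {l \<in> X. fst l = v} = {y}" if v: "v \<in> V" for v
    proof -
      have "(\<Sum>l\<in>X. count_list (con l) (unit_block v)) = (\<Sum>l\<in>X. if fst l = v then 1 else 0)"
        using X(1) one v by (intro sum.cong) auto
      also have "\<dots> = card {l \<in> X. fst l = v}"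
        using finX by (simp add: sum.If_cases Int_def)
      finally have "card {l \<in> X. fst l = v} = 1"
        using X(2)[of "unit_block v"] target[OF v] v blocks by simp
      then show ?thesis by (simp add: card_1_singleton_iff)
    qed
    then obtain y where y: "\<And>v. v \<in> V \<Longrightarrow> {l \<in> X. fst l = v} = {y v}" by metis
    have fsty: "y v \<in> X \<and> fst (y v) = v" if "v \<in> V" for v using y[OF that] by blast
    have Xeq: "X = (\<lambda>v. (v, snd (y v))) ` V"
    proof (intro equalityI subsetI)
      fix l assume l: "l \<in> X"
      then have "fst l \<in> V" using X(1) L(2) by auto
      then have "l = y (fst l)" using y l by blast
      then have "l = (fst l, snd (y (fst l)))" by (metis prod.collapse)
      with \<open>fst l \<in> V\<close> show "l \<in> (\<lambda>v. (v, snd (y v))) ` V" by (rule rev_image_eqI)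
    next
      fix l assume "l \<in> (\<lambda>v. (v, snd (y v))) ` V"
      then show "l \<in> X" using fsty by (metis (no_types, lifting) imageE prod.collapse)
    qed
    have "(\<Sum>v\<in>V. count_list (con (v, snd (y v))) b) = count_list target b" if "b \<in> B" for b
    proof -
      have "(\<Sum>l\<in>X. count_list (con l) b) = (\<Sum>v\<in>V. count_list (con (v, snd (y v))) b)"
        unfolding Xeq by (subst sum.reindex) (auto simp: inj_on_def)
      then show ?thesis using X(2)[of b] that blocks by simp
    qed
    moreover have "\<forall>v\<in>V. (v, snd (y v)) \<in> set L" using Xeq X(1) by blast
    ultimately show ?R by (intro exI[of _ "\<lambda>v. snd (y v)"]) simp
  next
    assume ?R
    then obtain c where c: "\<forall>v\<in>V. (v, c v) \<in> set L"
      "\<And>b. b \<in> B \<Longrightarrow> (\<Sum>v\<in>V. count_list (con (v, c v)) b) = count_list target b" by blast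
    let ?X = "(\<lambda>v. (v, c v)) ` V"
    have sum: "(\<Sum>l\<in>?X. count_list (con l) b) = (\<Sum>v\<in>V. count_list (con (v, c v)) b)" for b
      by (subst sum.reindex) (auto simp: inj_on_def)
    have "(\<Sum>v\<in>V. count_list (con (v, c v)) (unit_block v')) = 1" if "v' \<in> V" for v'
    proof -
      have "(\<Sum>v\<in>V. count_list (con (v, c v)) (unit_block v')) = (\<Sum>v\<in>V. if v = v' then 1 else 0)"
        using c(1) one that by (intro sum.cong) auto
      then show ?thesis using that finV by simp
    qed
    then have "\<forall>b\<in>set blocks. (\<Sum>l\<in>?X. count_list (con l) b) = count_list target b"
      unfolding sum blocks using c(2) target by auto
    moreover have "?X \<subseteq> set L" using c(1) by auto
    ultimately show ?M by blast
  qed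
  finally show ?thesis .
qed

section \<open>Runs of a Turing machine as a constraint satisfaction problem\<close>

text \<open>
  Positions are relative to the head, which makes it unnecessary to guess head positions: with
  \<open>r\<close> steps remaining, only the cells at distance at most \<open>r\<close> matter, and \<open>cell c r i j\<close> is
  the one at distance \<open>j - r\<close> from the head of tape \<open>i\<close>, where \<open>j \<le> 2 * r\<close>.
\<close>

definition cell :: "config \<Rightarrow> nat \<Rightarrow> nat \<Rightarrow> nat \<Rightarrow> nat" where
  "cell c r i j = fst (snd c ! i) (snd (snd c ! i) + int j - int r)"

text \<open>During a step the head is displaced by \<open>shift m\<close> and the radius of the
  window shrinks by one. Index \<open>j\<close> of the new window is therefore index
  \<open>j + shift m + 1\<close> of the old one, and \<open>shift m + 1\<close> is a natural
  number.\<close>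

fun move_code :: "move \<Rightarrow> nat" where
  "move_code Move_Left = 0"
| "move_code Stay = 1"
| "move_code Move_Right = 2"

lemma shift_move_code: "shift m = int (move_code m) - 1"
  by (cases m) auto

lemma move_code_less: "move_code m < 3"
  by (cases m) auto

text \<open>A halted machine takes steps that change nothing, so every row of the table has an
  option and all runs have the same length.\<close>

definition step_result :: "tm \<Rightarrow> nat \<Rightarrow> nat list \<Rightarrow> nat \<times> (nat \<times> move) list" where
  "step_result M q ss = (if q = 1 then (q, map (\<lambda>s. (s, Stay)) ss) else tm_trans M q ss)"

lemma tm_step_result:
  "tm_step M (q, ts) = (case step_result M q (map read_tape ts) of (q', as) \<Rightarrow> (q', map2 act as ts))"
  by (simp add: step_result_def map2_act_idle del: map_map)

lemma step_result_wf:
  assumes "wf_tm M" "q < tm_states M" "length ss = tm_tapes M" "set ss \<subseteq> {..<tm_symbols M}"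
    and "step_result M q ss = (q', as)"
  shows "q' < tm_states M \<and> length as = tm_tapes M \<and> fst ` set as \<subseteq> {..<tm_symbols M}"
proof (cases "q = 1")
  case True
  then show ?thesis using assms by (auto simp: step_result_def)
next
  case False
  then have "tm_trans M q ss = (q', as)" using assms(5) by (simp add: step_result_def)
  with assms(1-4) show ?thesis unfolding wf_tm_def by fastforce
qed

lemma cell_step:
  assumes "length as = length ts" "i < length ts"
  shows "cell (q', map2 act as ts) r i j =
    (if j + move_code (snd (as ! i)) = Suc r then fst (as ! i)
     else cell (q, ts) (Suc r) i (j + move_code (snd (as ! i))))"
proof -
  obtain T h where t: "ts ! i = (T, h)" by fastforce
  obtain s m where a: "as ! i = (s, m)" by fastforce
  have "map2 act as ts ! i = (T(h := s), h + shift m)"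
    using assms by (simp add: t a)
  then show ?thesis
    by (auto simp: cell_def t a shift_move_code algebra_simps)
qed

lemma read_tape_cell: "i < length ts \<Longrightarrow> read_tape (ts ! i) = cell (q, ts) r i r"
  by (cases "ts ! i") (simp add: cell_def)

text \<open>The old state, the new state and, for each tape, the symbol read, the symbol written and
  the code of the move.\<close>

type_synonym step_option = "nat \<times> nat \<times> (nat \<times> nat \<times> nat) list"

definition option_of :: "tm \<Rightarrow> nat \<Rightarrow> nat list \<Rightarrow> step_option" where
  "option_of M q ss = (case step_result M q ss of (q', as) \<Rightarrow>
     (q, q', map2 (\<lambda>s a. (s, fst a, move_code (snd a))) ss as))"

definition tm_opts :: "tm \<Rightarrow> step_option list" where
  "tm_opts M = remdups (map (\<lambda>p. option_of M (fst p) (snd p))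
     (List.product [0..<tm_states M] (List.n_lists (tm_tapes M) [0..<tm_symbols M])))"

lemma set_tm_opts: "set (tm_opts M) = {option_of M q ss | q ss.
    q < tm_states M \<and> length ss = tm_tapes M \<and> set ss \<subseteq> {..<tm_symbols M}}"
proof -
  have "set (tm_opts M) = (\<lambda>p. option_of M (fst p) (snd p)) `
      ({..<tm_states M} \<times> {ss. length ss = tm_tapes M \<and> set ss \<subseteq> {..<tm_symbols M}})"
    by (simp add: tm_opts_def set_n_lists atLeast0LessThan)
  then show ?thesis unfolding image_def by fastforce
qed

text \<open>Options for a cell: its content before and after the step, and the move of the head.\<close>

definition cell_opts :: "tm \<Rightarrow> (nat \<times> nat \<times> nat) list" where
  "cell_opts M = List.product [0..<tm_symbols M] (List.product [0..<tm_symbols M] [0..<3])"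

text \<open>
  The certificate is guessed by an automaton with two states, which writes bits in state 0
  and blanks in state 1.
\<close>

definition guess_opts :: "(nat \<times> nat \<times> nat) list" where
  "guess_opts = [(0, 0, 1), (0, 0, 2), (0, 1, 0), (1, 1, 0)]"

text \<open>The input is the known word \<open>pre\<close> followed by at most \<open>U\<close>
  guessed bits. The number of steps is \<open>Suc T'\<close>, so there always is a first
  step.\<close>

locale tableau =
  fixes M :: tm and T' U :: nat and pre :: "bool list"
  assumes wf: "wf_tm M"
begin

abbreviation "k \<equiv> tm_tapes M"
abbreviation "T \<equiv> Suc T'"

definition start_symbol :: "nat \<Rightarrow> nat \<Rightarrow> nat" where
  "start_symbol i j = (if i = 0 \<and> T \<le> j \<and> j - T < length pre then bit_symbol (pre ! (j - T)) else 0)"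

definition guess_symbol :: "(nat \<Rightarrow> nat \<times> nat \<times> nat) \<Rightarrow> nat \<Rightarrow> nat \<Rightarrow> nat" where
  "guess_symbol cg i j = (if i = 0 \<and> T + length pre \<le> j \<and> j < T + length pre + U
     then snd (snd (cg (j - (T + length pre)))) else 0)"

text \<open>Slot \<open>r\<close> belongs to the step taken when \<open>Suc r\<close> steps remain.\<close>

definition csp :: "(nat \<Rightarrow> step_option) \<Rightarrow> (nat \<Rightarrow> nat \<Rightarrow> nat \<Rightarrow> nat \<times> nat \<times> nat) \<Rightarrow>
    (nat \<Rightarrow> nat \<times> nat \<times> nat) \<Rightarrow> bool" where
  "csp co cc cg \<longleftrightarrow>
     (\<forall>r<T. co r \<in> set (tm_opts M)) \<and>
     (\<forall>r<T. \<forall>i<k. \<forall>j\<le>2 * Suc r. cc r i j \<in> set (cell_opts M) \<and>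
        (j = Suc r \<or> fst (snd (cc r i j)) = fst (cc r i j))) \<and>
     (\<forall>j<U. cg j \<in> set guess_opts) \<and>
     (\<forall>r<T. fst (co r) = (if r = T' then 0 else fst (snd (co (Suc r))))) \<and>
     (\<forall>r<T. \<forall>i<k. \<forall>j\<le>2 * Suc r. snd (snd (cc r i j)) = snd (snd (snd (snd (co r)) ! i))) \<and>
     (\<forall>r<T. \<forall>i<k. fst (cc r i (Suc r)) = fst (snd (snd (co r)) ! i)) \<and>
     (\<forall>r<T. \<forall>i<k. fst (snd (cc r i (Suc r))) = fst (snd (snd (snd (co r)) ! i))) \<and>
     (\<forall>r<T. \<forall>i<k. \<forall>j\<le>2 * Suc r. fst (cc r i j) =
        (if r = T' then start_symbol i j + guess_symbol cg i j
         else \<Sum>j'\<le>2 * Suc (Suc r). if j + snd (snd (cc (Suc r) i j')) = j'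
           then fst (snd (cc (Suc r) i j')) else 0)) \<and>
     (\<forall>j<U. fst (cg j) = (if j = 0 then 0 else fst (snd (cg (j - 1))))) \<and>
     (\<Sum>j\<le>2. if snd (snd (cc 0 0 j)) = j then fst (snd (cc 0 0 j)) else 0) = 2"

definition conf :: "bool list \<Rightarrow> nat \<Rightarrow> config" where
  "conf w r = (tm_step M ^^ (T - r)) (init_config M w)"

lemma conf_T: "conf w T = init_config M w"
  by (simp add: conf_def)

lemma conf_step: "r < T \<Longrightarrow> conf w r = tm_step M (conf w (Suc r))"
  by (simp add: conf_def Suc_diff_le)

definition wf_config :: "config \<Rightarrow> bool" where
  "wf_config c \<longleftrightarrow> fst c < tm_states M \<and> length (snd c) = k \<and>
     (\<forall>i<k. \<forall>p. fst (snd c ! i) p < tm_symbols M)"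

lemma wf_config_read:
  assumes "wf_config c" shows "set (map read_tape (snd c)) \<subseteq> {..<tm_symbols M}"
proof -
  have "read_tape t = fst t (snd t)" for t by (cases t) simp
  then have "read_tape (snd c ! i) < tm_symbols M" if "i < k" for i
    using assms that by (simp add: wf_config_def)
  then show ?thesis using assms by (force simp: wf_config_def set_conv_nth simp del: split_paired_All)
qed

lemma wf_config_step:
  assumes "wf_config c" shows "wf_config (tm_step M c)"
proof -
  obtain q ts where c: "c = (q, ts)" by fastforce
  obtain q' as where s: "step_result M q (map read_tape ts) = (q', as)" by fastforce
  have *: "q' < tm_states M" "length as = k" "fst ` set as \<subseteq> {..<tm_symbols M}"
    using step_result_wf[OF wf _ _ _ s] assms wf_config_read[OF assms] by (auto simp: c wf_config_def)
  have "fst (act (as ! i) (ts ! i)) p < tm_symbols M" if "i < k" for i p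
  proof -
    have "fst (as ! i) \<in> fst ` set as" using *(2) that by simp
    then have "fst (as ! i) < tm_symbols M" using *(3) by blast
    moreover have "fst (ts ! i) p < tm_symbols M" using assms that by (auto simp: c wf_config_def)
    ultimately show ?thesis by (cases "as ! i"; cases "ts ! i") auto
  qed
  with * assms show ?thesis by (auto simp: c tm_step_result s wf_config_def simp del: tm_step.simps)
qed

lemma wf_config_init: "wf_config (init_config M w)"
proof -
  have "fst (word_tape w) p < tm_symbols M" for w p
    using wf by (auto simp: word_tape_def bit_symbol_def wf_tm_def)
  then show ?thesis
    using wf by (auto simp: wf_config_def init_config_def wf_tm_def nth_Cons split: nat.splits)
qed

lemma wf_conf: "wf_config (conf w r)"
proof -
  have "wf_config ((tm_step M ^^ n) (init_config M w))" for n
    by (induction n) (auto simp: wf_config_init wf_config_step)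
  then show ?thesis by (simp add: conf_def)
qed

lemma cell_init:
  assumes "i < k"
  shows "cell (init_config M w) T i j
    = (if i = 0 \<and> T \<le> j \<and> j - T < length w then bit_symbol (w ! (j - T)) else 0)"
proof (cases i)
  case 0
  have "nat (int j - int T) = j - T" by simp
  then show ?thesis using 0 by (auto simp: cell_def init_config_def word_tape_def of_nat_diff)
next
  case (Suc i')
  then show ?thesis using assms by (simp add: cell_def init_config_def word_tape_def)
qed

lemma option_of_step:
  assumes "wf_config c" "tm_step M c = c'" and opt: "opt = option_of M (fst c) (map read_tape (snd c))"
  shows "opt \<in> set (tm_opts M)" "fst opt = fst c" "fst (snd opt) = fst c'"
    "\<And>i. i < k \<Longrightarrow> fst (snd (snd opt) ! i) = cell c r i r"
    "\<And>i. i < k \<Longrightarrow> fst (snd (snd (snd opt) ! i)) < tm_symbols M"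
    "\<And>i. i < k \<Longrightarrow> snd (snd (snd (snd opt) ! i)) < 3"
    "\<And>i j. i < k \<Longrightarrow> cell c' r' i j = (if j + snd (snd (snd (snd opt) ! i)) = Suc r'
       then fst (snd (snd (snd opt) ! i)) else cell c (Suc r') i (j + snd (snd (snd (snd opt) ! i))))"
proof -
  obtain q ts where c: "c = (q, ts)" by fastforce
  obtain q' as where s: "step_result M q (map read_tape ts) = (q', as)" by fastforce
  have len: "length ts = k" using assms(1) by (simp add: c wf_config_def)
  have *: "q' < tm_states M" "length as = k" "fst ` set as \<subseteq> {..<tm_symbols M}"
    using step_result_wf[OF wf _ _ _ s] assms(1) wf_config_read[OF assms(1)]
    by (auto simp: c wf_config_def)
  have c': "c' = (q', map2 act as ts)" using assms(2) by (simp add: c tm_step_result s del: tm_step.simps)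
  have opt': "opt = (q, q', map2 (\<lambda>s a. (s, fst a, move_code (snd a))) (map read_tape ts) as)"
    by (simp add: opt c option_of_def s)
  have nth: "snd (snd opt) ! i = (read_tape (ts ! i), fst (as ! i), move_code (snd (as ! i)))"
    if "i < k" for i
    using that len * by (simp add: opt')
  show "opt \<in> set (tm_opts M)"
    unfolding set_tm_opts opt mem_Collect_eq using assms(1) wf_config_read[OF assms(1)]
    by (intro exI[of _ "fst c"] exI[of _ "map read_tape (snd c)"]) (simp add: wf_config_def)
  show "fst opt = fst c" "fst (snd opt) = fst c'" by (simp_all add: opt' c c')
  show "fst (snd (snd opt) ! i) = cell c r i r" if "i < k" for i
    using that len by (simp add: nth c read_tape_cell)
  show "fst (snd (snd (snd opt) ! i)) < tm_symbols M" if "i < k" for i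
  proof -
    have "fst (as ! i) \<in> fst ` set as" using *(2) that by simp
    with *(3) that show ?thesis by (auto simp: nth)
  qed
  show "snd (snd (snd (snd opt) ! i)) < 3" if "i < k" for i
    using that by (simp add: nth move_code_less)
  show "cell c' r' i j = (if j + snd (snd (snd (snd opt) ! i)) = Suc r'
       then fst (snd (snd (snd opt) ! i)) else cell c (Suc r') i (j + snd (snd (snd (snd opt) ! i))))"
    if "i < k" for i j
    using that len *(2) cell_step[of as ts i q' r' j q] by (simp add: nth c c')
qed

lemma tm_opts_unique:
  assumes "opt \<in> set (tm_opts M)" "fst opt = fst c" "length (snd c) = k"
    and "\<And>i. i < k \<Longrightarrow> fst (snd (snd opt) ! i) = read_tape (snd c ! i)"
  shows "opt = option_of M (fst c) (map read_tape (snd c))"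
proof -
  obtain q ss where opt: "opt = option_of M q ss" and q: "q < tm_states M" "length ss = k"
    "set ss \<subseteq> {..<tm_symbols M}"
    using assms(1) by (auto simp: set_tm_opts)
  obtain q' as where s: "step_result M q ss = (q', as)" by fastforce
  have *: "length as = k" using step_result_wf[OF wf q s] by simp
  have "q = fst c" using assms(2) by (simp add: opt option_of_def s)
  moreover have "ss = map read_tape (snd c)"
  proof (rule nth_equalityI)
    show "ss ! i = map read_tape (snd c) ! i" if "i < length ss" for i
      using that assms(3) assms(4)[of i] q(2) * by (simp add: opt option_of_def s)
  qed (use q assms(3) in simp)
  ultimately show ?thesis using opt by simp
qed

text \<open>As all cells of a tape move alike, exactly one cell moves to a given position.\<close>

lemma sum_moved:
  fixes f :: "nat \<Rightarrow> nat"
  assumes "\<And>j'. j' \<le> n \<Longrightarrow> m j' = d" "j + d \<le> n"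
  shows "(\<Sum>j'\<le>n. if j + m j' = j' then f j' else 0) = f (j + d)"
proof -
  have "(\<Sum>j'\<le>n. if j + m j' = j' then f j' else 0) = (\<Sum>j'\<le>n. if j' = j + d then f j' else 0)"
    using assms(1) by (intro sum.cong) auto
  then show ?thesis using assms(2) by simp
qed

lemma csp_complete:
  assumes u: "length u \<le> U" and acc: "cell (conf (pre @ u) 0) 0 0 0 = 2"
  shows "\<exists>co cc cg. csp co cc cg"
proof -
  let ?c = "\<lambda>r. conf (pre @ u) (Suc r)"
  define co where "co r = option_of M (fst (?c r)) (map read_tape (snd (?c r)))" for r
  let ?mv = "\<lambda>r i. snd (snd (snd (snd (co r)) ! i))"
  let ?wr = "\<lambda>r i. fst (snd (snd (snd (co r)) ! i))"
  define cc where "cc r i j = (cell (?c r) (Suc r) i j,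
    if j = Suc r then ?wr r i else cell (?c r) (Suc r) i j, ?mv r i)" for r i j
  \<comment> \<open>The automaton leaves state 0 while it writes the first blank.\<close>
  define cg :: "nat \<Rightarrow> nat \<times> nat \<times> nat" where
    "cg j = (of_bool (length u < j), of_bool (length u \<le> j),
      if j < length u then bit_symbol (u ! j) else 0)" for j
  note step = option_of_step[OF wf_conf conf_step[symmetric] co_def]
  have sym: "cell (?c r) n i j < tm_symbols M" if "i < k" for r n i j
    using wf_conf[of "pre @ u" "Suc r"] that by (simp add: wf_config_def cell_def)
  have k: "0 < k" using wf by (auto simp: wf_tm_def)
  have next_cell: "cell (conf (pre @ u) r) r i j
      = (\<Sum>j'\<le>2 * Suc r. if j + snd (snd (cc r i j')) = j' then fst (snd (cc r i j')) else 0)"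
    if "r < T" "i < k" "j \<le> 2 * r" for r i j
  proof -
    have "j + ?mv r i \<le> 2 * Suc r" using step(6)[OF that(1,2)] that(3) by simp
    then have "(\<Sum>j'\<le>2 * Suc r. if j + snd (snd (cc r i j')) = j' then fst (snd (cc r i j')) else 0)
        = fst (snd (cc r i (j + ?mv r i)))"
      by (intro sum_moved) (auto simp: cc_def)
    also have "\<dots> = cell (conf (pre @ u) r) r i j"
      using step(7)[OF that(1,2), of r j] by (simp add: cc_def)
    finally show ?thesis ..
  qed
  have start: "cell (?c T') T i j = start_symbol i j + guess_symbol cg i j" if "i < k" for i j
    unfolding conf_T cell_init[OF that] start_symbol_def guess_symbol_def
    using u by (auto simp: cg_def nth_append)
  have "csp co cc cg"
    unfolding csp_def
  proof (intro conjI allI impI)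
    fix r assume r: "r < T"
    show "co r \<in> set (tm_opts M)" by (rule step(1)[OF r])
    show "fst (co r) = (if r = T' then 0 else fst (snd (co (Suc r))))"
    proof (cases "r = T'")
      case True
      then show ?thesis using step(2)[OF r] by (simp add: conf_T init_config_def)
    next
      case False
      then have "Suc r < T" using r by simp
      then show ?thesis using step(2)[OF r] step(3)[OF \<open>Suc r < T\<close>] False by simp
    qed
    fix i assume i: "i < k"
    show "fst (cc r i (Suc r)) = fst (snd (snd (co r)) ! i)"
      using step(4)[OF r i] by (simp add: cc_def)
    show "fst (snd (cc r i (Suc r))) = fst (snd (snd (snd (co r)) ! i))"
      by (simp add: cc_def)
    fix j assume j: "j \<le> 2 * Suc r"
    show "cc r i j \<in> set (cell_opts M)"
      using sym[OF i] step(5)[OF r i] step(6)[OF r i] by (simp add: cell_opts_def cc_def)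
    show "j = Suc r \<or> fst (snd (cc r i j)) = fst (cc r i j)" by (simp add: cc_def)
    show "snd (snd (cc r i j)) = snd (snd (snd (snd (co r)) ! i))" by (simp add: cc_def)
    show "fst (cc r i j) =
        (if r = T' then start_symbol i j + guess_symbol cg i j
         else \<Sum>j'\<le>2 * Suc (Suc r). if j + snd (snd (cc (Suc r) i j')) = j'
           then fst (snd (cc (Suc r) i j')) else 0)"
    proof (cases "r = T'")
      case True
      then show ?thesis using start[OF i] by (simp add: cc_def)
    next
      case False
      then have "Suc r < T" using r by simp
      from next_cell[OF this i j] False show ?thesis by (simp add: cc_def)
    qed
  next
    fix j assume "j < U"
    show "cg j \<in> set guess_opts" by (auto simp: cg_def guess_opts_def bit_symbol_def)
    show "fst (cg j) = (if j = 0 then 0 else fst (snd (cg (j - 1))))" by (auto simp: cg_def)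
  next
    show "(\<Sum>j\<le>2. if snd (snd (cc 0 0 j)) = j then fst (snd (cc 0 0 j)) else 0) = 2"
      using next_cell[of 0 0 0] k acc by simp
  qed
  then show ?thesis by blast
qed

text \<open>The guesses spell out a word \<open>u\<close>. From the first step on, the chosen
  options then agree with the run on \<open>pre @ u\<close>: an option is determined by its state
  and the scanned symbols, and it fixes the contents of the next, smaller window.\<close>

lemma csp_sound:
  assumes "csp co cc cg"
  shows "\<exists>u. length u \<le> U \<and> cell (conf (pre @ u) 0) 0 0 0 = 2"
proof -
  have co: "\<forall>r<T. co r \<in> set (tm_opts M)"
    and cc: "\<forall>r<T. \<forall>i<k. \<forall>j\<le>2 * Suc r. cc r i j \<in> set (cell_opts M) \<and>
        (j = Suc r \<or> fst (snd (cc r i j)) = fst (cc r i j))"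
    and cg: "\<forall>j<U. cg j \<in> set guess_opts"
    and state: "\<forall>r<T. fst (co r) = (if r = T' then 0 else fst (snd (co (Suc r))))"
    and mv: "\<forall>r<T. \<forall>i<k. \<forall>j\<le>2 * Suc r. snd (snd (cc r i j)) = snd (snd (snd (snd (co r)) ! i))"
    and rd: "\<forall>r<T. \<forall>i<k. fst (cc r i (Suc r)) = fst (snd (snd (co r)) ! i)"
    and wr: "\<forall>r<T. \<forall>i<k. fst (snd (cc r i (Suc r))) = fst (snd (snd (snd (co r)) ! i))"
    and cnt: "\<forall>r<T. \<forall>i<k. \<forall>j\<le>2 * Suc r. fst (cc r i j) =
        (if r = T' then start_symbol i j + guess_symbol cg i j
         else \<Sum>j'\<le>2 * Suc (Suc r). if j + snd (snd (cc (Suc r) i j')) = j'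
           then fst (snd (cc (Suc r) i j')) else 0)"
    and link: "\<forall>j<U. fst (cg j) = (if j = 0 then 0 else fst (snd (cg (j - 1))))"
    and acc: "(\<Sum>j\<le>2. if snd (snd (cc 0 0 j)) = j then fst (snd (cc 0 0 j)) else 0) = 2"
    using assms unfolding csp_def by - (elim conjE, assumption)+
  note co = co[rule_format] and cc = cc[rule_format] and cg = cg[rule_format]
    and state = state[rule_format] and mv = mv[rule_format] and rd = rd[rule_format]
    and wr = wr[rule_format] and cnt = cnt[rule_format] and link = link[rule_format]
  have k: "0 < k" using wf by (auto simp: wf_tm_def)
  \<comment> \<open>The first \<open>n\<close> guesses write a word followed by blanks, and the
    state after them tells whether a blank has been written.\<close>
  have "\<exists>u. length u \<le> n \<and> (\<forall>j<n. snd (snd (cg j)) = (if j < length u then bit_symbol (u ! j) else 0)) \<and>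
      (n > 0 \<longrightarrow> fst (snd (cg (n - 1))) = of_bool (length u < n))" if "n \<le> U" for n
    using that
  proof (induction n)
    case (Suc n)
    then obtain u where u: "length u \<le> n"
        "\<And>j. j < n \<Longrightarrow> snd (snd (cg j)) = (if j < length u then bit_symbol (u ! j) else 0)"
        "n > 0 \<Longrightarrow> fst (snd (cg (n - 1))) = of_bool (length u < n)"
      by auto
    have n: "n < U" using Suc.prems by simp
    have first: "fst (cg n) = of_bool (length u < n)"
      using link[OF n] u by (cases "n = 0") auto
    show ?case
    proof (cases "cg n = (0, 0, 1) \<or> cg n = (0, 0, 2)")
      case True
      then have "length u = n" using first u(1) by auto
      let ?u = "u @ [cg n = (0, 0, 2)]"
      have "\<forall>j<Suc n. snd (snd (cg j)) = (if j < length ?u then bit_symbol (?u ! j) else 0)"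
        using u(2) True \<open>length u = n\<close> by (auto simp: less_Suc_eq nth_append bit_symbol_def)
      then show ?thesis using True \<open>length u = n\<close> by (intro exI[of _ ?u]) auto
    next
      case False
      then have "cg n = (0, 1, 0) \<or> cg n = (1, 1, 0)"
        using cg[OF n] by (auto simp: guess_opts_def)
      then show ?thesis
        using u by (intro exI[of _ u]) (auto simp: less_Suc_eq)
    qed
  qed simp
  from this[of U] obtain u where u: "length u \<le> U"
    "\<And>j. j < U \<Longrightarrow> snd (snd (cg j)) = (if j < length u then bit_symbol (u ! j) else 0)" by auto
  let ?c = "\<lambda>r. conf (pre @ u) r"
  have start: "cell (init_config M (pre @ u)) T i j = start_symbol i j + guess_symbol cg i j"
    if "i < k" for i j
  proof -
    have "guess_symbol cg i j = (if i = 0 \<and> T + length pre \<le> j \<and> j < T + length pre + length u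
      then bit_symbol (u ! (j - (T + length pre))) else 0)"
      using u by (auto simp: guess_symbol_def)
    then show ?thesis
      unfolding cell_init[OF that] start_symbol_def by (auto simp: nth_append)
  qed
  let ?P = "\<lambda>r. fst (co r) = fst (?c (Suc r)) \<and>
      (\<forall>i<k. \<forall>j\<le>2 * Suc r. fst (cc r i j) = cell (?c (Suc r)) (Suc r) i j)"
    have nxt: "fst (snd (co r)) = fst (?c r) \<and>
        (\<forall>i<k. \<forall>j\<le>2 * r. (\<Sum>j'\<le>2 * Suc r. if j + snd (snd (cc r i j')) = j'
           then fst (snd (cc r i j')) else 0) = cell (?c r) r i j)"
      if P: "?P r" and r: "r < T" for r
    proof -
      have len: "length (snd (?c (Suc r))) = k" using wf_conf by (auto simp: wf_config_def)
      have "fst (snd (snd (co r)) ! i) = read_tape (snd (?c (Suc r)) ! i)" if i: "i < k" for i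
      proof -
        have "fst (snd (snd (co r)) ! i) = cell (?c (Suc r)) (Suc r) i (Suc r)"
          using rd[OF r i] P i by simp
        also have "\<dots> = read_tape (snd (?c (Suc r)) ! i)"
          using read_tape_cell[of i "snd (?c (Suc r))" "fst (?c (Suc r))" "Suc r"] len i by simp
        finally show ?thesis .
      qed
      then have "co r = option_of M (fst (?c (Suc r))) (map read_tape (snd (?c (Suc r))))"
        using P len by (intro tm_opts_unique[OF co[OF r]]) auto
      note step = option_of_step[OF wf_conf conf_step[OF r, symmetric] this]
      have "(\<Sum>j'\<le>2 * Suc r. if j + snd (snd (cc r i j')) = j' then fst (snd (cc r i j')) else 0)
          = cell (?c r) r i j" if i: "i < k" and j: "j \<le> 2 * r" for i j
      proof -
        let ?d = "snd (snd (snd (snd (co r)) ! i))"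
        have d: "j + ?d \<le> 2 * Suc r" using step(6)[OF i] j by simp
        have "(\<Sum>j'\<le>2 * Suc r. if j + snd (snd (cc r i j')) = j' then fst (snd (cc r i j')) else 0)
            = fst (snd (cc r i (j + ?d)))"
          using mv[OF r i] d by (intro sum_moved) auto
        also have "\<dots> = cell (?c r) r i j"
          using wr[OF r i] cc[OF r i d] P i d step(7)[OF i, of r j] by auto
        finally show ?thesis .
      qed
      then show ?thesis using step(3) by simp
    qed
    \<comment> \<open>Slots count the remaining steps: the run begins with slot \<open>T'\<close>,
      and the induction descends from there.\<close>
    have matches: "?P r" if "r < T" for r
      using that
    proof (induction "T' - r" arbitrary: r)
      case 0
      then have r: "r = T'" by simp
      have "fst (co T') = fst (?c T)" using state[of T'] by (simp add: conf_T init_config_def)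
      moreover have "fst (cc T' i j) = cell (?c T) T i j" if "i < k" "j \<le> 2 * T" for i j
        using cnt[OF _ that] start[OF that(1)] by (simp add: conf_T)
      ultimately show ?case unfolding r by blast
    next
      case (Suc n)
      then have r: "Suc r < T" "r \<noteq> T'" by simp_all
      have "?P (Suc r)" using Suc r by (intro Suc.hyps(1)) simp_all
      note n = nxt[OF this r(1)]
      have "fst (co r) = fst (?c (Suc r))" using state[of r] r n by simp
      moreover have "fst (cc r i j) = cell (?c (Suc r)) (Suc r) i j" if "i < k" "j \<le> 2 * Suc r" for i j
        using cnt[OF _ that] r n that by simp
      ultimately show ?case by blast
    qed
  from nxt[OF matches, of 0] k acc have "cell (?c 0) 0 0 0 = 2" by simp
  with u(1) show ?thesis by blast
qed

end

section \<open>The constraint satisfaction problem as a vector sum\<close>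

text \<open>A kind with up to three indices. Kind 3 links the states of successive steps; 4 links
  the content of a cell with the preceding step or the initial tape; 5 compares the move in a cell
  with the move of its tape; 6 and 7 compare the scanned cell with the symbols read and written; 8
  links the states of the guessing automaton; 9 is acceptance.\<close>

type_synonym blk = "nat \<times> nat \<times> nat \<times> nat"

text \<open>The number \<open>n\<close> is given in binary. Filtering the constant list
  \<open>[0..<A]\<close> repeats the block without a loop whose length depends on
  \<open>n\<close>.\<close>

definition times_upto :: "nat \<Rightarrow> nat \<Rightarrow> 'b \<Rightarrow> 'b list" where
  "times_upto A n b = map (\<lambda>_. b) (filter (\<lambda>v. v < n) [0..<A])"

definition times_from :: "nat \<Rightarrow> nat \<Rightarrow> 'b \<Rightarrow> 'b list" where
  "times_from A n b = map (\<lambda>_. b) (filter (\<lambda>v. n \<le> v) [0..<A])"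

lemma count_list_const: "count_list (map (\<lambda>_. b) l) c = (if b = c then length l else 0)"
  by (induction l) auto

lemma count_times_upto [simp]:
  "count_list (times_upto A n b) c = (if b = c then min n A else 0)"
proof -
  have "card {i. i < A \<and> i < n} = min n A"
    by (rule card_Collect_less_nat[of "min n A", THEN back_subst[of "\<lambda>x. x = min n A"]])
      (auto intro!: arg_cong[of _ _ card])
  then show ?thesis
    by (simp add: times_upto_def count_list_const length_filter_conv_card cong: conj_cong)
qed

lemma count_times_from [simp]:
  "count_list (times_from A n b) c = (if b = c then A - n else 0)"
proof -
  have "{i. i < A \<and> n \<le> i} = {n..<A}" by auto
  then have "card {i. i < A \<and> n \<le> i} = A - n" by simp
  then show ?thesis
    by (simp add: times_from_def count_list_const length_filter_conv_card cong: conj_cong)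
qed

text \<open>
  Blocks of kind 0, 1, 2 are the unit blocks of the slots. The other kinds express the equations of
  \<^term>\<open>tableau.csp\<close>: an equation \<open>x = y\<close> with \<open>x \<le> A\<close> becomes \<open>(A - x) + y = A\<close>.
\<close>

definition step_con :: "nat \<Rightarrow> nat list \<Rightarrow> nat list \<Rightarrow> nat \<Rightarrow> step_option \<Rightarrow> blk list" where
  "step_con A rs js r opt = (0, r, 0, 0) # times_from A (fst opt) (3, r, 0, 0) @
     concat (map (\<lambda>r'. if Suc r' = r then times_upto A (fst (snd opt)) (3, r', 0, 0) else []) rs) @
     concat (map (\<lambda>e. times_upto A (fst (snd e)) (6, r, fst e, 0) @
         times_upto A (fst (snd (snd e))) (7, r, fst e, 0) @
         concat (map (\<lambda>j. times_upto A (snd (snd (snd e))) (5, r, fst e, j)) js))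
       (zip [0..<length (snd (snd opt))] (snd (snd opt))))"

text \<open>The closure rules provide addition but no subtraction. The slot of the following step
  and the place to which the content moves are therefore found by searching \<open>rs\<close> and
  \<open>js\<close>.\<close>

definition cell_con :: "nat \<Rightarrow> nat list \<Rightarrow> nat list \<Rightarrow> nat \<Rightarrow> nat \<Rightarrow> nat \<Rightarrow> nat \<times> nat \<times> nat \<Rightarrow> blk list" where
  "cell_con A rs js r i j e = (1, r, i, j) # times_from A (fst e) (4, r, i, j) @
     times_from A (snd (snd e)) (5, r, i, j) @
     (if j = Suc r then times_from A (fst e) (6, r, i, 0) @ times_from A (fst (snd e)) (7, r, i, 0)
      else []) @
     concat (map (\<lambda>r'. if Suc r' = r then concat (map (\<lambda>j'. if j' + snd (snd e) = j
       then times_upto A (fst (snd e)) (4, r', i, j') else []) js) else []) rs) @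
     (if r = 0 \<and> i = 0 \<and> snd (snd e) = j then times_upto A (fst (snd e)) (9, 0, 0, 0) else [])"

text \<open>The last guess contributes to a block of kind 8 that is not among the blocks of
  \<open>tm_blocks\<close>; \<open>vector_sum\<close> ignores it, so the final state of the
  automaton is free.\<close>

definition guess_con :: "nat \<Rightarrow> nat \<Rightarrow> nat \<Rightarrow> nat \<Rightarrow> nat \<times> nat \<times> nat \<Rightarrow> blk list" where
  "guess_con A t off j e = (2, j, 0, 0) # times_from A (fst e) (8, j, 0, 0) @
     times_upto A (fst (snd e)) (8, Suc j, 0, 0) @ times_upto A (snd (snd e)) (4, t, 0, off + j)"

definition cells :: "nat \<Rightarrow> nat list \<Rightarrow> nat list \<Rightarrow> (nat \<times> nat \<times> nat) list" where
  "cells k rs js = filter (\<lambda>p. snd (snd p) \<le> Suc (fst p) + Suc (fst p))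
     (List.product rs (List.product [0..<k] js))"

definition cell_choices :: "tm \<Rightarrow> nat list \<Rightarrow> nat list \<Rightarrow> ((nat \<times> nat \<times> nat) \<times> (nat \<times> nat \<times> nat)) list" where
  "cell_choices M rs js =
     filter (\<lambda>p. snd (snd (fst p)) = Suc (fst (fst p)) \<or> fst (snd (snd p)) = fst (snd p))
       (List.product (cells (tm_tapes M) rs js) (cell_opts M))"

text \<open>One constant bounds all values that are to be compared: states, symbols and the codes of
  moves and guesses, which are at most 2.\<close>

definition tm_bound :: "tm \<Rightarrow> nat" where
  "tm_bound M = tm_states M + tm_symbols M + 3"

definition tm_items :: "tm \<Rightarrow> nat list \<Rightarrow> nat list \<Rightarrow> nat list \<Rightarrow> nat \<Rightarrow> nat \<Rightarrow> blk list list" where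
  "tm_items M rs js us t off =
     map (\<lambda>p. step_con (tm_bound M) rs js (fst p) (snd p)) (List.product rs (tm_opts M)) @
     map (\<lambda>p. cell_con (tm_bound M) rs js (fst (fst p)) (fst (snd (fst p))) (snd (snd (fst p))) (snd p))
       (cell_choices M rs js) @
     map (\<lambda>p. guess_con (tm_bound M) t off (fst p) (snd p)) (List.product us guess_opts)"

definition tm_blocks :: "tm \<Rightarrow> nat list \<Rightarrow> nat list \<Rightarrow> nat list \<Rightarrow> blk list" where
  "tm_blocks M rs js us = (let cs = cells (tm_tapes M) rs js; ts = List.product rs [0..<tm_tapes M] in
     map (\<lambda>r. (0, r, 0, 0)) rs @ map (Pair 1) cs @ map (\<lambda>j. (2, j, 0, 0)) us @
     map (\<lambda>r. (3, r, 0, 0)) rs @ map (Pair 4) cs @ map (Pair 5) cs @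
     map (\<lambda>p. (6, fst p, snd p, 0)) ts @ map (\<lambda>p. (7, fst p, snd p, 0)) ts @
     map (\<lambda>j. (8, j, 0, 0)) us @ [(9, 0, 0, 0)])"

text \<open>A computable form of \<open>start_symbol\<close>: one blank for each element of
  \<open>rs\<close> is put before the word, instead of subtracting the position of the head from the
  index.\<close>

definition init_symbol :: "nat list \<Rightarrow> bool list \<Rightarrow> nat \<Rightarrow> nat \<times> nat \<times> nat \<Rightarrow> nat" where
  "init_symbol rs pre t p = (if fst p = t \<and> fst (snd p) = 0
     then nth_default 0 (map (\<lambda>_. 0) rs @ map bit_symbol pre) (snd (snd p)) else 0)"

text \<open>In the first step, the known symbol \<open>c\<close> of a cell is a constant of its
  equation: \<open>(A - x) + y + c = A\<close> has the target \<open>A - c\<close>, where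
  \<open>y\<close> is the guessed symbol. The final 2 is the tape symbol of
  \<open>True\<close>.\<close>

definition tm_target :: "tm \<Rightarrow> nat list \<Rightarrow> nat list \<Rightarrow> nat list \<Rightarrow> bool list \<Rightarrow> nat \<Rightarrow> blk list" where
  "tm_target M rs js us pre t = (let A = tm_bound M; cs = cells (tm_tapes M) rs js;
      ts = List.product rs [0..<tm_tapes M] in
     map (\<lambda>r. (0, r, 0, 0)) rs @ map (Pair 1) cs @ map (\<lambda>j. (2, j, 0, 0)) us @
     concat (map (\<lambda>r. times_upto A A (3, r, 0, 0)) rs) @
     concat (map (\<lambda>p. times_from A (init_symbol rs pre t p) (4, p)) cs) @
     concat (map (\<lambda>p. times_upto A A (5, p)) cs) @
     concat (map (\<lambda>p. times_upto A A (6, fst p, snd p, 0)) ts) @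
     concat (map (\<lambda>p. times_upto A A (7, fst p, snd p, 0)) ts) @
     concat (map (\<lambda>j. times_upto A A (8, j, 0, 0)) us) @
     times_upto A 2 (9, 0, 0, 0))"

section \<open>Multiplicities of blocks\<close>

lemma count_concat_single:
  assumes "distinct xs" "x \<in> set xs" "\<And>y. y \<in> set xs \<Longrightarrow> y \<noteq> x \<Longrightarrow> count_list (g y) b = 0"
  shows "count_list (concat (map g xs)) b = count_list (g x) b"
  using assms
proof (induction xs)
  case (Cons y ys)
  have zero: "count_list (concat (map g zs)) b = 0" if "\<And>z. z \<in> set zs \<Longrightarrow> count_list (g z) b = 0" for zs
    using that by (induction zs) auto
  show ?case
  proof (cases "y = x")
    case True
    then have "count_list (concat (map g ys)) b = 0" using Cons.prems by (intro zero) auto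
    with True show ?thesis by simp
  next
    case False
    with Cons show ?thesis by simp
  qed
qed simp

lemma count_concat_zero:
  assumes "\<And>y. y \<in> set xs \<Longrightarrow> count_list (g y) b = 0"
  shows "count_list (concat (map g xs)) b = 0"
  using assms by (induction xs) auto

lemma count_map_inj:
  assumes "distinct xs" "inj_on f (set xs)"
  shows "count_list (map f xs) b = (if b \<in> f ` set xs then 1 else 0)"
  using assms by (induction xs) auto

lemma sum_single:
  assumes "finite F" "\<And>x. x \<in> F \<Longrightarrow> x \<noteq> y \<Longrightarrow> f x = 0"
  shows "sum f F = (if y \<in> F then f y else (0 :: nat))"
proof -
  have "sum f F = (\<Sum>x\<in>F. if x = y then f y else 0)"
    using assms(2) by (intro sum.cong) auto
  then show ?thesis using assms(1) by simp
qed

lemma count_step_con: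
  fixes opt :: step_option
  assumes "fst opt \<le> A" "fst (snd opt) \<le> A"
    "\<And>e. e \<in> set (snd (snd opt)) \<Longrightarrow> fst e \<le> A \<and> fst (snd e) \<le> A \<and> snd (snd e) \<le> A"
  shows "count_list (step_con A [0..<t] js r opt) (0, p) = (if p = (r, 0, 0) then 1 else 0)"
    "count_list (step_con A [0..<t] js r opt) (1, p) = 0"
    "count_list (step_con A [0..<t] js r opt) (2, p) = 0"
    "r' < t \<Longrightarrow> count_list (step_con A [0..<t] js r opt) (3, r', 0, 0)
      = (if r = r' then A - fst opt else 0) + (if r = Suc r' then fst (snd opt) else 0)"
    "count_list (step_con A [0..<t] js r opt) (4, p) = 0"
    "i < length (snd (snd opt)) \<Longrightarrow> j \<in> set js \<Longrightarrow> distinct js \<Longrightarrow>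
      count_list (step_con A [0..<t] js r opt) (5, r', i, j)
      = (if r = r' then snd (snd (snd (snd opt) ! i)) else 0)"
    "i < length (snd (snd opt)) \<Longrightarrow> count_list (step_con A [0..<t] js r opt) (6, r', i, 0)
      = (if r = r' then fst (snd (snd opt) ! i) else 0)"
    "i < length (snd (snd opt)) \<Longrightarrow> count_list (step_con A [0..<t] js r opt) (7, r', i, 0)
      = (if r = r' then fst (snd (snd (snd opt) ! i)) else 0)"
    "count_list (step_con A [0..<t] js r opt) (8, p) = 0"
    "count_list (step_con A [0..<t] js r opt) (9, p) = 0"
proof -
  let ?as = "snd (snd opt)"
  let ?f = "\<lambda>r'. if Suc r' = r then times_upto A (fst (snd opt)) (3 :: nat, r', 0 :: nat, 0 :: nat) else []"
  let ?h = "\<lambda>e j. times_upto A (snd (snd (snd e))) (5 :: nat, r, fst e, j)"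
  define H :: "nat \<times> nat \<times> nat \<times> nat \<Rightarrow> blk list" where "H e = concat (map (?h e) js)" for e
  let ?g = "\<lambda>e. times_upto A (fst (snd e)) (6 :: nat, r, fst e, 0) @
    times_upto A (fst (snd (snd e))) (7 :: nat, r, fst e, 0) @ H e"
  let ?z = "zip [0..<length ?as] ?as"
  define F where "F = concat (map ?f [0..<t])"
  define G where "G = concat (map ?g ?z)"
  have f0: "count_list F (c, p) = 0" if "c \<noteq> 3" for c :: nat and p
    unfolding F_def using that by (intro count_concat_zero) auto
  have f3: "count_list F (3, r', 0, 0) = (if r = Suc r' then fst (snd opt) else 0)"
    if "r' < t" for r'
    unfolding F_def using that assms(2) by (subst count_concat_single[of _ r']) auto
  have h0: "count_list (H e) (c, p) = 0" if "c \<noteq> 5 \<or> fst (snd p) \<noteq> fst e" for e and c :: nat and p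
    unfolding H_def using that by (intro count_concat_zero) auto
  have g0: "count_list G (c, p) = 0" if "c \<notin> {5, 6, 7}" for c :: nat and p
    unfolding G_def using that h0[of c p] by (intro count_concat_zero) auto
  have "distinct ?z" by (simp add: distinct_zipI1)
  have mem: "(i, ?as ! i) \<in> set ?z" if "i < length ?as" for i
    using that by (auto simp: in_set_zip intro!: exI[of _ i])
  have fst_z: "e = (i, ?as ! i)" if "e \<in> set ?z" "fst e = i" for e i
  proof -
    from that(1)[unfolded in_set_conv_nth] obtain n where "n < length ?z" "?z ! n = e" by (elim exE conjE)
    then have "n < length ?as" "e = ?z ! n" by simp_all
    moreover from this(1) have "?z ! n = (n, ?as ! n)" by simp
    ultimately show ?thesis using that(2) by (simp only: fst_conv)
  qed
  have g: "count_list G (c, r', i, j) = count_list (?g (i, ?as ! i)) (c, r', i, j)"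
    if "i < length ?as" for c :: nat and r' i j
    unfolding G_def
  proof (rule count_concat_single)
    fix e assume "e \<in> set ?z" "e \<noteq> (i, ?as ! i)"
    then have "fst e \<noteq> i" using fst_z by blast
    then show "count_list (?g e) (c, r', i, j) = 0" using h0[of c "(r', i, j)" e] by simp
  qed (use that mem \<open>distinct ?z\<close> in auto)
  have h: "count_list (H (i, ?as ! i)) (5, r', i, j)
      = (if r = r' then snd (snd (?as ! i)) else 0)"
    if "i < length ?as" "j \<in> set js" "distinct js" for i j r'
    unfolding H_def using that assms(3)[OF nth_mem[OF that(1)]] by (subst count_concat_single[of _ j]) auto
  have con: "step_con A [0..<t] js r opt = (0, r, 0, 0) # times_from A (fst opt) (3, r, 0, 0) @ F @ G"
    by (simp only: step_con_def F_def G_def H_def)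
  note defs = con count_list_append
  show "count_list (step_con A [0..<t] js r opt) (0, p) = (if p = (r, 0, 0) then 1 else 0)"
    using f0[of 0 p] g0[of 0 p] by (auto simp: defs)
  show "count_list (step_con A [0..<t] js r opt) (1, p) = 0"
    "count_list (step_con A [0..<t] js r opt) (2, p) = 0"
    "count_list (step_con A [0..<t] js r opt) (4, p) = 0"
    "count_list (step_con A [0..<t] js r opt) (8, p) = 0"
    "count_list (step_con A [0..<t] js r opt) (9, p) = 0"
    using f0[of 1 p] g0[of 1 p] f0[of 2 p] g0[of 2 p] f0[of 4 p] g0[of 4 p] f0[of 8 p] g0[of 8 p]
      f0[of 9 p] g0[of 9 p] by (simp_all add: defs)
  show "count_list (step_con A [0..<t] js r opt) (3, r', 0, 0)
      = (if r = r' then A - fst opt else 0) + (if r = Suc r' then fst (snd opt) else 0)" if "r' < t"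
    using f3[OF that] g0[of 3 "(r', 0, 0)"] by (simp add: defs)
  show "count_list (step_con A [0..<t] js r opt) (5, r', i, j)
      = (if r = r' then snd (snd (?as ! i)) else 0)" if "i < length ?as" "j \<in> set js" "distinct js"
    using f0[of 5 "(r', i, j)"] g[OF that(1), of 5 r' j] h[OF that] by (simp add: defs)
  show "count_list (step_con A [0..<t] js r opt) (6, r', i, 0)
      = (if r = r' then fst (?as ! i) else 0)" if "i < length ?as"
    using f0[of 6 "(r', i, 0)"] g[OF that, of 6 r' 0] h0[of 6 "(r', i, 0)"] assms(3)[OF nth_mem[OF that]]
    by (simp add: defs)
  show "count_list (step_con A [0..<t] js r opt) (7, r', i, 0)
      = (if r = r' then fst (snd (?as ! i)) else 0)" if "i < length ?as"
    using f0[of 7 "(r', i, 0)"] g[OF that, of 7 r' 0] h0[of 7 "(r', i, 0)"] assms(3)[OF nth_mem[OF that]]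
    by (simp add: defs)
qed

lemma count_cell_con:
  fixes e :: "nat \<times> nat \<times> nat"
  assumes "fst (snd e) \<le> A"
  shows "count_list (cell_con A [0..<t] [0..<l] r i j e) (0, p) = 0"
    "count_list (cell_con A [0..<t] [0..<l] r i j e) (1, p) = (if p = (r, i, j) then 1 else 0)"
    "count_list (cell_con A [0..<t] [0..<l] r i j e) (2, p) = 0"
    "count_list (cell_con A [0..<t] [0..<l] r i j e) (3, p) = 0"
    "r' < t \<Longrightarrow> j' < l \<Longrightarrow> count_list (cell_con A [0..<t] [0..<l] r i j e) (4, r', i', j')
      = (if (r, i, j) = (r', i', j') then A - fst e else 0) +
        (if r = Suc r' \<and> i = i' \<and> j' + snd (snd e) = j then fst (snd e) else 0)"
    "count_list (cell_con A [0..<t] [0..<l] r i j e) (5, p) = (if p = (r, i, j) then A - snd (snd e) else 0)"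
    "count_list (cell_con A [0..<t] [0..<l] r i j e) (6, r', i', 0)
      = (if (r, i, j) = (r', i', Suc r') then A - fst e else 0)"
    "count_list (cell_con A [0..<t] [0..<l] r i j e) (7, r', i', 0)
      = (if (r, i, j) = (r', i', Suc r') then A - fst (snd e) else 0)"
    "count_list (cell_con A [0..<t] [0..<l] r i j e) (8, p) = 0"
    "count_list (cell_con A [0..<t] [0..<l] r i j e) (9, 0, 0, 0)
      = (if r = 0 \<and> i = 0 \<and> snd (snd e) = j then fst (snd e) else 0)"
proof -
  let ?h = "\<lambda>r' j'. if j' + snd (snd e) = j then times_upto A (fst (snd e)) (4 :: nat, r', i, j') else []"
  define H :: "nat \<Rightarrow> blk list" where "H r' = concat (map (?h r') [0..<l])" for r'
  let ?f = "\<lambda>r'. if Suc r' = r then H r' else []"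
  define F where "F = concat (map ?f [0..<t])"
  have h0: "count_list (H r') (c, p) = 0" if "c \<noteq> 4 \<or> fst p \<noteq> r' \<or> fst (snd p) \<noteq> i"
    for r' and c :: nat and p
    unfolding H_def using that by (intro count_concat_zero) auto
  have h: "count_list (H r') (4, r', i, j')
      = (if j' + snd (snd e) = j then fst (snd e) else 0)" if "j' < l" for r' j'
    unfolding H_def using that assms by (subst count_concat_single[of _ j']) auto
  have f0: "count_list F (c, p) = 0" if "c \<noteq> 4 \<or> fst (snd p) \<noteq> i" for c :: nat and p
    unfolding F_def using that h0[of c p] by (intro count_concat_zero) auto
  have f: "count_list F (4, r', i, j')
      = (if r = Suc r' \<and> j' + snd (snd e) = j then fst (snd e) else 0)" if "r' < t" "j' < l" for r' j'
    unfolding F_def using that h[OF that(2)] h0[of 4 "(r', i, j')"] by (subst count_concat_single[of _ r']) auto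
  have con: "cell_con A [0..<t] [0..<l] r i j e = (1, r, i, j) # times_from A (fst e) (4, r, i, j) @
      times_from A (snd (snd e)) (5, r, i, j) @
      (if j = Suc r then times_from A (fst e) (6, r, i, 0) @ times_from A (fst (snd e)) (7, r, i, 0)
       else []) @ F @
      (if r = 0 \<and> i = 0 \<and> snd (snd e) = j then times_upto A (fst (snd e)) (9, 0, 0, 0) else [])"
    by (simp only: cell_con_def F_def H_def)
  note defs = con count_list_append
  show "count_list (cell_con A [0..<t] [0..<l] r i j e) (0, p) = 0" using f0[of 0 p] by (simp add: defs)
  show "count_list (cell_con A [0..<t] [0..<l] r i j e) (2, p) = 0" using f0[of 2 p] by (simp add: defs)
  show "count_list (cell_con A [0..<t] [0..<l] r i j e) (3, p) = 0" using f0[of 3 p] by (simp add: defs)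
  show "count_list (cell_con A [0..<t] [0..<l] r i j e) (8, p) = 0" using f0[of 8 p] by (simp add: defs)
  show "count_list (cell_con A [0..<t] [0..<l] r i j e) (1, p) = (if p = (r, i, j) then 1 else 0)"
    using f0[of 1 p] by (auto simp add: defs)
  show "count_list (cell_con A [0..<t] [0..<l] r i j e) (5, p) = (if p = (r, i, j) then A - snd (snd e) else 0)"
    using f0[of 5 p] by (auto simp add: defs)
  show "count_list (cell_con A [0..<t] [0..<l] r i j e) (6, r', i', 0)
      = (if (r, i, j) = (r', i', Suc r') then A - fst e else 0)"
    using f0[of 6 "(r', i', 0)"] by (auto simp add: defs)
  show "count_list (cell_con A [0..<t] [0..<l] r i j e) (7, r', i', 0)
      = (if (r, i, j) = (r', i', Suc r') then A - fst (snd e) else 0)"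
    using f0[of 7 "(r', i', 0)"] by (auto simp add: defs)
  show "count_list (cell_con A [0..<t] [0..<l] r i j e) (9, 0, 0, 0)
      = (if r = 0 \<and> i = 0 \<and> snd (snd e) = j then fst (snd e) else 0)"
    using f0[of 9 "(0, 0, 0)"] assms by (auto simp add: defs)
  show "count_list (cell_con A [0..<t] [0..<l] r i j e) (4, r', i', j')
      = (if (r, i, j) = (r', i', j') then A - fst e else 0) +
        (if r = Suc r' \<and> i = i' \<and> j' + snd (snd e) = j then fst (snd e) else 0)"
    if "r' < t" "j' < l"
    unfolding defs using f[OF that] f0[of 4 "(r', i', j')"] by (cases "i = i'") auto
qed

lemma count_guess_con:
  assumes "fst (snd e) \<le> A" "snd (snd e) \<le> A"
  shows "count_list (guess_con A t off j e) (0, p) = 0"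
    "count_list (guess_con A t off j e) (1, p) = 0"
    "count_list (guess_con A t off j e) (2, p) = (if p = (j, 0, 0) then 1 else 0)"
    "count_list (guess_con A t off j e) (3, p) = 0"
    "count_list (guess_con A t off j e) (4, r', i', j')
      = (if r' = t \<and> i' = 0 \<and> j' = off + j then snd (snd e) else 0)"
    "count_list (guess_con A t off j e) (5, p) = 0"
    "count_list (guess_con A t off j e) (6, p) = 0"
    "count_list (guess_con A t off j e) (7, p) = 0"
    "count_list (guess_con A t off j e) (8, j', 0, 0)
      = (if j = j' then A - fst e else 0) + (if j' = Suc j then fst (snd e) else 0)"
    "count_list (guess_con A t off j e) (9, p) = 0"
  using assms by (auto simp: guess_con_def)

declare upt_Suc [simp del] sum.atMost_Suc [simp del]

section \<open>Selections of options and their sums\<close>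

datatype choice = Step step_option | Cell "nat \<times> nat \<times> nat" | Guess "nat \<times> nat \<times> nat"

lemma option_bounds:
  assumes "wf_tm M" "opt \<in> set (tm_opts M)"
  shows "fst opt \<le> tm_bound M" "fst (snd opt) \<le> tm_bound M" "length (snd (snd opt)) = tm_tapes M"
    "\<And>e. e \<in> set (snd (snd opt)) \<Longrightarrow> fst e \<le> tm_bound M \<and> fst (snd e) \<le> tm_bound M \<and> snd (snd e) \<le> tm_bound M"
proof -
  obtain q ss where o: "opt = option_of M q ss" "q < tm_states M" "length ss = tm_tapes M"
    "set ss \<subseteq> {..<tm_symbols M}"
    using assms(2) by (auto simp: set_tm_opts)
  obtain q' as where s: "step_result M q ss = (q', as)" by fastforce
  have *: "q' < tm_states M" "length as = tm_tapes M" "fst ` set as \<subseteq> {..<tm_symbols M}"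
    using step_result_wf[OF assms(1) o(2-4) s] by auto
  have opt: "opt = (q, q', map2 (\<lambda>s a. (s, fst a, move_code (snd a))) ss as)"
    by (simp add: o(1) option_of_def s)
  show "fst opt \<le> tm_bound M" "fst (snd opt) \<le> tm_bound M" "length (snd (snd opt)) = tm_tapes M"
    using o(2-4) * unfolding opt by (simp_all add: tm_bound_def)
  show "fst e \<le> tm_bound M \<and> fst (snd e) \<le> tm_bound M \<and> snd (snd e) \<le> tm_bound M"
    if "e \<in> set (snd (snd opt))" for e
  proof -
    have "e \<in> (\<lambda>(s, a). (s, fst a, move_code (snd a))) ` set (zip ss as)"
      using that by (simp add: opt)
    then obtain z where "z \<in> set (zip ss as)" "e = (\<lambda>(s, a). (s, fst a, move_code (snd a))) z"
      by (elim imageE)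
    moreover obtain s a where "z = (s, a)" by (cases z)
    ultimately have sa: "e = (s, fst a, move_code (snd a))" "(s, a) \<in> set (zip ss as)" by simp_all
    then have "s \<in> set ss" "a \<in> set as" by (auto dest: set_zip_leftD set_zip_rightD)
    then have "s < tm_symbols M" "fst a < tm_symbols M" using o(4) *(3) by auto
    then show ?thesis using move_code_less[of "snd a"] by (simp add: sa(1) tm_bound_def)
  qed
qed

lemma choice_on:
  assumes "\<And>x. P x \<Longrightarrow> \<exists>y. Q x y"
  shows "\<exists>f. \<forall>x. P x \<longrightarrow> Q x (f x)"
  using assms by metis

text \<open>The name \<open>N\<close> for \<open>Suc T'\<close> keeps the simplifier from unfolding the range of the sums.\<close>

locale tableau_vectors = tableau +
  fixes N
  assumes N: "N = Suc T'"
begin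

abbreviation "A \<equiv> tm_bound M"
abbreviation "rs \<equiv> [0..<N]"
abbreviation "js \<equiv> [0..<Suc (2 * N)]"
abbreviation "us \<equiv> [0..<U]"
abbreviation "off \<equiv> N + length pre"
abbreviation "CS \<equiv> {(r, i, j). r < N \<and> i < k \<and> j \<le> 2 * Suc r}"

lemma set_cells: "set (cells k rs js) = CS"
  by (auto simp: cells_def)

lemma finite_CS: "finite CS"
  unfolding set_cells[symmetric] by simp

lemma distinct_cells: "distinct (cells k rs js)"
  unfolding cells_def by (intro distinct_filter distinct_product) auto

definition con :: "blk \<times> choice \<Rightarrow> blk list" where
  "con p = (case snd p of
     Step opt \<Rightarrow> step_con A rs js (fst (snd (fst p))) opt
   | Cell e \<Rightarrow> cell_con A rs js (fst (snd (fst p))) (fst (snd (snd (fst p)))) (snd (snd (snd (fst p)))) e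
   | Guess e \<Rightarrow> guess_con A T' off (fst (snd (fst p))) e)"

definition choices :: "(blk \<times> choice) list" where
  "choices =
     map (\<lambda>p. ((0, fst p, 0, 0), Step (snd p))) (List.product rs (tm_opts M)) @
     map (\<lambda>p. ((1, fst p), Cell (snd p))) (cell_choices M rs js) @
     map (\<lambda>p. ((2, fst p, 0, 0), Guess (snd p))) (List.product us guess_opts)"

lemma items_choices: "tm_items M rs js us T' off = map con choices"
  by (simp add: tm_items_def choices_def con_def)

lemma distinct_choices: "distinct choices"
proof -
  have "distinct (tm_opts M)" "distinct (cell_opts M)" "distinct guess_opts"
    by (simp_all add: tm_opts_def cell_opts_def distinct_product guess_opts_def)
  then have "distinct (List.product rs (tm_opts M))" "distinct (cell_choices M rs js)"
      "distinct (List.product us guess_opts)"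
    by (auto intro!: distinct_product distinct_filter simp: cell_choices_def distinct_cells)
  then show ?thesis
    unfolding choices_def by (auto simp: distinct_map inj_on_def)
qed

text \<open>A slot is identified with its unit block, so \<open>vector_sum_choice\<close> applies
  with the identity as \<open>unit_block\<close>.\<close>

definition slots :: "blk set" where
  "slots = (\<lambda>r. (0, r, 0, 0)) ` {..<N} \<union> Pair 1 ` CS \<union> (\<lambda>j. (2, j, 0, 0)) ` {..<U}"

definition members :: "(nat \<Rightarrow> step_option) \<Rightarrow> (nat \<times> nat \<times> nat \<Rightarrow> nat \<times> nat \<times> nat) \<Rightarrow>
    (nat \<Rightarrow> nat \<times> nat \<times> nat) \<Rightarrow> bool" where
  "members co cc cg \<longleftrightarrow> (\<forall>r<N. co r \<in> set (tm_opts M)) \<and>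
     (\<forall>p\<in>CS. cc p \<in> set (cell_opts M) \<and> (snd (snd p) = Suc (fst p) \<or> fst (snd (cc p)) = fst (cc p))) \<and>
     (\<forall>j<U. cg j \<in> set guess_opts)"

definition total :: "(nat \<Rightarrow> step_option) \<Rightarrow> (nat \<times> nat \<times> nat \<Rightarrow> nat \<times> nat \<times> nat) \<Rightarrow>
    (nat \<Rightarrow> nat \<times> nat \<times> nat) \<Rightarrow> blk \<Rightarrow> nat" where
  "total co cc cg b = (\<Sum>r<N. count_list (step_con A rs js r (co r)) b) +
     (\<Sum>p\<in>CS. count_list (cell_con A rs js (fst p) (fst (snd p)) (snd (snd p)) (cc p)) b) +
     (\<Sum>j<U. count_list (guess_con A T' off j (cg j)) b)"

abbreviation "target \<equiv> tm_target M rs js us pre T'"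

definition equations :: "blk set" where
  "equations = (\<lambda>r. (3, r, 0, 0)) ` {..<N} \<union> Pair 4 ` CS \<union> Pair 5 ` CS \<union>
     (\<lambda>p. (6, fst p, snd p, 0)) ` ({..<N} \<times> {..<k}) \<union> (\<lambda>p. (7, fst p, snd p, 0)) ` ({..<N} \<times> {..<k}) \<union>
     (\<lambda>j. (8, j, 0, 0)) ` {..<U} \<union> {(9, 0, 0, 0)}"

lemma set_blocks: "set (tm_blocks M rs js us) = slots \<union> equations"
  unfolding tm_blocks_def Let_def slots_def equations_def
  by (simp add: set_cells atLeast0LessThan Un_ac)

lemma count_target:
  "r < N \<Longrightarrow> count_list target (0, r, 0, 0) = 1"
  "p \<in> CS \<Longrightarrow> count_list target (1, p) = 1"
  "j < U \<Longrightarrow> count_list target (2, j, 0, 0) = 1"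
  "r < N \<Longrightarrow> count_list target (3, r, 0, 0) = A"
  "p \<in> CS \<Longrightarrow> count_list target (4, p) = A - init_symbol rs pre T' p"
  "p \<in> CS \<Longrightarrow> count_list target (5, p) = A"
  "r < N \<Longrightarrow> i < k \<Longrightarrow> count_list target (6, r, i, 0) = A"
  "r < N \<Longrightarrow> i < k \<Longrightarrow> count_list target (7, r, i, 0) = A"
  "j < U \<Longrightarrow> count_list target (8, j, 0, 0) = A"
  "count_list target (9, 0, 0, 0) = 2"
proof -
  let ?cs = "cells k rs js" and ?ts = "List.product rs [0..<k]"
  define S0 :: "blk list" where "S0 = map (\<lambda>r. (0, r, 0, 0)) rs"
  define S1 :: "blk list" where "S1 = map (Pair 1) ?cs"
  define S2 :: "blk list" where "S2 = map (\<lambda>j. (2, j, 0, 0)) us"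
  define S3 :: "blk list" where "S3 = concat (map (\<lambda>r. times_upto A A (3, r, 0, 0)) rs)"
  define S4 :: "blk list" where "S4 = concat (map (\<lambda>p. times_from A (init_symbol rs pre T' p) (4, p)) ?cs)"
  define S5 :: "blk list" where "S5 = concat (map (\<lambda>p. times_upto A A (5, p)) ?cs)"
  define S6 :: "blk list" where "S6 = concat (map (\<lambda>p. times_upto A A (6, fst p, snd p, 0)) ?ts)"
  define S7 :: "blk list" where "S7 = concat (map (\<lambda>p. times_upto A A (7, fst p, snd p, 0)) ?ts)"
  define S8 :: "blk list" where "S8 = concat (map (\<lambda>j. times_upto A A (8, j, 0, 0)) us)"
  have target: "target = S0 @ S1 @ S2 @ S3 @ S4 @ S5 @ S6 @ S7 @ S8 @ times_upto A 2 (9, 0, 0, 0)"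
    unfolding tm_target_def Let_def S0_def S1_def S2_def S3_def S4_def S5_def S6_def S7_def S8_def ..
  have zero: "count_list S0 (c, p) = 0" if "c \<noteq> 0" for c p using that by (auto simp: S0_def count_list_0_iff)
  have zero1: "count_list S1 (c, p) = 0" if "c \<noteq> 1" for c p using that by (auto simp: S1_def count_list_0_iff)
  have zero2: "count_list S2 (c, p) = 0" if "c \<noteq> 2" for c p using that by (auto simp: S2_def count_list_0_iff)
  have zero3: "count_list S3 (c, p) = 0" if "c \<noteq> 3" for c p
    unfolding S3_def using that by (intro count_concat_zero) auto
  have zero4: "count_list S4 (c, p) = 0" if "c \<noteq> 4" for c p
    unfolding S4_def using that by (intro count_concat_zero) auto
  have zero5: "count_list S5 (c, p) = 0" if "c \<noteq> 5" for c p
    unfolding S5_def using that by (intro count_concat_zero) auto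
  have zero6: "count_list S6 (c, p) = 0" if "c \<noteq> 6" for c p
    unfolding S6_def using that by (intro count_concat_zero) auto
  have zero7: "count_list S7 (c, p) = 0" if "c \<noteq> 7" for c p
    unfolding S7_def using that by (intro count_concat_zero) auto
  have zero8: "count_list S8 (c, p) = 0" if "c \<noteq> 8" for c p
    unfolding S8_def using that by (intro count_concat_zero) auto
  note zeros = zero zero1 zero2 zero3 zero4 zero5 zero6 zero7 zero8
  have dts: "distinct ?ts" by (simp add: distinct_product)
  have A2: "2 \<le> A" by (simp add: tm_bound_def)
  have "count_list S0 (0, r, 0, 0) = 1" if "r < N" for r
    unfolding S0_def using that by (subst count_map_inj) (auto simp: inj_on_def image_iff)
  then show "r < N \<Longrightarrow> count_list target (0, r, 0, 0) = 1" unfolding target by (simp add: zeros)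
  have "count_list S1 (1, p) = 1" if "p \<in> CS" for p
    unfolding S1_def using that distinct_cells set_cells by (subst count_map_inj) (auto simp: inj_on_def)
  then show "p \<in> CS \<Longrightarrow> count_list target (1, p) = 1" unfolding target by (simp add: zeros)
  have "count_list S2 (2, j, 0, 0) = 1" if "j < U" for j
    unfolding S2_def using that by (subst count_map_inj) (auto simp: inj_on_def image_iff)
  then show "j < U \<Longrightarrow> count_list target (2, j, 0, 0) = 1" unfolding target by (simp add: zeros)
  have "count_list S3 (3, r, 0, 0) = A" if "r < N" for r
    unfolding S3_def using that by (subst count_concat_single[of _ r]) auto
  then show "r < N \<Longrightarrow> count_list target (3, r, 0, 0) = A" unfolding target by (simp add: zeros)
  have "count_list S4 (4, p) = A - init_symbol rs pre T' p" if "p \<in> CS" for p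
    unfolding S4_def using that distinct_cells unfolding set_cells[symmetric]
    by (subst count_concat_single[of _ p]) simp_all
  then show "p \<in> CS \<Longrightarrow> count_list target (4, p) = A - init_symbol rs pre T' p"
    unfolding target by (simp add: zeros)
  have "count_list S5 (5, p) = A" if "p \<in> CS" for p
    unfolding S5_def using that distinct_cells unfolding set_cells[symmetric]
    by (subst count_concat_single[of _ p]) simp_all
  then show "p \<in> CS \<Longrightarrow> count_list target (5, p) = A" unfolding target by (simp add: zeros)
  have "count_list S6 (6, r, i, 0) = A" if "r < N" "i < k" for r i
    unfolding S6_def using that dts by (subst count_concat_single[of _ "(r, i)"]) auto
  then show "r < N \<Longrightarrow> i < k \<Longrightarrow> count_list target (6, r, i, 0) = A" unfolding target by (simp add: zeros)
  have "count_list S7 (7, r, i, 0) = A" if "r < N" "i < k" for r i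
    unfolding S7_def using that dts by (subst count_concat_single[of _ "(r, i)"]) auto
  then show "r < N \<Longrightarrow> i < k \<Longrightarrow> count_list target (7, r, i, 0) = A" unfolding target by (simp add: zeros)
  have "count_list S8 (8, j, 0, 0) = A" if "j < U" for j
    unfolding S8_def using that by (subst count_concat_single[of _ j]) auto
  then show "j < U \<Longrightarrow> count_list target (8, j, 0, 0) = A" unfolding target by (simp add: zeros)
  show "count_list target (9, 0, 0, 0) = 2" unfolding target using A2 by (simp add: zeros)
qed

lemma init_symbol: "p \<in> CS \<Longrightarrow> init_symbol rs pre T' p =
    (if fst p = T' then start_symbol (fst (snd p)) (snd (snd p)) else 0)"
  by (auto simp: init_symbol_def start_symbol_def nth_default_append nth_default_def nth_append N)

lemma sum_CS:
  fixes h :: "nat \<times> nat \<times> nat \<Rightarrow> nat"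
  assumes "i < k"
  shows "(\<Sum>p\<in>CS. if fst p = r \<and> fst (snd p) = i \<and> P p then h p else 0)
    = (if r < N then \<Sum>j\<le>2 * Suc r. if P (r, i, j) then h (r, i, j) else 0 else 0)"
proof (cases "r < N")
  case True
  let ?S = "(\<lambda>j. (r, i, j)) ` {..2 * Suc r}"
  have "(\<Sum>p\<in>CS. if fst p = r \<and> fst (snd p) = i \<and> P p then h p else 0)
      = (\<Sum>p\<in>?S. if fst p = r \<and> fst (snd p) = i \<and> P p then h p else 0)"
    using True assms finite_CS by (intro sum.mono_neutral_right) auto
  also have "\<dots> = (\<Sum>j\<le>2 * Suc r. if P (r, i, j) then h (r, i, j) else 0)"
    by (subst sum.reindex) (auto simp: inj_on_def)
  finally show ?thesis using True by simp
next
  case False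
  then have "(\<Sum>p\<in>CS. if fst p = r \<and> fst (snd p) = i \<and> P p then h p else 0) = (\<Sum>p\<in>CS. 0)"
    by (intro sum.cong) auto
  with False show ?thesis by simp
qed

section \<open>Totals of the blocks that express equations\<close>

context
  fixes co cc cg
  assumes members: "members co cc cg"
begin

lemma bounds:
  "\<And>r. r < N \<Longrightarrow> fst (co r) \<le> A"
  "\<And>r. r < N \<Longrightarrow> fst (snd (co r)) \<le> A"
  "\<And>r. r < N \<Longrightarrow> length (snd (snd (co r))) = k"
  "\<And>r e. r < N \<Longrightarrow> e \<in> set (snd (snd (co r))) \<Longrightarrow> fst e \<le> A \<and> fst (snd e) \<le> A \<and> snd (snd e) \<le> A"
  "\<And>p. p \<in> CS \<Longrightarrow> fst (cc p) \<le> A \<and> fst (snd (cc p)) \<le> A \<and> snd (snd (cc p)) \<le> A"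
  "\<And>j. j < U \<Longrightarrow> fst (cg j) \<le> A \<and> fst (snd (cg j)) \<le> A \<and> snd (snd (cg j)) \<le> A"
proof -
  have co: "co r \<in> set (tm_opts M)" if "r < N" for r using members that by (auto simp: members_def)
  note ob = option_bounds[OF wf co]
  show "\<And>r. r < N \<Longrightarrow> fst (co r) \<le> A" "\<And>r. r < N \<Longrightarrow> fst (snd (co r)) \<le> A"
    "\<And>r. r < N \<Longrightarrow> length (snd (snd (co r))) = k"
    "\<And>r e. r < N \<Longrightarrow> e \<in> set (snd (snd (co r))) \<Longrightarrow> fst e \<le> A \<and> fst (snd e) \<le> A \<and> snd (snd e) \<le> A"
    using ob by blast+
  show "fst (cc p) \<le> A \<and> fst (snd (cc p)) \<le> A \<and> snd (snd (cc p)) \<le> A" if "p \<in> CS" for p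
  proof -
    have "cc p \<in> set (cell_opts M)" using members that unfolding members_def by blast
    then have "cc p \<in> {..<tm_symbols M} \<times> {..<tm_symbols M} \<times> {..<3}"
      by (simp add: cell_opts_def atLeast0LessThan)
    then show ?thesis by (auto simp: mem_Times_iff tm_bound_def)
  qed
  show "fst (cg j) \<le> A \<and> fst (snd (cg j)) \<le> A \<and> snd (snd (cg j)) \<le> A" if "j < U" for j
  proof -
    have "cg j \<in> set guess_opts" using members that unfolding members_def by blast
    then show ?thesis by (auto simp: guess_opts_def tm_bound_def)
  qed
qed

text \<open>The state before a step is contributed by slot \<open>r\<close> itself, the state after
  the preceding step by slot \<open>Suc r\<close>. The first step has no predecessor, and the
  missing summand is the initial state 0.\<close>

lemma total_3:
  assumes "r < N"
  shows "total co cc cg (3, r, 0, 0) = (A - fst (co r)) + (if r = T' then 0 else fst (snd (co (Suc r))))"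
proof -
  have "(\<Sum>s<N. count_list (step_con A rs js s (co s)) (3, r, 0, 0))
      = (\<Sum>s<N. (if s = r then A - fst (co s) else 0) + (if s = Suc r then fst (snd (co s)) else 0))"
    using assms bounds by (intro sum.cong refl) (simp add: count_step_con(4))
  also have "\<dots> = (A - fst (co r)) + (if r = T' then 0 else fst (snd (co (Suc r))))"
  proof -
    have "Suc r < N \<longleftrightarrow> r \<noteq> T'" using assms N by auto
    then show ?thesis using assms by (simp add: sum.distrib)
  qed
  finally show ?thesis
    using bounds by (simp add: total_def count_cell_con(4) count_guess_con(4))
qed

text \<open>The content of a cell meets what the cells of slot \<open>Suc r\<close> hand over. In
  the first step it meets the guesses; the known symbols are in the target.\<close>

lemma total_4:
  assumes "p \<in> CS" "p = (r, i, j)"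
  shows "total co cc cg (4, p) = (A - fst (cc p)) +
    (if r = T' then 0 else \<Sum>j'\<le>2 * Suc (Suc r). if j + snd (snd (cc (Suc r, i, j'))) = j'
       then fst (snd (cc (Suc r, i, j'))) else 0) + (if r = T' then guess_symbol cg i j else 0)"
proof -
  have "r < N \<and> i < k \<and> j \<le> 2 * Suc r"
    using assms(1) unfolding assms(2) by (simp only: mem_Collect_eq prod.case)
  moreover from this have "j < Suc (2 * N)" by auto
  ultimately have rij: "r < N" "i < k" "j < Suc (2 * N)" by blast+
  have "(\<Sum>q\<in>CS. count_list (cell_con A rs js (fst q) (fst (snd q)) (snd (snd q)) (cc q)) (4, p))
      = (\<Sum>q\<in>CS. (if q = p then A - fst (cc q) else 0) +
          (if fst q = Suc r \<and> fst (snd q) = i \<and> j + snd (snd (cc q)) = snd (snd q) then fst (snd (cc q)) else 0))"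
  proof (intro sum.cong refl)
    fix q assume "q \<in> CS"
    then have "fst (snd (cc q)) \<le> A" using bounds(5) by blast
    from count_cell_con(5)[OF this rij(1,3), of "fst q" "fst (snd q)" "snd (snd q)" i]
    show "count_list (cell_con A rs js (fst q) (fst (snd q)) (snd (snd q)) (cc q)) (4, p)
      = (if q = p then A - fst (cc q) else 0) +
        (if fst q = Suc r \<and> fst (snd q) = i \<and> j + snd (snd (cc q)) = snd (snd q) then fst (snd (cc q)) else 0)"
      by (cases q) (simp add: assms(2))
  qed
  also have "\<dots> = (A - fst (cc p)) +
    (if Suc r < N then \<Sum>j'\<le>2 * Suc (Suc r). if j + snd (snd (cc (Suc r, i, j'))) = j'
       then fst (snd (cc (Suc r, i, j'))) else 0 else 0)"
    unfolding sum.distrib sum_CS[OF rij(2), of "Suc r" "\<lambda>q. j + snd (snd (cc q)) = snd (snd q)"]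
    using assms(1) finite_CS by simp
  also have "Suc r < N \<longleftrightarrow> r \<noteq> T'" using rij(1) N by auto
  finally have 1: "(\<Sum>q\<in>CS. count_list (cell_con A rs js (fst q) (fst (snd q)) (snd (snd q)) (cc q)) (4, p))
      = (A - fst (cc p)) + (if r = T' then 0 else \<Sum>j'\<le>2 * Suc (Suc r).
          if j + snd (snd (cc (Suc r, i, j'))) = j' then fst (snd (cc (Suc r, i, j'))) else 0)"
    by simp
  have "(\<Sum>j'<U. count_list (guess_con A T' off j' (cg j')) (4, p))
      = (\<Sum>j'<U. if r = T' \<and> i = 0 \<and> j = off + j' then snd (snd (cg j')) else 0)"
    using bounds(6) by (intro sum.cong refl) (simp add: count_guess_con(5) assms(2))
  also have "\<dots> = (if r = T' then guess_symbol cg i j else 0)"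
  proof -
    have gs: "guess_symbol cg i j = (if i = 0 \<and> off \<le> j \<and> j < off + U then snd (snd (cg (j - off))) else 0)"
      by (simp add: guess_symbol_def N)
    \<comment> \<open>Only guess number \<open>j - off\<close> can write to the cell with index
      \<open>j\<close>.\<close>
    show ?thesis unfolding gs by (subst sum_single[of _ "j - off"]) auto
  qed
  finally have 2: "(\<Sum>j'<U. count_list (guess_con A T' off j' (cg j')) (4, p))
      = (if r = T' then guess_symbol cg i j else 0)" .
  have 3: "(\<Sum>s<N. count_list (step_con A rs js s (co s)) (4, p)) = 0"
    using bounds by (simp add: count_step_con(5))
  show ?thesis unfolding total_def 1 2 3 by simp
qed

lemma total_5:
  assumes "p \<in> CS" "p = (r, i, j)"
  shows "total co cc cg (5, p) = snd (snd (snd (snd (co r)) ! i)) + (A - snd (snd (cc p)))"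
proof -
  have "r < N \<and> i < k \<and> j \<le> 2 * Suc r"
    using assms(1) unfolding assms(2) by (simp only: mem_Collect_eq prod.case)
  moreover from this have "j \<in> set js" by auto
  ultimately have rij: "r < N" "i < k" "j \<in> set js" by blast+
  have "(\<Sum>s<N. count_list (step_con A rs js s (co s)) (5, p))
      = (\<Sum>s<N. if s = r then snd (snd (snd (snd (co s)) ! i)) else 0)"
    using rij bounds(1-4) unfolding assms(2)
    by (intro sum.cong refl) (subst count_step_con(6), auto)
  also have "\<dots> = snd (snd (snd (snd (co r)) ! i))" using rij by simp
  finally have 1: "(\<Sum>s<N. count_list (step_con A rs js s (co s)) (5, p)) = snd (snd (snd (snd (co r)) ! i))" .
  have "(\<Sum>q\<in>CS. count_list (cell_con A rs js (fst q) (fst (snd q)) (snd (snd q)) (cc q)) (5, p))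
      = (\<Sum>q\<in>CS. if q = p then A - snd (snd (cc q)) else 0)"
  proof (intro sum.cong refl)
    fix q assume "q \<in> CS"
    then have "fst (snd (cc q)) \<le> A" using bounds(5) by blast
    from count_cell_con(6)[OF this]
    show "count_list (cell_con A rs js (fst q) (fst (snd q)) (snd (snd q)) (cc q)) (5, p)
      = (if q = p then A - snd (snd (cc q)) else 0)" by auto
  qed
  also have "\<dots> = A - snd (snd (cc p))" using assms(1) finite_CS by simp
  finally show ?thesis
    using bounds(6) by (simp add: total_def 1 count_guess_con(6))
qed

lemma total_67:
  assumes "r < N" "i < k"
  shows "total co cc cg (6, r, i, 0) = fst (snd (snd (co r)) ! i) + (A - fst (cc (r, i, Suc r)))"
    "total co cc cg (7, r, i, 0) = fst (snd (snd (snd (co r)) ! i)) + (A - fst (snd (cc (r, i, Suc r))))"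
proof -
  let ?p = "(r, i, Suc r)"
  have p: "?p \<in> CS" using assms by simp
  have "(\<Sum>s<N. count_list (step_con A rs js s (co s)) (6, r, i, 0))
      = (\<Sum>s<N. if s = r then fst (snd (snd (co s)) ! i) else 0)"
    "(\<Sum>s<N. count_list (step_con A rs js s (co s)) (7, r, i, 0))
      = (\<Sum>s<N. if s = r then fst (snd (snd (snd (co s)) ! i)) else 0)"
    using assms bounds(1-4) by (auto intro!: sum.cong simp: count_step_con(7,8))
  then have 1: "(\<Sum>s<N. count_list (step_con A rs js s (co s)) (6, r, i, 0)) = fst (snd (snd (co r)) ! i)"
    "(\<Sum>s<N. count_list (step_con A rs js s (co s)) (7, r, i, 0)) = fst (snd (snd (snd (co r)) ! i))"
    using assms by simp_all
  have 67: "count_list (cell_con A rs js (fst q) (fst (snd q)) (snd (snd q)) (cc q)) (6, r, i, 0)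
      = (if q = ?p then A - fst (cc q) else 0) \<and>
      count_list (cell_con A rs js (fst q) (fst (snd q)) (snd (snd q)) (cc q)) (7, r, i, 0)
      = (if q = ?p then A - fst (snd (cc q)) else 0)" if "q \<in> CS" for q
  proof -
    have "fst (snd (cc q)) \<le> A" using bounds(5) that by blast
    from count_cell_con(7,8)[OF this, of N "Suc (2 * N)" "fst q" "fst (snd q)" "snd (snd q)" r i]
    show ?thesis by simp
  qed
  have "(\<Sum>q\<in>CS. count_list (cell_con A rs js (fst q) (fst (snd q)) (snd (snd q)) (cc q)) (6, r, i, 0))
      = (\<Sum>q\<in>CS. if q = ?p then A - fst (cc q) else 0)"
    "(\<Sum>q\<in>CS. count_list (cell_con A rs js (fst q) (fst (snd q)) (snd (snd q)) (cc q)) (7, r, i, 0))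
      = (\<Sum>q\<in>CS. if q = ?p then A - fst (snd (cc q)) else 0)"
    by (rule sum.cong[OF refl], use 67 in blast)+
  then have 2: "(\<Sum>q\<in>CS. count_list (cell_con A rs js (fst q) (fst (snd q)) (snd (snd q)) (cc q)) (6, r, i, 0))
      = A - fst (cc ?p)"
    "(\<Sum>q\<in>CS. count_list (cell_con A rs js (fst q) (fst (snd q)) (snd (snd q)) (cc q)) (7, r, i, 0))
      = A - fst (snd (cc ?p))"
    using p finite_CS by simp_all
  show "total co cc cg (6, r, i, 0) = fst (snd (snd (co r)) ! i) + (A - fst (cc (r, i, Suc r)))"
    "total co cc cg (7, r, i, 0) = fst (snd (snd (snd (co r)) ! i)) + (A - fst (snd (cc (r, i, Suc r))))"
    unfolding total_def 1 2 using bounds(6) by (simp_all add: count_guess_con(7,8))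
qed

lemma total_8:
  assumes "j < U"
  shows "total co cc cg (8, j, 0, 0) = (A - fst (cg j)) + (if j = 0 then 0 else fst (snd (cg (j - 1))))"
proof -
  have "(\<Sum>s<U. count_list (guess_con A T' off s (cg s)) (8, j, 0, 0))
      = (\<Sum>s<U. (if s = j then A - fst (cg s) else 0) + (if j = Suc s then fst (snd (cg s)) else 0))"
    using bounds(6) by (intro sum.cong refl) (simp add: count_guess_con(9))
  also have "\<dots> = (A - fst (cg j)) + (\<Sum>s<U. if j = Suc s then fst (snd (cg s)) else 0)"
    using assms by (simp add: sum.distrib)
  also have "(\<Sum>s<U. if j = Suc s then fst (snd (cg s)) else 0) = (if j = 0 then 0 else fst (snd (cg (j - 1))))"
    using assms by (subst sum_single[of _ "j - 1"]) auto
  finally show ?thesis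
    using bounds by (simp add: total_def count_step_con(9) count_cell_con(9))
qed

lemma total_9:
  "total co cc cg (9, 0, 0, 0)
    = (\<Sum>j\<le>2. if snd (snd (cc (0, 0, j))) = j then fst (snd (cc (0, 0, j))) else 0)"
proof -
  have k: "0 < k" using wf unfolding wf_tm_def by simp
  have "(\<Sum>q\<in>CS. count_list (cell_con A rs js (fst q) (fst (snd q)) (snd (snd q)) (cc q)) (9, 0, 0, 0))
      = (\<Sum>q\<in>CS. if fst q = 0 \<and> fst (snd q) = 0 \<and> snd (snd (cc q)) = snd (snd q) then fst (snd (cc q)) else 0)"
  proof (intro sum.cong refl)
    fix q assume "q \<in> CS"
    then have "fst (snd (cc q)) \<le> A" using bounds(5) by blast
    from count_cell_con(10)[OF this, of N "Suc (2 * N)" "fst q" "fst (snd q)" "snd (snd q)"]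
    show "count_list (cell_con A rs js (fst q) (fst (snd q)) (snd (snd q)) (cc q)) (9, 0, 0, 0)
      = (if fst q = 0 \<and> fst (snd q) = 0 \<and> snd (snd (cc q)) = snd (snd q) then fst (snd (cc q)) else 0)" .
  qed
  also have "\<dots> = (\<Sum>j\<le>2. if snd (snd (cc (0, 0, j))) = j then fst (snd (cc (0, 0, j))) else 0)"
    unfolding sum_CS[OF k, of 0 "\<lambda>q. snd (snd (cc q)) = snd (snd q)"]
    using N by (simp add: numeral_2_eq_2)
  finally show ?thesis
    using bounds by (simp add: total_def count_step_con(10) count_guess_con(10))
qed

end

text \<open>With \<open>x \<le> A\<close>, the equations \<open>(A - x) + y = A\<close> and \<open>x = y\<close> are equivalent.\<close>

lemma equations_iff:
  assumes members: "members co cc cg"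
  shows "(\<forall>b\<in>equations. total co cc cg b = count_list target b) \<longleftrightarrow>
     (\<forall>r<N. fst (co r) = (if r = T' then 0 else fst (snd (co (Suc r))))) \<and>
     (\<forall>(r, i, j)\<in>CS. snd (snd (cc (r, i, j))) = snd (snd (snd (snd (co r)) ! i))) \<and>
     (\<forall>r<N. \<forall>i<k. fst (cc (r, i, Suc r)) = fst (snd (snd (co r)) ! i)) \<and>
     (\<forall>r<N. \<forall>i<k. fst (snd (cc (r, i, Suc r))) = fst (snd (snd (snd (co r)) ! i))) \<and>
     (\<forall>(r, i, j)\<in>CS. fst (cc (r, i, j)) = (if r = T' then start_symbol i j + guess_symbol cg i j
        else \<Sum>j'\<le>2 * Suc (Suc r). if j + snd (snd (cc (Suc r, i, j'))) = j'
          then fst (snd (cc (Suc r, i, j'))) else 0)) \<and>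
     (\<forall>j<U. fst (cg j) = (if j = 0 then 0 else fst (snd (cg (j - 1))))) \<and>
     (\<Sum>j\<le>2. if snd (snd (cc (0, 0, j))) = j then fst (snd (cc (0, 0, j))) else 0) = 2"
proof -
  note bounds = bounds[OF members] and total_3 = total_3[OF members] and total_4 = total_4[OF members]
    and total_5 = total_5[OF members] and total_67 = total_67[OF members]
    and total_8 = total_8[OF members] and total_9 = total_9[OF members]
  let ?E = "\<lambda>b. total co cc cg b = count_list target b"
  have 3: "?E (3, r, 0, 0) \<longleftrightarrow> fst (co r) = (if r = T' then 0 else fst (snd (co (Suc r))))" if "r < N" for r
    unfolding total_3[OF that] count_target(4)[OF that] using bounds(1)[OF that] by auto
  have 4: "?E (4, r, i, j) \<longleftrightarrow> fst (cc (r, i, j)) = (if r = T' then start_symbol i j + guess_symbol cg i j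
        else \<Sum>j'\<le>2 * Suc (Suc r). if j + snd (snd (cc (Suc r, i, j'))) = j'
          then fst (snd (cc (Suc r, i, j'))) else 0)" if "(r, i, j) \<in> CS" for r i j
  proof -
    \<comment> \<open>These bounds make the truncated subtractions on both sides exact.\<close>
    have "start_symbol i j \<le> A" by (simp add: start_symbol_def bit_symbol_def tm_bound_def)
    moreover have "fst (cc (r, i, j)) \<le> A" using bounds(5)[OF that] by blast
    ultimately show ?thesis
      unfolding total_4[OF that refl] count_target(5)[OF that] init_symbol[OF that]
      by (cases "r = T'") auto
  qed
  have 5: "?E (5, r, i, j) \<longleftrightarrow> snd (snd (cc (r, i, j))) = snd (snd (snd (snd (co r)) ! i))"
    if "(r, i, j) \<in> CS" for r i j
  proof -
    have "snd (snd (cc (r, i, j))) \<le> A" using bounds(5)[OF that] by blast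
    then show ?thesis unfolding total_5[OF that refl] count_target(6)[OF that] by auto
  qed
  have 67: "?E (6, r, i, 0) \<longleftrightarrow> fst (cc (r, i, Suc r)) = fst (snd (snd (co r)) ! i)"
      "?E (7, r, i, 0) \<longleftrightarrow> fst (snd (cc (r, i, Suc r))) = fst (snd (snd (snd (co r)) ! i))"
    if "r < N" "i < k" for r i
  proof -
    have "(r, i, Suc r) \<in> CS" using that by simp
    from bounds(5)[OF this] have "fst (cc (r, i, Suc r)) \<le> A" "fst (snd (cc (r, i, Suc r))) \<le> A" by auto
    then show "?E (6, r, i, 0) \<longleftrightarrow> fst (cc (r, i, Suc r)) = fst (snd (snd (co r)) ! i)"
      "?E (7, r, i, 0) \<longleftrightarrow> fst (snd (cc (r, i, Suc r))) = fst (snd (snd (snd (co r)) ! i))"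
      unfolding total_67[OF that] count_target(7,8)[OF that] by auto
  qed
  have 8: "?E (8, j, 0, 0) \<longleftrightarrow> fst (cg j) = (if j = 0 then 0 else fst (snd (cg (j - 1))))" if "j < U" for j
    unfolding total_8[OF that] count_target(9)[OF that] using bounds(6)[OF that] by auto
  have "(\<forall>b\<in>equations. ?E b) \<longleftrightarrow> (\<forall>r<N. ?E (3, r, 0, 0)) \<and> (\<forall>p\<in>CS. ?E (5, p)) \<and>
      (\<forall>r<N. \<forall>i<k. ?E (6, r, i, 0)) \<and> (\<forall>r<N. \<forall>i<k. ?E (7, r, i, 0)) \<and> (\<forall>p\<in>CS. ?E (4, p)) \<and>
      (\<forall>j<U. ?E (8, j, 0, 0)) \<and> ?E (9, 0, 0, 0)"
    unfolding equations_def ball_Un by (auto simp del: mult_Suc_right)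
  also have "(\<forall>p\<in>CS. ?E (5, p))
      \<longleftrightarrow> (\<forall>(r, i, j)\<in>CS. snd (snd (cc (r, i, j))) = snd (snd (snd (snd (co r)) ! i)))"
    using 5 by (intro ball_cong refl) (auto simp del: mult_Suc_right)
  also have "(\<forall>p\<in>CS. ?E (4, p)) \<longleftrightarrow> (\<forall>(r, i, j)\<in>CS. fst (cc (r, i, j)) =
      (if r = T' then start_symbol i j + guess_symbol cg i j
        else \<Sum>j'\<le>2 * Suc (Suc r). if j + snd (snd (cc (Suc r, i, j'))) = j'
          then fst (snd (cc (Suc r, i, j'))) else 0))"
    using 4 by (intro ball_cong refl) (auto simp del: mult_Suc_right)
  finally show ?thesis
    unfolding total_9 count_target(10) using 3 67 8 by simp
qed

lemma choices_iff:
  "((0, r, 0, 0), x) \<in> set choices \<longleftrightarrow> r < N \<and> (\<exists>opt\<in>set (tm_opts M). x = Step opt)"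
  "((1, p), x) \<in> set choices \<longleftrightarrow> p \<in> CS \<and> (\<exists>e\<in>set (cell_opts M). x = Cell e \<and>
     (snd (snd p) = Suc (fst p) \<or> fst (snd e) = fst e))"
  "((2, j, 0, 0), x) \<in> set choices \<longleftrightarrow> j < U \<and> (\<exists>e\<in>set guess_opts. x = Guess e)"
proof -
  show "((0, r, 0, 0), x) \<in> set choices \<longleftrightarrow> r < N \<and> (\<exists>opt\<in>set (tm_opts M). x = Step opt)"
    by (auto simp: choices_def image_iff)
  show "((2, j, 0, 0), x) \<in> set choices \<longleftrightarrow> j < U \<and> (\<exists>e\<in>set guess_opts. x = Guess e)"
    by (auto simp: choices_def image_iff)
  have "((1, p), x) \<in> set choices \<longleftrightarrow> (\<exists>z\<in>set (cell_choices M rs js). p = fst z \<and> x = Cell (snd z))"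
    by (simp add: choices_def image_iff)
  also have "\<dots> \<longleftrightarrow> (\<exists>e. (p, e) \<in> set (cell_choices M rs js) \<and> x = Cell e)"
    by (metis fst_conv prod.collapse snd_conv)
  also have "\<dots> \<longleftrightarrow> p \<in> CS \<and> (\<exists>e\<in>set (cell_opts M). x = Cell e \<and>
     (snd (snd p) = Suc (fst p) \<or> fst (snd e) = fst e))"
    unfolding cell_choices_def set_filter set_product set_cells by (simp only: mem_Collect_eq mem_Sigma_iff fst_conv snd_conv) blast
  finally show "((1, p), x) \<in> set choices \<longleftrightarrow> p \<in> CS \<and> (\<exists>e\<in>set (cell_opts M). x = Cell e \<and>
     (snd (snd p) = Suc (fst p) \<or> fst (snd e) = fst e))" .
qed

lemma slots_cases:
  assumes "v \<in> slots"
  obtains r where "v = (0, r, 0, 0)" "r < N" | p where "v = (1, p)" "p \<in> CS"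
    | j where "v = (2, j, 0, 0)" "j < U"
  using assms unfolding slots_def by blast

lemma choices_cases:
  assumes "l \<in> set choices"
  obtains r opt where "l = ((0, r, 0, 0), Step opt)" "r < N" "opt \<in> set (tm_opts M)"
    | p e where "l = ((1, p), Cell e)" "p \<in> CS" "e \<in> set (cell_opts M)"
    | j e where "l = ((2, j, 0, 0), Guess e)" "j < U" "e \<in> set guess_opts"
proof -
  have "\<exists>v x. l = (v, x)" by simp
  then obtain v x where l: "l = (v, x)" by blast
  have "(\<exists>r. v = (0, r, 0, 0)) \<or> (\<exists>p. v = (1, p)) \<or> (\<exists>j. v = (2, j, 0, 0))"
    using assms unfolding l choices_def by auto
  then consider r where "v = (0, r, 0, 0)" | p where "v = (1, p)" | j where "v = (2, j, 0, 0)" by blast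
  then show thesis
  proof cases
    case 1
    then show ?thesis using assms that(1) unfolding l 1 choices_iff(1) by blast
  next
    case 2
    then show ?thesis using assms that(2) unfolding l 2 choices_iff(2) by blast
  next
    case 3
    then show ?thesis using assms that(3) unfolding l 3 choices_iff(3) by blast
  qed
qed

lemma sum_slots:
  fixes f :: "blk \<Rightarrow> nat"
  shows "(\<Sum>v\<in>slots. f v) = (\<Sum>r<N. f (0, r, 0, 0)) + (\<Sum>p\<in>CS. f (1, p)) + (\<Sum>j<U. f (2, j, 0, 0))"
proof -
  have "(\<Sum>v\<in>slots. f v) = (\<Sum>v\<in>(\<lambda>r. (0, r, 0, 0)) ` {..<N}. f v) + (\<Sum>v\<in>Pair 1 ` CS. f v) +
      (\<Sum>v\<in>(\<lambda>j. (2, j, 0, 0)) ` {..<U}. f v)"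
    unfolding slots_def using finite_CS
    by (subst sum.union_disjoint; (subst sum.union_disjoint)?) auto
  also have "\<dots> = (\<Sum>r<N. f (0, r, 0, 0)) + (\<Sum>p\<in>CS. f (1, p)) + (\<Sum>j<U. f (2, j, 0, 0))"
    by (simp add: sum.reindex inj_on_def)
  finally show ?thesis .
qed

lemma unit_blocks:
  assumes "l \<in> set choices" "v \<in> slots"
  shows "count_list (con l) v = (if fst l = v then 1 else 0)"
  using assms(1)
proof (cases rule: choices_cases)
  case (1 r opt)
  note b = option_bounds[OF wf 1(3)]
  from assms(2) show ?thesis
    by (cases rule: slots_cases) (auto simp: 1(1) con_def count_step_con[OF b(1,2,4)] simp del: One_nat_def)
next
  case (2 p e)
  have "fst (snd e) \<le> A" using 2(3) by (auto simp: cell_opts_def tm_bound_def)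
  from assms(2) show ?thesis
    by (cases rule: slots_cases) (auto simp: 2(1) con_def count_cell_con[OF \<open>fst (snd e) \<le> A\<close>] simp del: One_nat_def)
next
  case (3 j e)
  have "fst (snd e) \<le> A" "snd (snd e) \<le> A" using 3(3) by (auto simp: guess_opts_def tm_bound_def)
  from assms(2) show ?thesis
    by (cases rule: slots_cases) (auto simp: 3(1) con_def count_guess_con[OF \<open>fst (snd e) \<le> A\<close> \<open>snd (snd e) \<le> A\<close>] simp del: One_nat_def)
qed

lemma vector_sum_members:
  "vector_sum (tm_items M rs js us T' off) (tm_blocks M rs js us) target \<longleftrightarrow>
    (\<exists>co cc cg. members co cc cg \<and> (\<forall>b\<in>equations. total co cc cg b = count_list target b))"
proof -
  have fin: "finite slots" unfolding slots_def using finite_CS by simp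
  have sub: "fst ` set choices \<subseteq> slots"
  proof (intro image_subsetI)
    fix l assume "l \<in> set choices"
    then show "fst l \<in> slots"
      by (cases rule: choices_cases) (auto simp: slots_def simp del: mult_Suc_right)
  qed
  have tgt: "count_list target v = 1" if "v \<in> slots" for v
    using that by (cases rule: slots_cases) (simp_all only: count_target(1-3))
  have blocks: "set (tm_blocks M rs js us) = (\<lambda>v. v) ` slots \<union> equations"
    by (simp add: set_blocks)
  have "vector_sum (map con choices) (tm_blocks M rs js us) target \<longleftrightarrow>
    (\<exists>c. (\<forall>v\<in>slots. (v, c v) \<in> set choices) \<and>
      (\<forall>b\<in>equations. (\<Sum>v\<in>slots. count_list (con (v, c v)) b) = count_list target b))"
    by (rule vector_sum_choice[OF distinct_choices sub fin unit_blocks tgt blocks])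
  also have "\<dots> \<longleftrightarrow> (\<exists>co cc cg. members co cc cg \<and> (\<forall>b\<in>equations. total co cc cg b = count_list target b))"
    (is "?L \<longleftrightarrow> ?R")
  proof
    assume ?L
    then obtain c where c: "\<And>v. v \<in> slots \<Longrightarrow> (v, c v) \<in> set choices"
      "\<And>b. b \<in> equations \<Longrightarrow> (\<Sum>v\<in>slots. count_list (con (v, c v)) b) = count_list target b" by blast
    have "\<exists>opt. c (0, r, 0, 0) = Step opt \<and> opt \<in> set (tm_opts M)" if "r < N" for r
    proof -
      have "(0, r, 0, 0) \<in> slots" unfolding slots_def using that by blast
      from c(1)[OF this] show ?thesis unfolding choices_iff(1) by blast
    qed
    then have "\<exists>co. \<forall>r. r < N \<longrightarrow> c (0, r, 0, 0) = Step (co r) \<and> co r \<in> set (tm_opts M)"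
      by (rule choice_on)
    then obtain co where co: "\<And>r. r < N \<Longrightarrow> c (0, r, 0, 0) = Step (co r) \<and> co r \<in> set (tm_opts M)"
      by blast
    have "\<exists>e. c (1, p) = Cell e \<and> e \<in> set (cell_opts M) \<and> (snd (snd p) = Suc (fst p) \<or> fst (snd e) = fst e)"
      if "p \<in> CS" for p
    proof -
      have "(1, p) \<in> slots" unfolding slots_def using that by blast
      from c(1)[OF this] show ?thesis unfolding choices_iff(2) by blast
    qed
    then have "\<exists>cc. \<forall>p. p \<in> CS \<longrightarrow> c (1, p) = Cell (cc p) \<and> cc p \<in> set (cell_opts M) \<and>
      (snd (snd p) = Suc (fst p) \<or> fst (snd (cc p)) = fst (cc p))"
      by (rule choice_on)
    then obtain cc where cc: "\<And>p. p \<in> CS \<Longrightarrow> c (1, p) = Cell (cc p) \<and> cc p \<in> set (cell_opts M) \<and>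
      (snd (snd p) = Suc (fst p) \<or> fst (snd (cc p)) = fst (cc p))"
      by blast
    have "\<exists>e. c (2, j, 0, 0) = Guess e \<and> e \<in> set guess_opts" if "j < U" for j
    proof -
      have "(2, j, 0, 0) \<in> slots" unfolding slots_def using that by blast
      from c(1)[OF this] show ?thesis unfolding choices_iff(3) by blast
    qed
    then have "\<exists>cg. \<forall>j. j < U \<longrightarrow> c (2, j, 0, 0) = Guess (cg j) \<and> cg j \<in> set guess_opts"
      by (rule choice_on)
    then obtain cg where cg: "\<And>j. j < U \<Longrightarrow> c (2, j, 0, 0) = Guess (cg j) \<and> cg j \<in> set guess_opts"
      by blast
    have "members co cc cg" unfolding members_def using co cc cg N by blast
    moreover have "(\<Sum>v\<in>slots. count_list (con (v, c v)) b) = total co cc cg b" for b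
      unfolding sum_slots total_def
      by (intro arg_cong2[of _ _ _ _ "(+)"] sum.cong refl) (use co cc cg in \<open>simp_all add: con_def del: mult_Suc_right\<close>)
    ultimately show ?R using c(2) by (intro exI[of _ co] exI[of _ cc] exI[of _ cg]) simp
  next
    assume ?R
    then obtain co cc cg where m: "members co cc cg"
      "\<And>b. b \<in> equations \<Longrightarrow> total co cc cg b = count_list target b" by blast
    define c where "c v = (if fst v = 0 then Step (co (fst (snd v))) else if fst v = 1 then Cell (cc (snd v))
      else Guess (cg (fst (snd v))))" for v :: blk
    have "(v, c v) \<in> set choices" if "v \<in> slots" for v
      using that
    proof (cases rule: slots_cases)
      case (1 r)
      then show ?thesis using m(1) by (auto simp: choices_iff c_def members_def)
    next
      case (2 p)
      then have "cc p \<in> set (cell_opts M) \<and> (snd (snd p) = Suc (fst p) \<or> fst (snd (cc p)) = fst (cc p))"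
        using m(1) unfolding members_def by blast
      then show ?thesis unfolding 2(1) choices_iff(2) using 2(2) by (simp add: c_def)
    next
      case (3 j)
      then show ?thesis using m(1) by (auto simp: choices_iff c_def members_def)
    qed
    moreover have "(\<Sum>v\<in>slots. count_list (con (v, c v)) b) = total co cc cg b" for b
      unfolding sum_slots total_def by (simp add: con_def c_def)
    ultimately show ?L using m(2) by (intro exI[of _ c]) simp
  qed
  finally show ?thesis unfolding items_choices .
qed

lemma csp_iff:
  "csp co (\<lambda>r i j. cc (r, i, j)) cg \<longleftrightarrow>
     members co cc cg \<and> (\<forall>b\<in>equations. total co cc cg b = count_list target b)"
proof -
  have CS: "(\<forall>p\<in>CS. P p) \<longleftrightarrow> (\<forall>r<N. \<forall>i<k. \<forall>j\<le>2 * Suc r. P (r, i, j))" for P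
    by (auto simp del: mult_Suc_right)
  \<comment> \<open>The equations are compared under the assumption of membership, which provides
    the bounds on which \<open>equations_iff\<close> rests.\<close>
  have gen: "(a \<and> b \<and> c \<and> d) = ((a \<and> b \<and> c) \<and> e)" if "a \<and> b \<and> c \<Longrightarrow> d = e" for a b c d e
    using that by blast
  note eq = equations_iff[of co cc cg, unfolded members_def CS prod.case fst_conv snd_conv, symmetric]
  show ?thesis
    unfolding csp_def N[symmetric] members_def CS fst_conv snd_conv by (rule gen, rule eq, assumption)
qed

lemma vector_sum_run:
  "vector_sum (tm_items M rs js us T' off) (tm_blocks M rs js us) target \<longleftrightarrow>
    (\<exists>u. length u \<le> U \<and> cell (conf (pre @ u) 0) 0 0 0 = 2)"
proof -
  have "(\<exists>co cc cg. csp co cc cg) \<longleftrightarrow> (\<exists>co cc cg. csp co (\<lambda>r i j. cc (r, i, j)) cg)"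
  proof
    assume "\<exists>co cc cg. csp co cc cg"
    then obtain co cc cg where "csp co cc cg" by blast
    then have "csp co (\<lambda>r i j. (\<lambda>p. cc (fst p) (fst (snd p)) (snd (snd p))) (r, i, j)) cg" by simp
    then show "\<exists>co cc cg. csp co (\<lambda>r i j. cc (r, i, j)) cg"
      by (rule exI[of _ cg, THEN exI[of _ "\<lambda>p. cc (fst p) (fst (snd p)) (snd (snd p))"], THEN exI[of _ co]])
  qed blast
  then show ?thesis
    unfolding vector_sum_members csp_iff[symmetric] using csp_sound csp_complete by blast
qed

end

section \<open>The reduction\<close>

text \<open>Halting configurations persist, so the answer is still visible after \<open>T\<close>
  steps. With no step remaining, the window consists of the scanned cell alone.\<close>

lemma (in tableau) cell_accept:
  assumes "tm_computes M w [b] n" "n \<le> T"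
  shows "cell (conf w 0) 0 0 0 = bit_symbol b"
proof -
  obtain ts where ts: "(tm_step M ^^ n) (init_config M w) = (1, ts)" "tape_output (hd ts) [b]"
    using assms(1) unfolding tm_computes_def by blast
  have "(tm_step M ^^ m) (1, ts) = (1, ts)" for m by (induction m) simp_all
  then have "(tm_step M ^^ (T - n + n)) (init_config M w) = (1, ts)"
    unfolding funpow_add comp_apply ts(1) .
  then have conf: "conf w 0 = (1, ts)" using assms(2) by (simp add: conf_def)
  have "ts \<noteq> []" using wf_conf[of w 0] wf by (auto simp: conf wf_config_def wf_tm_def)
  then have "hd ts = ts ! 0" by (rule hd_conv_nth)
  then show ?thesis using ts(2) by (cases "ts ! 0") (simp add: cell_def conf)
qed

section \<open>The tables are computable in polynomial time\<close>

lemma pt_product [pt_intros]: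
  assumes "pt l" "pt m" shows "pt (\<lambda>x. List.product (l x) (m x))"
  unfolding product_concat_map by (intro pt_intros assms pt_comp[OF assms(2)])

lemma pt_times_upto [pt_intros]:
  assumes "pt n" "pt b" shows "pt (\<lambda>x. times_upto A (n x) (b x))"
  unfolding times_upto_def by (intro pt_intros assms pt_comp[OF assms(1)] pt_comp[OF assms(2)])

lemma pt_times_from [pt_intros]:
  assumes "pt n" "pt b" shows "pt (\<lambda>x. times_from A (n x) (b x))"
  unfolding times_from_def by (intro pt_intros assms pt_comp[OF assms(1)] pt_comp[OF assms(2)])

lemma pt_step_con [pt_intros]:
  assumes "pt rs" "pt js" "pt r" "pt opt"
  shows "pt (\<lambda>x. step_con A (rs x) (js x) (r x) (opt x))"
  unfolding step_con_def
  by (intro pt_intros assms pt_comp[OF assms(1)] pt_comp[OF assms(2)] pt_comp[OF assms(3)] pt_comp[OF assms(4)])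

lemma pt_cell_con [pt_intros]:
  assumes "pt rs" "pt js" "pt r" "pt i" "pt j" "pt e"
  shows "pt (\<lambda>x. cell_con A (rs x) (js x) (r x) (i x) (j x) (e x))"
  unfolding cell_con_def
  by (intro pt_intros assms pt_comp[OF assms(1)] pt_comp[OF assms(2)] pt_comp[OF assms(3)]
    pt_comp[OF assms(4)] pt_comp[OF assms(5)] pt_comp[OF assms(6)])

lemma pt_guess_con [pt_intros]:
  assumes "pt t" "pt off" "pt j" "pt e"
  shows "pt (\<lambda>x. guess_con A (t x) (off x) (j x) (e x))"
  unfolding guess_con_def by (intro pt_intros assms)

lemma pt_cells [pt_intros]:
  assumes "pt rs" "pt js" shows "pt (\<lambda>x. cells k (rs x) (js x))"
  unfolding cells_def by (intro pt_intros assms)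

lemma pt_cell_choices [pt_intros]:
  assumes "pt rs" "pt js" shows "pt (\<lambda>x. cell_choices M (rs x) (js x))"
  unfolding cell_choices_def by (intro pt_intros assms)

text \<open>The machine is fixed, so its list of options and \<open>tm_bound M\<close> are constants
  for the rules.\<close>

lemma pt_tm_items [pt_intros]:
  assumes "pt rs" "pt js" "pt us" "pt t" "pt off"
  shows "pt (\<lambda>x. tm_items M (rs x) (js x) (us x) (t x) (off x))"
  unfolding tm_items_def
  by (intro pt_intros assms pt_comp[OF assms(1)] pt_comp[OF assms(2)] pt_comp[OF assms(4)] pt_comp[OF assms(5)])

lemma pt_tm_blocks [pt_intros]:
  assumes "pt rs" "pt js" "pt us" shows "pt (\<lambda>x. tm_blocks M (rs x) (js x) (us x))"
  unfolding tm_blocks_def Let_def by (intro pt_intros assms)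

lemma pt_init_symbol [pt_intros]:
  assumes "pt rs" "pt pre" "pt t" "pt p"
  shows "pt (\<lambda>x. init_symbol (rs x) (pre x) (t x) (p x))"
  unfolding init_symbol_def bit_symbol_def by (intro pt_intros assms)

lemma pt_tm_target [pt_intros]:
  assumes "pt rs" "pt js" "pt us" "pt pre" "pt t"
  shows "pt (\<lambda>x. tm_target M (rs x) (js x) (us x) (pre x) (t x))"
  unfolding tm_target_def Let_def
  by (intro pt_intros assms pt_comp[OF assms(1)] pt_comp[OF assms(4)] pt_comp[OF assms(5)])

theorem NP_hard_ILMTP_SD: "NP_hard ILMTP_SD"
  unfolding NP_hard_def
proof
  fix A assume "A \<in> NP"
  then obtain R and p :: "nat poly" where "polytime_decidable R"
    and A: "\<And>x. x \<in> A \<longleftrightarrow> (\<exists>u. length u \<le> poly p (length x) \<and> enc_pair x u \<in> R)"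
    unfolding NP_def by blast
  then obtain M and q :: "nat poly" where wf: "wf_tm M"
    and M: "\<And>w. tm_computes M w [w \<in> R] (poly q (length w))"
    unfolding polytime_decidable_def polytime_def by blast
  \<comment> \<open>\<open>enc_pair x u\<close> is \<open>pre x @ u\<close>: a known prefix followed
    by the bare certificate.\<close>
  define pre where "pre x = enc_list (\<lambda>b :: bool. [b]) x" for x
  \<comment> \<open>The pair has length at most \<open>2 * n + 1 + poly p n\<close> for inputs of
    length \<open>n\<close>; the running time \<open>q\<close> is evaluated there.\<close>
  define steps where "steps = pcompose q ([:1, 2:] + p)"
  \<comment> \<open>Unary numbers as lists, from which \<open>pt_upt_length\<close> builds the
    ranges below.\<close>
  define unary where "unary s x = replicate (poly s (length x)) ()" for s and x :: "bool list"
  \<comment> \<open>With \<open>T'\<close> for the value of \<open>steps\<close>, there are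
    \<open>Suc T'\<close> rows, and the widest window has the indices up to
    \<open>2 * Suc T'\<close>.\<close>
  define rs where "rs x = [0..<length (unary (steps + 1) x)]" for x
  define js where "js x = [0..<length (unary (2 * steps + 3) x)]" for x
  define us where "us x = [0..<length (unary p x)]" for x
  define t where "t x = length (unary steps x)" for x
  define off where "off x = length (unary (steps + 1) x) + length (pre x)" for x
  define f where "f x = enc_ilmtp (vector_instance (tm_items M (rs x) (js x) (us x) (t x) (off x))
    (tm_blocks M (rs x) (js x) (us x)) (tm_target M (rs x) (js x) (us x) (pre x) (t x)))" for x
  have pt_unary: "pt (\<lambda>x. unary s x)" for s
    unfolding unary_def by (intro pt_intros)
  have "pt f"
    unfolding f_def rs_def js_def us_def t_def off_def pre_def
    by (intro pt_enc_vector_instance pt_intros pt_unary)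
  then have "polytime f" by (rule polytime_pt)
  moreover have "x \<in> A \<longleftrightarrow> f x \<in> ILMTP_SD" for x
  proof -
    define T' where "T' = poly steps (length x)"
    define U where "U = poly p (length x)"
    interpret tableau_vectors M T' U "pre x" "Suc T'"
      by unfold_locales (simp_all add: wf)
    have eqs: "rs x = [0..<Suc T']" "js x = [0..<Suc (2 * Suc T')]" "us x = [0..<U]" "t x = T'"
        "off x = Suc T' + length (pre x)"
      by (simp_all add: rs_def js_def us_def t_def off_def unary_def T'_def U_def numeral_3_eq_3)
    have "f x \<in> ILMTP_SD \<longleftrightarrow> has_feasible_solution (vector_instance
        (tm_items M (rs x) (js x) (us x) (t x) (off x)) (tm_blocks M (rs x) (js x) (us x))
        (tm_target M (rs x) (js x) (us x) (pre x) (t x)))"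
      unfolding f_def ILMTP_SD_def inj_image_mem_iff[OF inj_enc_ilmtp] mem_Collect_eq
      using valid_vector_instance by blast
    also have "\<dots> \<longleftrightarrow> vector_sum (tm_items M (rs x) (js x) (us x) (t x) (off x))
        (tm_blocks M (rs x) (js x) (us x)) (tm_target M (rs x) (js x) (us x) (pre x) (t x))"
      \<comment> \<open>The unit block of the step slot 0 exists because there is at least one row;
        it occurs both in the blocks and in the target.\<close>
      by (rule feasible_vector_instance[symmetric, where b = "(0, 0, 0, 0)"])
        (auto simp: eqs(1) tm_blocks_def tm_target_def Let_def simp del: upt_Suc)
    also have "\<dots> \<longleftrightarrow> (\<exists>u. length u \<le> U \<and> cell (conf (pre x @ u) 0) 0 0 0 = 2)"
      unfolding eqs by (rule vector_sum_run)
    also have "\<dots> \<longleftrightarrow> (\<exists>u. length u \<le> U \<and> enc_pair x u \<in> R)"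
    proof -
      have "cell (conf (pre x @ u) 0) 0 0 0 = 2 \<longleftrightarrow> enc_pair x u \<in> R" if "length u \<le> U" for u
      proof -
        have "length (pre x) = 2 * length x + 1"
          by (simp add: pre_def length_enc_list sum_list_triv)
        then have "length (enc_pair x u) \<le> 2 * length x + 1 + U"
          using that by (simp add: enc_pair_def pre_def)
        then have "poly q (length (enc_pair x u)) \<le> T'"
          by (auto simp: T'_def U_def steps_def poly_pcompose mult.commute intro!: poly_nat_mono)
        then have "cell (conf (enc_pair x u) 0) 0 0 0 = bit_symbol (enc_pair x u \<in> R)"
          by (intro cell_accept[OF M]) simp
        then show ?thesis by (simp add: enc_pair_def pre_def bit_symbol_def)
      qed
      then show ?thesis by blast
    qed
    finally show ?thesis unfolding A U_def by simp
  qed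
  ultimately show "polytime_reducible A ILMTP_SD" unfolding polytime_reducible_def by blast
qed

theorem theorem1: "NP_complete ILMTP_SD"
  unfolding NP_complete_def using ILMTP_SD_in_NP NP_hard_ILMTP_SD by blast

end
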